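(* Let $d\in\mathbb{N}$, let $a<b$ be real numbers, let $P_1=P_1^*\in\mathbb{R}^{d\times d}$ be invertible, $P_0=-P_0^*\in\mathbb{R}^{d\times d}$, and let $\mathcal{H}\colon(a,b)\to\mathbb{R}^{d\times d}$ be measurable such that there are $m,M_0>0$ with $m\le \mathcal{H}(x)=\mathcal{H}(x)^*\le M_0$ for all $x\in(a,b)$. Let $W\in\mathbb{R}^{d\times 2d}$ have rank $d$ and satisfy $$W\begin{pmatrix}P_1&-P_1\\1_d&1_d\end{pmatrix}^{-1}\begin{pmatrix}0&1_d\\1_d&0\end{pmatrix}\left(W\begin{pmatrix}P_1&-P_1\\1_d&1_d\end{pmatrix}^{-1}\right)^*\ge 0.$$ Let $H$ be the Hilbert space $L_2(a,b)^d$ with inner product $\langle u,v\rangle_H=\langle\mathcal{H}u,v\rangle_{L_2}$ and let $\mathcal{A}\colon\operatorname{dom}(\mathcal{A})\subseteq H\to H$ be given by $\mathcal{A}u=P_1(\mathcal{H}u)'+P_0\mathcal{H}u$ with $$\operatorname{dom}(\mathcal{A})=\left\{u\in H\,;\ \mathcal{H}u\in H^1(a,b)^d,\ W\begin{pmatrix}(\mathcal{H}u)(b)\\(\mathcal{H}u)(a)\end{pmatrix}=0\right\}.$$ Assume that $\mathcal{A}$ is $m$-dissipative, i.e. generates a contraction semigroup. For $t\in\mathbb{R}$ let $\Phi_t\colon[a,b]\to\mathbb{C}^{d\times d}$ be the fundamental solution of $$u'(x)=P_1^{-1}\big(\mathrm{i}t\mathcal{H}(x)^{-1}-P_0\big)u(x)\quad(x\in(a,b))$$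 with $\Phi_t(a)=1_d$, and assume that $\sup_{t\in\mathbb{R}}\sup_{x\in(a,b)}\|\Phi_t(x)\|<\infty$. Then the following conditions are equivalent: (i) $\mathcal{A}$ generates an exponentially stable $C_0$-semigroup. (ii) For all $t\in\mathbb{R}$ the matrix $T_t:=W\begin{pmatrix}\Phi_t(b)\\1_d\end{pmatrix}$ is invertible, and $\sup_{t\in\mathbb{R}}\|T_t^{-1}\|<\infty$.
   Context: $1_d$ is the $d\times d$ identity matrix. $L_2(a,b)^d$ and $H^1(a,b)^d$ consist of $\mathbb{R}^d$-valued functions; derivatives are weak derivatives. Inequalities between matrices are in the sense of positive (semi-)definiteness. A $C_0$-semigroup $(S(t))_{t\ge0}$ is exponentially stable if there are $C\ge1$, $\omega>0$ with $\|S(t)\|\le C\mathrm{e}^{-\omega t}$ for all $t\ge0$. The fundamental solution $\Phi_t$ is the matrix-valued (absolutely continuous) solution of the ODE with the stated initial value. *)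

theory Defs
  imports "HOL-Analysis.Analysis"
begin

section \<open>Matrices\<close>

text \<open>Stacking on top of each other. A matrix is a vector of its rows, so this stacks vectors
  as well as matrices.\<close>

definition vstack :: "'e^'p \<Rightarrow> 'e^'q \<Rightarrow> 'e^('p + 'q)" where
  "vstack A B = (\<chi> i. case i of Inl j \<Rightarrow> A $ j | Inr j \<Rightarrow> B $ j)"

definition block_mat ::
  "'a^'m^'p \<Rightarrow> 'a^'n^'p \<Rightarrow> 'a^'m^'q \<Rightarrow> 'a^'n^'q \<Rightarrow> 'a^('m + 'n)^('p + 'q)" where
  "block_mat A B C D = vstack (\<chi> i. vstack (A $ i) (B $ i)) (\<chi> i. vstack (C $ i) (D $ i))"

definition psd :: "real^'n^'n \<Rightarrow> bool" where
  "psd A \<longleftrightarrow> transpose A = A \<and> (\<forall>v. 0 \<le> v \<bullet> (A *v v))"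

definition cmat :: "real^'n^'m \<Rightarrow> complex^'n^'m" where
  "cmat = map_matrix complex_of_real"

text \<open>The operator norm with respect to the Euclidean norms.\<close>

definition op_norm :: "complex^'n^'m \<Rightarrow> real" where
  "op_norm A = onorm (\<lambda>v. A *v v)"


section \<open>Function spaces on a bounded interval\<close>

text \<open>Functions are total on the real line, but only their restrictions to the open interval
  from \<open>a\<close> to \<open>b\<close> matter. Elements of \<open>L\<^sub>2\<close> are represented by functions; two representatives
  are identified when the (semi)norm of their difference vanishes, that is, when they agree
  almost everywhere on the interval.\<close>

definition L2 :: "real \<Rightarrow> real \<Rightarrow> (real \<Rightarrow> 'e::euclidean_space) set" where
  "L2 a b = {u. u \<in> borel_measurable (lebesgue_on {a<..<b}) \<and>
                integrable (lebesgue_on {a<..<b}) (\<lambda>x. (norm (u x))\<^sup>2)}"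

definition locally_integrable :: "real \<Rightarrow> real \<Rightarrow> (real \<Rightarrow> 'e::euclidean_space) \<Rightarrow> bool" where
  "locally_integrable a b f \<longleftrightarrow>
     (\<forall>c d. a < c \<longrightarrow> d < b \<longrightarrow> set_integrable lebesgue {c..d} f)"

text \<open>Smooth functions with compact support in the open interval.\<close>

definition test_function :: "real \<Rightarrow> real \<Rightarrow> (real \<Rightarrow> real) \<Rightarrow> bool" where
  "test_function a b \<phi> \<longleftrightarrow>
     (\<forall>n. (deriv ^^ n) \<phi> differentiable_on UNIV) \<and>
     (\<exists>c d. a < c \<and> d < b \<and> (\<forall>x. x \<notin> {c..d} \<longrightarrow> \<phi> x = 0))"

definition has_weak_deriv ::
  "real \<Rightarrow> real \<Rightarrow> (real \<Rightarrow> 'e::euclidean_space) \<Rightarrow> (real \<Rightarrow> 'e) \<Rightarrow> bool" where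
  "has_weak_deriv a b f g \<longleftrightarrow>
     locally_integrable a b f \<and> locally_integrable a b g \<and>
     (\<forall>\<phi>. test_function a b \<phi> \<longrightarrow>
        (LINT x|lebesgue_on {a<..<b}. deriv \<phi> x *\<^sub>R f x)
          = - (LINT x|lebesgue_on {a<..<b}. \<phi> x *\<^sub>R g x))"

text \<open>Weak derivatives are unique up to null sets.\<close>

definition weak_deriv ::
  "real \<Rightarrow> real \<Rightarrow> (real \<Rightarrow> 'e::euclidean_space) \<Rightarrow> real \<Rightarrow> 'e" where
  "weak_deriv a b f = (SOME g. has_weak_deriv a b f g)"

definition H1 :: "real \<Rightarrow> real \<Rightarrow> (real \<Rightarrow> 'e::euclidean_space) set" where
  "H1 a b = {f \<in> L2 a b. \<exists>g \<in> L2 a b. has_weak_deriv a b f g}"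

text \<open>Point values of an \<open>H\<^sup>1\<close>-function, including those at the end points, are the values of
  its representative that is continuous on the closed interval; on that interval this
  representative is unique.\<close>

definition cont_rep ::
  "real \<Rightarrow> real \<Rightarrow> (real \<Rightarrow> 'e::euclidean_space) \<Rightarrow> real \<Rightarrow> 'e" where
  "cont_rep a b f = (SOME g. continuous_on {a..b} g \<and> (AE x in lebesgue_on {a<..<b}. g x = f x))"

definition abs_continuous_on ::
  "real \<Rightarrow> real \<Rightarrow> (real \<Rightarrow> 'e::euclidean_space) \<Rightarrow> bool" where
  "abs_continuous_on a b f \<longleftrightarrow>
     (\<forall>\<epsilon>>0. \<exists>\<delta>>0. \<forall>(n::nat) c d.
        (\<forall>k<n. a \<le> c k \<and> c k \<le> d k \<and> d k \<le> b) \<and>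
        (\<forall>j<n. \<forall>k<n. j \<noteq> k \<longrightarrow> d j \<le> c k \<or> d k \<le> c j) \<and>
        (\<Sum>k<n. d k - c k) < \<delta> \<longrightarrow>
        (\<Sum>k<n. norm (f (d k) - f (c k))) < \<epsilon>)"


section \<open>Semigroups\<close>

text \<open>In the following, \<open>V\<close> is a vector space of functions and \<open>p\<close> a seminorm on it. The
  definitions describe operators on the normed space obtained from \<open>V\<close> by identifying functions
  whose difference has seminorm zero, so all identities between elements of \<open>V\<close> are understood in
  this sense. In particular linearity and boundedness make each \<open>S t\<close> respect the
  identification. Only times \<open>t \<ge> 0\<close> are relevant.\<close>

definition bounded_op ::
  "('x \<Rightarrow> 'e::real_vector) set \<Rightarrow> (('x \<Rightarrow> 'e) \<Rightarrow> real) \<Rightarrow> (('x \<Rightarrow> 'e) \<Rightarrow> ('x \<Rightarrow> 'e)) \<Rightarrow> bool" where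
  "bounded_op V p T \<longleftrightarrow>
     (\<forall>u\<in>V. T u \<in> V) \<and>
     (\<forall>u\<in>V. \<forall>v\<in>V. \<forall>\<alpha> \<beta>.
        p (\<lambda>x. T (\<lambda>y. \<alpha> *\<^sub>R u y + \<beta> *\<^sub>R v y) x - (\<alpha> *\<^sub>R T u x + \<beta> *\<^sub>R T v x)) = 0) \<and>
     (\<exists>C. \<forall>u\<in>V. p (T u) \<le> C * p u)"

definition C0_semigroup ::
  "('x \<Rightarrow> 'e::real_vector) set \<Rightarrow> (('x \<Rightarrow> 'e) \<Rightarrow> real) \<Rightarrow> (real \<Rightarrow> ('x \<Rightarrow> 'e) \<Rightarrow> ('x \<Rightarrow> 'e)) \<Rightarrow> bool" where
  "C0_semigroup V p S \<longleftrightarrow>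
     (\<forall>t\<ge>0. bounded_op V p (S t)) \<and>
     (\<forall>u\<in>V. p (\<lambda>x. S 0 u x - u x) = 0) \<and>
     (\<forall>s\<ge>0. \<forall>t\<ge>0. \<forall>u\<in>V. p (\<lambda>x. S (s + t) u x - S s (S t u) x) = 0) \<and>
     (\<forall>u\<in>V. ((\<lambda>t. p (\<lambda>x. S t u x - u x)) \<longlongrightarrow> 0) (at_right 0))"

definition contraction_semigroup ::
  "('x \<Rightarrow> 'e::real_vector) set \<Rightarrow> (('x \<Rightarrow> 'e) \<Rightarrow> real) \<Rightarrow> (real \<Rightarrow> ('x \<Rightarrow> 'e) \<Rightarrow> ('x \<Rightarrow> 'e)) \<Rightarrow> bool" where
  "contraction_semigroup V p S \<longleftrightarrow>
     C0_semigroup V p S \<and> (\<forall>t\<ge>0. \<forall>u\<in>V. p (S t u) \<le> p u)"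

definition exp_stable ::
  "('x \<Rightarrow> 'e::real_vector) set \<Rightarrow> (('x \<Rightarrow> 'e) \<Rightarrow> real) \<Rightarrow> (real \<Rightarrow> ('x \<Rightarrow> 'e) \<Rightarrow> ('x \<Rightarrow> 'e)) \<Rightarrow> bool" where
  "exp_stable V p S \<longleftrightarrow>
     (\<exists>C\<ge>1. \<exists>\<omega>>0. \<forall>t\<ge>0. \<forall>u\<in>V. p (S t u) \<le> C * exp (- \<omega> * t) * p u)"

text \<open>\<open>f\<close> is the right derivative at time 0 of the orbit of \<open>u\<close>.\<close>

definition gen_limit ::
  "(('x \<Rightarrow> 'e::real_vector) \<Rightarrow> real) \<Rightarrow> (real \<Rightarrow> ('x \<Rightarrow> 'e) \<Rightarrow> ('x \<Rightarrow> 'e)) \<Rightarrow> ('x \<Rightarrow> 'e) \<Rightarrow> ('x \<Rightarrow> 'e) \<Rightarrow> bool" where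
  "gen_limit p S u f \<longleftrightarrow>
     ((\<lambda>t. p (\<lambda>x. (1 / t) *\<^sub>R (S t u x - u x) - f x)) \<longlongrightarrow> 0) (at_right 0)"

text \<open>The operator \<open>A\<close> with domain \<open>D\<close> is the infinitesimal generator of \<open>S\<close>.\<close>

definition generates ::
  "('x \<Rightarrow> 'e::real_vector) set \<Rightarrow> (('x \<Rightarrow> 'e) \<Rightarrow> real) \<Rightarrow> ('x \<Rightarrow> 'e) set \<Rightarrow> (('x \<Rightarrow> 'e) \<Rightarrow> ('x \<Rightarrow> 'e))
    \<Rightarrow> (real \<Rightarrow> ('x \<Rightarrow> 'e) \<Rightarrow> ('x \<Rightarrow> 'e)) \<Rightarrow> bool" where
  "generates V p D A S \<longleftrightarrow>
     D = {u \<in> V. \<exists>f\<in>V. gen_limit p S u f} \<and>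
     (\<forall>u\<in>D. A u \<in> V \<and> gen_limit p S u (A u))"

definition m_dissipative ::
  "('x \<Rightarrow> 'e::real_vector) set \<Rightarrow> (('x \<Rightarrow> 'e) \<Rightarrow> real) \<Rightarrow> ('x \<Rightarrow> 'e) set \<Rightarrow> (('x \<Rightarrow> 'e) \<Rightarrow> ('x \<Rightarrow> 'e)) \<Rightarrow> bool" where
  "m_dissipative V p D A \<longleftrightarrow> (\<exists>S. contraction_semigroup V p S \<and> generates V p D A S)"


section \<open>The port-Hamiltonian operator\<close>

definition ph_inner ::
  "real \<Rightarrow> real \<Rightarrow> (real \<Rightarrow> real^'d^'d) \<Rightarrow> (real \<Rightarrow> real^'d) \<Rightarrow> (real \<Rightarrow> real^'d) \<Rightarrow> real" where
  "ph_inner a b H u v = (LINT x|lebesgue_on {a<..<b}. (H x *v u x) \<bullet> v x)"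

definition ph_norm ::
  "real \<Rightarrow> real \<Rightarrow> (real \<Rightarrow> real^'d^'d) \<Rightarrow> (real \<Rightarrow> real^'d) \<Rightarrow> real" where
  "ph_norm a b H u = sqrt (ph_inner a b H u u)"

definition ph_dom ::
  "real \<Rightarrow> real \<Rightarrow> (real \<Rightarrow> real^'d^'d) \<Rightarrow> real^('d + 'd)^'d \<Rightarrow> (real \<Rightarrow> real^'d) set" where
  "ph_dom a b H W =
     {u \<in> L2 a b. (\<lambda>x. H x *v u x) \<in> H1 a b \<and>
        W *v vstack (cont_rep a b (\<lambda>x. H x *v u x) b) (cont_rep a b (\<lambda>x. H x *v u x) a) = 0}"

definition ph_op ::
  "real \<Rightarrow> real \<Rightarrow> (real \<Rightarrow> real^'d^'d) \<Rightarrow> real^'d^'d \<Rightarrow> real^'d^'d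
    \<Rightarrow> (real \<Rightarrow> real^'d) \<Rightarrow> real \<Rightarrow> real^'d" where
  "ph_op a b H P1 P0 u =
     (\<lambda>x. P1 *v weak_deriv a b (\<lambda>y. H y *v u y) x + P0 *v (H x *v u x))"

definition ph_coeff ::
  "(real \<Rightarrow> real^'d^'d) \<Rightarrow> real^'d^'d \<Rightarrow> real^'d^'d \<Rightarrow> real \<Rightarrow> real \<Rightarrow> complex^'d^'d" where
  "ph_coeff H P1 P0 t x =
     cmat (matrix_inv P1) **
       (mat (\<i> * complex_of_real t) ** cmat (matrix_inv (H x)) - cmat P0)"

text \<open>\<open>\<Phi>\<close> is the absolutely continuous matrix-valued solution of \<open>\<Phi>' = M \<Phi>\<close>, \<open>\<Phi>(a) = 1\<close>.\<close>

definition fundamental_solution ::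
  "real \<Rightarrow> real \<Rightarrow> (real \<Rightarrow> complex^'d^'d) \<Rightarrow> (real \<Rightarrow> complex^'d^'d) \<Rightarrow> bool" where
  "fundamental_solution a b M \<Phi> \<longleftrightarrow>
     abs_continuous_on a b \<Phi> \<and> has_weak_deriv a b \<Phi> (\<lambda>x. M x ** \<Phi> x) \<and> \<Phi> a = mat 1"

end

theory Submission
  imports Defs "HOL-Library.Function_Algebras"
begin

text \<open>
  Both conditions say that the resolvent of the operator is uniformly bounded on the imaginary axis.
  This bound takes the form of an inequality \<open>\<parallel>u\<parallel> \<le> C \<parallel>(\<i>t - A)u\<parallel>\<close> for all real \<open>t\<close> and all \<open>u\<close> in the
  complexified domain.

  For a semigroup that decays exponentially, the lower bound is obtained by writing \<open>u\<close> as a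
  telescoping sum of the vectors \<open>S(kd)(u - S(d)u)\<close>, summing the geometric series and letting \<open>d\<close>
  tend to \<open>0\<close> (\<open>generator_lower_bound\<close>). For a contraction semigroup the converse is the theorem of
  Gearhart and Pruess, proved here in discrete time. Multiplied by a tent function, the samples
  \<open>S(id)u\<close> of an orbit satisfy the backward Euler scheme up to small errors. A discrete Fourier
  transform turns the difference quotient of that scheme into the numbers
  \<open>(1 - exp(-\<i>\<theta>))/d\<close>, which lie in the right half-plane; there the lower bound persists, because on
  the part far from the imaginary axis it follows from contractivity (\<open>half_plane_bound\<close>). By
  Parseval's identity the orbit is controlled by the slope of the tent, which is small on a long
  time interval; hence \<open>S(\<tau>)\<close> has norm at most \<open>1/2\<close> for some \<open>\<tau>\<close> (\<open>contraction_decay\<close>). In both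
  directions finite sums take the place of vector-valued integrals.

  The differential equation links the lower bound to the matrices \<open>T t\<close>. With \<open>v = H u\<close> and
  \<open>f = (\<i>t - A)u\<close> one has \<open>v' = M v - P1\<inverse> f\<close>, where \<open>M\<close> is the coefficient of the fundamental solution \<open>\<Phi>\<close>.
  Since \<open>P1 M\<close> is skew-adjoint, \<open>(\<Phi> c)\<^sup>* P1 v\<close> has derivative \<open>-(\<Phi> c)\<^sup>* f\<close> (\<open>energy_identity\<close>). The choice
  \<open>f = 0\<close> shows that the bound on \<open>\<Phi>\<close> is accompanied by a bound on \<open>\<Phi>\<inverse>\<close>; for general \<open>f\<close> the identity
  bounds \<open>v\<close> by \<open>v a\<close> and the integral of \<open>f\<close>. The boundary condition \<open>W (v b; v a) = 0\<close> then becomes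
  an equation \<open>T t (v a) = r\<close> with \<open>r\<close> bounded by \<open>f\<close>, so a bound on the inverse of \<open>T t\<close> gives the
  resolvent bound. Conversely, given \<open>c\<close>, a right inverse of \<open>W\<close> provides boundary values of the size of
  \<open>T t c\<close> that compensate those of \<open>\<Phi> c\<close>; interpolating them along the flow produces a function in the
  domain to which the resolvent bound applies.

  Membership in the domain is expressed by weak derivatives. They are handled through the lemma of
  du Bois-Reymond, which identifies functions having an integrable weak derivative with primitives, and
  a product rule for primitives proved by Fubini's theorem.
\<close>

section \<open>Function spaces with a degenerate inner product\<close>

text \<open>With this structure the pointwise expressions in the definitions of semigroups and generators are,
  up to unfolding, vector-space expressions. The semigroup theory can then be developed in an
  arbitrary real vector space and applied to functions as well as to pairs of functions.\<close>
instantiation "fun" :: (type, real_vector) real_vector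
begin

definition scaleR_fun :: "real \<Rightarrow> ('a \<Rightarrow> 'b) \<Rightarrow> 'a \<Rightarrow> 'b" where
  "scaleR_fun c f = (\<lambda>x. c *\<^sub>R f x)"

instance
  by standard (auto simp: scaleR_fun_def fun_eq_iff algebra_simps)

end

text \<open>The form may vanish on nonzero vectors, as it does for functions that vanish almost everywhere.\<close>
locale semi_inner_product =
  fixes V :: "'a::real_vector set" and B :: "'a \<Rightarrow> 'a \<Rightarrow> real"
  assumes subsp: "subspace V"
    and B_sym: "\<lbrakk>u \<in> V; v \<in> V\<rbrakk> \<Longrightarrow> B u v = B v u"
    and B_add: "\<lbrakk>u \<in> V; v \<in> V; w \<in> V\<rbrakk> \<Longrightarrow> B (u + v) w = B u w + B v w"
    and B_scale: "\<lbrakk>u \<in> V; w \<in> V\<rbrakk> \<Longrightarrow> B (c *\<^sub>R u) w = c * B u w"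
    and B_nonneg: "u \<in> V \<Longrightarrow> 0 \<le> B u u"
begin

definition nrm :: "'a \<Rightarrow> real" where "nrm u = sqrt (B u u)"

lemma V_closed [intro, simp]:
  "0 \<in> V" "\<lbrakk>u \<in> V; v \<in> V\<rbrakk> \<Longrightarrow> u + v \<in> V" "\<lbrakk>u \<in> V; v \<in> V\<rbrakk> \<Longrightarrow> u - v \<in> V"
  "u \<in> V \<Longrightarrow> c *\<^sub>R u \<in> V" "u \<in> V \<Longrightarrow> - u \<in> V"
  using subsp by (auto simp: subspace_0 subspace_add subspace_diff subspace_scale subspace_neg)

lemma V_sum [intro, simp]: "(\<And>i. i \<in> I \<Longrightarrow> u i \<in> V) \<Longrightarrow> (\<Sum>i\<in>I. u i) \<in> V"
  using subsp by (simp add: subspace_sum)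

lemma B_add_right: "\<lbrakk>u \<in> V; v \<in> V; w \<in> V\<rbrakk> \<Longrightarrow> B w (u + v) = B w u + B w v"
  using B_add[of u v w] B_sym[of w] by simp

lemma B_scale_right: "\<lbrakk>u \<in> V; w \<in> V\<rbrakk> \<Longrightarrow> B w (c *\<^sub>R u) = c * B w u"
  using B_scale[of u w c] B_sym[of w] by simp

lemma B_zero: "w \<in> V \<Longrightarrow> B 0 w = 0" "w \<in> V \<Longrightarrow> B w 0 = 0"
  using B_scale[of 0 w 0] B_scale_right[of 0 w 0] by auto

lemma B_sum_left:
  assumes "\<And>i. i \<in> I \<Longrightarrow> u i \<in> V" "w \<in> V"
  shows "B (\<Sum>i\<in>I. c i *\<^sub>R u i) w = (\<Sum>i\<in>I. c i * B (u i) w)"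
  using assms by (induction I rule: infinite_finite_induct) (auto simp: B_zero B_add B_scale)

lemma B_sum_right:
  assumes "\<And>i. i \<in> I \<Longrightarrow> u i \<in> V" "w \<in> V"
  shows "B w (\<Sum>i\<in>I. c i *\<^sub>R u i) = (\<Sum>i\<in>I. c i * B w (u i))"
  using assms by (induction I rule: infinite_finite_induct) (auto simp: B_zero B_add_right B_scale_right)

lemma nrm_ge0 [simp]: "u \<in> V \<Longrightarrow> 0 \<le> nrm u"
  by (simp add: nrm_def B_nonneg)

lemma nrm_power2: "u \<in> V \<Longrightarrow> (nrm u)\<^sup>2 = B u u"
  by (simp add: nrm_def B_nonneg)

lemma nrm_scale: "u \<in> V \<Longrightarrow> nrm (c *\<^sub>R u) = \<bar>c\<bar> * nrm u"
  by (simp add: nrm_def B_scale B_scale_right real_sqrt_mult flip: mult.assoc power2_eq_square)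

lemma nrm_zero [simp]: "nrm 0 = 0"
  by (simp add: nrm_def B_zero)

lemma nrm_minus [simp]: "u \<in> V \<Longrightarrow> nrm (- u) = nrm u"
  using nrm_scale[of u "-1"] by simp

lemma nrm_minus_commute: "u \<in> V \<Longrightarrow> v \<in> V \<Longrightarrow> nrm (u - v) = nrm (v - u)"
  using nrm_minus[of "v - u"] by simp

lemma B_quadratic:
  assumes "u \<in> V" "v \<in> V"
  shows "B (u + c *\<^sub>R v) (u + c *\<^sub>R v) = B u u + 2 * c * B u v + c\<^sup>2 * B v v"
  using assms by (simp add: B_add B_add_right B_scale B_scale_right B_sym[of v u] power2_eq_square
      algebra_simps)

lemma Cauchy_Schwarz:
  assumes u: "u \<in> V" and v: "v \<in> V"
  shows "B u v \<le> nrm u * nrm v"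
proof (cases "B v v = 0")
  case True
  have "B u v \<le> 0"
  proof (rule ccontr)
    assume pos: "\<not> B u v \<le> 0"
    \<comment> \<open>For \<open>B v v = 0\<close> the polynomial is affine in \<open>c\<close>; here it takes the value \<open>-1\<close>.\<close>
    define c where "c = - (B u u + 1) / (2 * B u v)"
    have "0 \<le> B u u + 2 * c * B u v + c\<^sup>2 * B v v"
      using B_quadratic[OF u v, of c] u v by (metis B_nonneg V_closed(2,4))
    then show False
      using pos True by (simp add: c_def field_simps)
  qed
  then show ?thesis
    using u v by (meson mult_nonneg_nonneg nrm_ge0 order_trans)
next
  case False
  then have vpos: "B v v > 0" using B_nonneg[OF v] by simp
  \<comment> \<open>The minimizer of the quadratic polynomial in \<open>c\<close>.\<close>
  define c where "c = - B u v / B v v"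
  have "0 \<le> B u u + 2 * c * B u v + c\<^sup>2 * B v v"
    using B_quadratic[OF u v, of c] u v by (metis B_nonneg V_closed(2,4))
  then have "(B u v)\<^sup>2 \<le> B u u * B v v"
    using vpos by (simp add: c_def field_simps power2_eq_square)
  also have "\<dots> = (nrm u * nrm v)\<^sup>2"
    using u v by (simp add: power_mult_distrib nrm_power2)
  finally show ?thesis
    using u v by (meson abs_le_square_iff abs_ge_self mult_nonneg_nonneg nrm_ge0 order_trans
        abs_of_nonneg power2_le_imp_le)
qed

lemma nrm_triangle: "\<lbrakk>u \<in> V; v \<in> V\<rbrakk> \<Longrightarrow> nrm (u + v) \<le> nrm u + nrm v"
proof -
  assume u: "u \<in> V" and v: "v \<in> V"
  have "(nrm (u + v))\<^sup>2 = B u u + 2 * B u v + B v v"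
    using B_quadratic[OF u v, of 1] u v by (simp add: nrm_power2)
  also have "\<dots> \<le> (nrm u)\<^sup>2 + 2 * (nrm u * nrm v) + (nrm v)\<^sup>2"
    using Cauchy_Schwarz[OF u v] u v by (simp add: nrm_power2)
  also have "\<dots> = (nrm u + nrm v)\<^sup>2"
    by (simp add: power2_eq_square algebra_simps)
  finally show ?thesis
    using u v by (meson add_nonneg_nonneg nrm_ge0 power2_le_imp_le)
qed

lemma nrm_triangle_diff: "\<lbrakk>u \<in> V; v \<in> V\<rbrakk> \<Longrightarrow> nrm (u - v) \<le> nrm u + nrm v"
  using nrm_triangle[of u "- v"] by simp

lemma nrm_triangle_sub: "\<lbrakk>u \<in> V; v \<in> V\<rbrakk> \<Longrightarrow> nrm u \<le> nrm v + nrm (u - v)"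
  using nrm_triangle[of v "u - v"] by simp

text \<open>Equality up to vectors of seminorm zero.\<close>

definition eqv :: "'a \<Rightarrow> 'a \<Rightarrow> bool" (infix "\<simeq>" 50) where
  "u \<simeq> v \<longleftrightarrow> u \<in> V \<and> v \<in> V \<and> nrm (u - v) = 0"

lemma eqv_refl: "u \<in> V \<Longrightarrow> u \<simeq> u"
  by (simp add: eqv_def)

lemma eqv_sym: "u \<simeq> v \<Longrightarrow> v \<simeq> u"
  by (auto simp: eqv_def nrm_minus_commute)

lemma eqv_in: "u \<simeq> v \<Longrightarrow> u \<in> V" "u \<simeq> v \<Longrightarrow> v \<in> V"
  by (auto simp: eqv_def)

lemma eqv_add: "u \<simeq> v \<Longrightarrow> u' \<simeq> v' \<Longrightarrow> u + u' \<simeq> v + v'"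
proof -
  assume *: "u \<simeq> v" "u' \<simeq> v'"
  then have "nrm ((u - v) + (u' - v')) \<le> 0"
    using nrm_triangle[of "u - v" "u' - v'"] by (auto simp: eqv_def)
  moreover have "(u - v) + (u' - v') = (u + u') - (v + v')" by simp
  ultimately show ?thesis
    using * nrm_ge0[of "(u + u') - (v + v')"] unfolding eqv_def by (auto intro: antisym)
qed

lemma eqv_trans [trans]: "u \<simeq> v \<Longrightarrow> v \<simeq> w \<Longrightarrow> u \<simeq> w"
  using eqv_add[of u v v w] unfolding eqv_def by auto

lemma eqv_scale: "u \<simeq> v \<Longrightarrow> c *\<^sub>R u \<simeq> c *\<^sub>R v"
  using nrm_scale[of "u - v" c] by (auto simp: eqv_def scaleR_right_diff_distrib)

lemma eqv_diff: "u \<simeq> v \<Longrightarrow> u' \<simeq> v' \<Longrightarrow> u - u' \<simeq> v - v'"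
  using eqv_add[of u v "-1 *\<^sub>R u'" "-1 *\<^sub>R v'"] eqv_scale[of u' v' "-1"] by simp

lemma eqv_nrm: "u \<simeq> v \<Longrightarrow> nrm u = nrm v"
  using nrm_triangle_sub[of u v] nrm_triangle_sub[of v u] nrm_minus_commute[of u v]
  by (auto simp: eqv_def)

end

section \<open>Semigroups and generators up to null vectors\<close>

text \<open>The laws hold up to vectors of seminorm zero. Strong continuity is kept out of the locale, as an
  assumption of the lemmas about decay, so that the semigroups \<open>rotated\<close> below are instances by
  algebra alone.\<close>
locale seminormed_semigroup = semi_inner_product +
  fixes S :: "real \<Rightarrow> 'a \<Rightarrow> 'a"
  assumes S_in [simp, intro]: "\<lbrakk>0 \<le> t; u \<in> V\<rbrakk> \<Longrightarrow> S t u \<in> V"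
    and S_linear: "\<lbrakk>0 \<le> t; u \<in> V; v \<in> V\<rbrakk> \<Longrightarrow> S t (\<alpha> *\<^sub>R u + \<beta> *\<^sub>R v) \<simeq> \<alpha> *\<^sub>R S t u + \<beta> *\<^sub>R S t v"
    and S_bounded: "0 \<le> t \<Longrightarrow> \<exists>C. \<forall>u\<in>V. nrm (S t u) \<le> C * nrm u"
    and S_zero: "u \<in> V \<Longrightarrow> S 0 u \<simeq> u"
    and S_add: "\<lbrakk>0 \<le> s; 0 \<le> t; u \<in> V\<rbrakk> \<Longrightarrow> S (s + t) u \<simeq> S s (S t u)"
begin

text \<open>The graph of the generator. It is a relation because the semigroup determines the value of the
  generator only up to a vector of seminorm zero.\<close>
definition gen :: "'a \<Rightarrow> 'a \<Rightarrow> bool" where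
  "gen u f \<longleftrightarrow> u \<in> V \<and> f \<in> V \<and> ((\<lambda>t. nrm ((1 / t) *\<^sub>R (S t u - u) - f)) \<longlongrightarrow> 0) (at_right 0)"

lemma gen_in: "gen u f \<Longrightarrow> u \<in> V" "gen u f \<Longrightarrow> f \<in> V"
  by (auto simp: gen_def)

lemma S_scale: "0 \<le> t \<Longrightarrow> u \<in> V \<Longrightarrow> S t (c *\<^sub>R u) \<simeq> c *\<^sub>R S t u"
  using S_linear[of t u u c 0] by simp

lemma S_diff: "0 \<le> t \<Longrightarrow> u \<in> V \<Longrightarrow> v \<in> V \<Longrightarrow> S t (u - v) \<simeq> S t u - S t v"
  using S_linear[of t u v 1 "-1"] by simp

lemma gen_linear:
  assumes "gen u f" "gen v g"
  shows "gen (\<alpha> *\<^sub>R u + \<beta> *\<^sub>R v) (\<alpha> *\<^sub>R f + \<beta> *\<^sub>R g)"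
proof -
  note V = gen_in[OF assms(1)] gen_in[OF assms(2)]
  let ?q = "\<lambda>u f t. (1 / t) *\<^sub>R (S t u - u) - f"
  have "((\<lambda>t. nrm (?q (\<alpha> *\<^sub>R u + \<beta> *\<^sub>R v) (\<alpha> *\<^sub>R f + \<beta> *\<^sub>R g) t)) \<longlongrightarrow> 0) (at_right 0)"
  proof (rule tendsto_sandwich[where f = "\<lambda>_. 0"])
    show "((\<lambda>t. \<bar>\<alpha>\<bar> * nrm (?q u f t) + \<bar>\<beta>\<bar> * nrm (?q v g t)) \<longlongrightarrow> 0) (at_right 0)"
      using assms unfolding gen_def by (auto intro!: tendsto_eq_intros)
    show "\<forall>\<^sub>F t in at_right 0. 0 \<le> nrm (?q (\<alpha> *\<^sub>R u + \<beta> *\<^sub>R v) (\<alpha> *\<^sub>R f + \<beta> *\<^sub>R g) t)"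
      using V by (auto simp: eventually_at_right_less intro!: eventually_mono[OF eventually_at_right_less])
    show "\<forall>\<^sub>F t in at_right 0. nrm (?q (\<alpha> *\<^sub>R u + \<beta> *\<^sub>R v) (\<alpha> *\<^sub>R f + \<beta> *\<^sub>R g) t)
        \<le> \<bar>\<alpha>\<bar> * nrm (?q u f t) + \<bar>\<beta>\<bar> * nrm (?q v g t)"
    proof (rule eventually_mono[OF eventually_at_right_less])
      fix t :: real assume t: "0 < t"
      have "?q (\<alpha> *\<^sub>R u + \<beta> *\<^sub>R v) (\<alpha> *\<^sub>R f + \<beta> *\<^sub>R g) t
          \<simeq> (1 / t) *\<^sub>R (\<alpha> *\<^sub>R S t u + \<beta> *\<^sub>R S t v - (\<alpha> *\<^sub>R u + \<beta> *\<^sub>R v)) - (\<alpha> *\<^sub>R f + \<beta> *\<^sub>R g)"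
        using t V by (intro eqv_diff eqv_scale S_linear eqv_refl) auto
      also have "(1 / t) *\<^sub>R (\<alpha> *\<^sub>R S t u + \<beta> *\<^sub>R S t v - (\<alpha> *\<^sub>R u + \<beta> *\<^sub>R v)) - (\<alpha> *\<^sub>R f + \<beta> *\<^sub>R g)
          = \<alpha> *\<^sub>R ?q u f t + \<beta> *\<^sub>R ?q v g t"
        by (simp add: algebra_simps)
      finally have "nrm (?q (\<alpha> *\<^sub>R u + \<beta> *\<^sub>R v) (\<alpha> *\<^sub>R f + \<beta> *\<^sub>R g) t) = nrm (\<alpha> *\<^sub>R ?q u f t + \<beta> *\<^sub>R ?q v g t)"
        by (rule eqv_nrm)
      also have "\<dots> \<le> nrm (\<alpha> *\<^sub>R ?q u f t) + nrm (\<beta> *\<^sub>R ?q v g t)"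
        using V t by (intro nrm_triangle) auto
      finally show "nrm (?q (\<alpha> *\<^sub>R u + \<beta> *\<^sub>R v) (\<alpha> *\<^sub>R f + \<beta> *\<^sub>R g) t)
        \<le> \<bar>\<alpha>\<bar> * nrm (?q u f t) + \<bar>\<beta>\<bar> * nrm (?q v g t)"
        using V t by (simp add: nrm_scale)
    qed
  qed simp
  then show ?thesis using V by (simp add: gen_def)
qed

lemma gen_zero: "gen 0 0"
proof -
  have "nrm ((1 / t) *\<^sub>R (S t 0 - 0) - 0) = 0" if "0 < t" for t
    using S_scale[of t 0 0] that nrm_scale[of "S t 0" "1 / t"] eqv_nrm by fastforce
  then have "((\<lambda>t. nrm ((1 / t) *\<^sub>R (S t 0 - 0) - 0)) \<longlongrightarrow> 0) (at_right 0)"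
    by (intro tendsto_eventually eventually_mono[OF eventually_at_right_less])
  then show ?thesis by (simp add: gen_def)
qed

lemma gen_scale: "gen u f \<Longrightarrow> gen (c *\<^sub>R u) (c *\<^sub>R f)"
  using gen_linear[of u f 0 0 c 0] gen_zero by simp

lemma gen_sum:
  assumes "\<And>i. i \<in> I \<Longrightarrow> gen (u i) (f i)"
  shows "gen (\<Sum>i\<in>I. c i *\<^sub>R u i) (\<Sum>i\<in>I. c i *\<^sub>R f i)"
  using assms
proof (induction I rule: infinite_finite_induct)
  case (insert i I)
  then show ?case using gen_linear[of "u i" "f i" "\<Sum>i\<in>I. c i *\<^sub>R u i" "\<Sum>i\<in>I. c i *\<^sub>R f i" "c i" 1] by simp
qed (auto simp: gen_zero)

lemma gen_unique:
  assumes "gen u f" "gen u g"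
  shows "f \<simeq> g"
proof -
  have "gen 0 (f - g)"
    using gen_linear[OF assms, of 1 "-1"] by simp
  then have lim: "((\<lambda>t. nrm ((1 / t) *\<^sub>R (S t 0 - 0) - (f - g))) \<longlongrightarrow> 0) (at_right 0)"
    by (simp add: gen_def)
  have "nrm ((1 / t) *\<^sub>R (S t 0 - 0) - (f - g)) = nrm (f - g)" if "0 < t" for t
  proof -
    have "(1 / t) *\<^sub>R (S t 0 - 0) - (f - g) \<simeq> (1 / t) *\<^sub>R (0 *\<^sub>R S t 0 - 0) - (f - g)"
      using S_scale[of t 0 0] that assms gen_in by (intro eqv_diff eqv_scale eqv_refl) auto
    then have "nrm ((1 / t) *\<^sub>R (S t 0 - 0) - (f - g)) = nrm (- (f - g))"
      using eqv_nrm by fastforce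
    then show ?thesis using assms gen_in by (simp only: nrm_minus V_closed)
  qed
  then have "((\<lambda>t. nrm ((1 / t) *\<^sub>R (S t 0 - 0) - (f - g))) \<longlongrightarrow> nrm (f - g)) (at_right 0)"
    by (intro tendsto_eventually eventually_mono[OF eventually_at_right_less])
  from tendsto_unique[OF _ lim this] show ?thesis
    using assms gen_in by (auto simp: eqv_def)
qed

lemma gen_semigroup:
  assumes "gen u f" "0 \<le> s"
  shows "gen (S s u) (S s f)"
proof -
  note V = gen_in[OF assms(1)]
  obtain C where C: "\<forall>u\<in>V. nrm (S s u) \<le> C * nrm u" using S_bounded[OF assms(2)] by blast
  have "((\<lambda>t. nrm ((1 / t) *\<^sub>R (S t (S s u) - S s u) - S s f)) \<longlongrightarrow> 0) (at_right 0)"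
  proof (rule tendsto_sandwich[where f = "\<lambda>_. 0"])
    show "((\<lambda>t. C * nrm ((1 / t) *\<^sub>R (S t u - u) - f)) \<longlongrightarrow> 0) (at_right 0)"
      using assms unfolding gen_def by (auto intro!: tendsto_eq_intros)
    show "\<forall>\<^sub>F t in at_right 0. 0 \<le> nrm ((1 / t) *\<^sub>R (S t (S s u) - S s u) - S s f)"
      using V assms by (auto intro!: eventually_mono[OF eventually_at_right_less])
    show "\<forall>\<^sub>F t in at_right 0. nrm ((1 / t) *\<^sub>R (S t (S s u) - S s u) - S s f) 
        \<le> C * nrm ((1 / t) *\<^sub>R (S t u - u) - f)"
    proof (rule eventually_mono[OF eventually_at_right_less])
      fix t :: real assume t: "0 < t"
      have "S t (S s u) \<simeq> S s (S t u)"
        using eqv_trans[OF eqv_sym[OF S_add[of t s u]] S_add[of s t u, unfolded add.commute[of s t]]]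
          t assms(2) V by auto
      then have "(1 / t) *\<^sub>R (S t (S s u) - S s u) - S s f \<simeq> (1 / t) *\<^sub>R (S s (S t u) - S s u) - S s f"
        using V assms(2) by (intro eqv_diff eqv_scale eqv_refl) auto
      also have "\<dots> \<simeq> (1 / t) *\<^sub>R S s (S t u - u) - S s f"
        using V assms(2) t by (intro eqv_diff eqv_scale eqv_refl eqv_sym[OF S_diff]) auto
      also have "\<dots> \<simeq> S s ((1 / t) *\<^sub>R (S t u - u)) - S s f"
        using V assms(2) t by (intro eqv_diff eqv_refl eqv_sym[OF S_scale]) auto
      also have "\<dots> \<simeq> S s ((1 / t) *\<^sub>R (S t u - u) - f)"
        using V assms(2) t by (intro eqv_sym[OF S_diff]) auto
      finally have "nrm ((1 / t) *\<^sub>R (S t (S s u) - S s u) - S s f) = nrm (S s ((1 / t) *\<^sub>R (S t u - u) - f))"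
        by (rule eqv_nrm)
      also have "\<dots> \<le> C * nrm ((1 / t) *\<^sub>R (S t u - u) - f)"
        using C V t by auto
      finally show "nrm ((1 / t) *\<^sub>R (S t (S s u) - S s u) - S s f) 
        \<le> C * nrm ((1 / t) *\<^sub>R (S t u - u) - f)" .
    qed
  qed simp
  then show ?thesis using V assms(2) by (simp add: gen_def)
qed

text \<open>If the semigroup decays exponentially, then \<open>u = - \<integral> S(t) f dt\<close>, and the bound is the triangle
  inequality. The integral is replaced by the telescoping sum of \<open>S(kd)(u - S(d)u)\<close> over \<open>k < n\<close>: its
  terms are bounded by a geometric series, \<open>n\<close> tends to infinity first, and \<open>(u - S(d)u)/d\<close> tends
  to \<open>-f\<close>.\<close>
lemma generator_lower_bound:
  assumes "\<omega> > 0" "C \<ge> 0"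
    and bound: "\<And>t u. \<lbrakk>0 \<le> t; u \<in> V\<rbrakk> \<Longrightarrow> nrm (S t u) \<le> C * exp (- \<omega> * t) * nrm u"
    and "gen u f"
  shows "nrm u \<le> C / \<omega> * nrm f"
proof -
  note V = gen_in[OF \<open>gen u f\<close>]
  have step: "nrm u \<le> C / (1 - exp (- \<omega> * d)) * nrm (u - S d u)" if d: "d > 0" for d
  proof -
    let ?e = "exp (- \<omega> * d)"
    have e: "0 < ?e" "?e < 1" using d assms(1) by auto
    have tele: "nrm u \<le> nrm (S (n * d) u) + (\<Sum>k<n. C * ?e ^ k * nrm (u - S d u))" for n :: nat
    proof (induction n)
      case 0
      then show ?case using eqv_nrm[OF S_zero, of u] V by simp
    next
      case (Suc n)
      have nd: "0 \<le> n * d" using d by simp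
      have "S (n * d) u - S (Suc n * d) u \<simeq> S (n * d) u - S (n * d) (S d u)"
        using V d nd S_add[of "n * d" d u] by (intro eqv_diff eqv_refl) (auto simp: algebra_simps)
      also have "\<dots> \<simeq> S (n * d) (u - S d u)"
        using V d nd by (intro eqv_sym[OF S_diff]) auto
      finally have "nrm (S (n * d) u - S (Suc n * d) u) = nrm (S (n * d) (u - S d u))"
        by (rule eqv_nrm)
      also have "\<dots> \<le> C * exp (- \<omega> * (n * d)) * nrm (u - S d u)"
        using bound[OF nd, of "u - S d u"] V d by auto
      also have "exp (- \<omega> * (n * d)) = ?e ^ n"
        by (simp flip: exp_of_nat_mult add: algebra_simps)
      finally have "nrm (S (n * d) u) \<le> nrm (S (Suc n * d) u) + C * ?e ^ n * nrm (u - S d u)"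
        using nrm_triangle_sub[of "S (n * d) u" "S (Suc n * d) u"] V d by auto
      then show ?case using Suc by simp
    qed
    have "nrm u \<le> C * nrm u * ?e ^ n + C / (1 - ?e) * nrm (u - S d u)" for n :: nat
    proof -
      have "(\<Sum>k<n. C * ?e ^ k * nrm (u - S d u)) = C * (\<Sum>k<n. ?e ^ k) * nrm (u - S d u)"
        by (simp add: sum_distrib_left sum_distrib_right)
      also have "\<dots> \<le> C * (1 / (1 - ?e)) * nrm (u - S d u)"
      proof (intro mult_right_mono mult_left_mono assms)
        have "(\<Sum>k<n. ?e ^ k) = (1 - ?e ^ n) / (1 - ?e)"
          using e by (subst sum_gp_strict) auto
        also have "\<dots> \<le> 1 / (1 - ?e)" using e by (intro divide_right_mono) auto
        finally show "(\<Sum>k<n. ?e ^ k) \<le> 1 / (1 - ?e)" .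
      qed (use V d in auto)
      moreover have "nrm (S (n * d) u) \<le> C * nrm u * ?e ^ n"
        using bound[of "n * d" u] V d by (simp add: mult_ac flip: exp_of_nat_mult)
      ultimately show ?thesis using tele[of n] by simp
    qed
    moreover have "(\<lambda>n. C * nrm u * ?e ^ n + C / (1 - ?e) * nrm (u - S d u)) \<longlonglongrightarrow>
        C * nrm u * 0 + C / (1 - ?e) * nrm (u - S d u)"
      using e by (intro tendsto_intros LIMSEQ_power_zero) auto
    ultimately show ?thesis
      by (intro LIMSEQ_le_const[where X = "\<lambda>n. C * nrm u * ?e ^ n + C / (1 - ?e) * nrm (u - S d u)"]) auto
  qed
  have "nrm u \<le> C * ((1 + \<omega> * d) / \<omega>) * (nrm f + nrm ((1 / d) *\<^sub>R (S d u - u) - f))" if d: "d > 0" for d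
  proof -
    have wd: "\<omega> * d > 0" using d assms by simp
    have "exp (- (\<omega> * d)) \<le> 1 / (1 + \<omega> * d)"
      using exp_ge_add_one_self[of "\<omega> * d"] wd by (simp add: exp_minus field_simps)
    then have "1 - exp (- \<omega> * d) \<ge> \<omega> * d / (1 + \<omega> * d)"
      using wd by (simp add: field_simps)
    then have "1 / (1 - exp (- \<omega> * d)) \<le> 1 / (\<omega> * d / (1 + \<omega> * d))"
      using wd d assms(1) by (intro divide_left_mono mult_pos_pos divide_pos_pos add_pos_pos) auto
    then have *: "C * (1 / (1 - exp (- \<omega> * d))) \<le> C * ((1 + \<omega> * d) / (\<omega> * d))"
      using assms by (intro mult_left_mono) auto
    have "nrm u \<le> C * (1 / (1 - exp (- \<omega> * d))) * nrm (u - S d u)"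
      using step[OF d] by simp
    also have "\<dots> \<le> C * ((1 + \<omega> * d) / (\<omega> * d)) * nrm (u - S d u)"
      using V d by (intro mult_right_mono *) auto
    also have "\<dots> = C * ((1 + \<omega> * d) / \<omega>) * nrm ((1 / d) *\<^sub>R (S d u - u))"
      using d V nrm_minus_commute[of u "S d u"] by (simp add: nrm_scale)
    also have "\<dots> \<le> C * ((1 + \<omega> * d) / \<omega>) * (nrm f + nrm ((1 / d) *\<^sub>R (S d u - u) - f))"
      using V d assms wd by (intro mult_left_mono nrm_triangle_sub) auto
    finally show ?thesis .
  qed
  then have ev: "\<forall>\<^sub>F d in at_right 0. nrm u \<le> C * ((1 + \<omega> * d) / \<omega>) * (nrm f + nrm ((1 / d) *\<^sub>R (S d u - u) - f))"
    by (intro eventually_mono[OF eventually_at_right_less])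
  have "((\<lambda>d. C * ((1 + \<omega> * d) / \<omega>) * (nrm f + nrm ((1 / d) *\<^sub>R (S d u - u) - f))) \<longlongrightarrow>
      C * ((1 + \<omega> * 0) / \<omega>) * (nrm f + 0)) (at_right 0)"
    using \<open>gen u f\<close> assms(1) unfolding gen_def by (intro tendsto_intros) auto
  from tendsto_lowerbound[OF this ev] show ?thesis by simp
qed

end

section \<open>Complexification\<close>

definition pair_form :: "('a \<Rightarrow> 'a \<Rightarrow> real) \<Rightarrow> 'a \<times> 'a \<Rightarrow> 'a \<times> 'a \<Rightarrow> real" where
  "pair_form B u v = B (fst u) (fst v) + B (snd u) (snd v)"

text \<open>A pair \<open>(u, v)\<close> stands for \<open>u + \<i>v\<close>; this is multiplication by a complex number.\<close>
definition cscale :: "complex \<Rightarrow> 'a::real_vector \<times> 'a \<Rightarrow> 'a \<times> 'a" where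
  "cscale z w = (Re z *\<^sub>R fst w - Im z *\<^sub>R snd w, Im z *\<^sub>R fst w + Re z *\<^sub>R snd w)"

lemma cscale_simps [simp]: "cscale 1 w = w" "cscale 0 w = 0" "cscale z 0 = 0"
  by (auto simp: cscale_def zero_prod_def)

lemma cscale_mult: "cscale (y * z) w = cscale y (cscale z w)"
  by (simp add: cscale_def algebra_simps scaleR_diff_left)

lemma cscale_add_left: "cscale (y + z) w = cscale y w + cscale z w"
  by (simp add: cscale_def algebra_simps)

lemma cscale_diff_left: "cscale (y - z) w = cscale y w - cscale z w"
  by (simp add: cscale_def algebra_simps)

lemma cscale_add_right: "cscale z (v + w) = cscale z v + cscale z w"
  by (simp add: cscale_def algebra_simps)

lemma cscale_diff_right: "cscale z (v - w) = cscale z v - cscale z w"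
  by (simp add: cscale_def algebra_simps)

lemma cscale_scaleR: "cscale z (c *\<^sub>R w) = c *\<^sub>R cscale z w"
  by (simp add: cscale_def algebra_simps)

lemma cscale_of_real: "cscale (of_real c) w = c *\<^sub>R w"
  by (simp add: cscale_def prod_eq_iff)

lemma cscale_sum_right: "cscale z (\<Sum>i\<in>I. w i) = (\<Sum>i\<in>I. cscale z (w i))"
  by (induction I rule: infinite_finite_induct) (simp_all add: cscale_add_right)

lemma sum_cos_roots_of_unity:
  assumes "N > 0" "m \<noteq> 0" "\<bar>m\<bar> < int N"
  shows "(\<Sum>k<N. cos (2 * pi * real k / real N * real_of_int m)) = 0"
proof -
  define z where "z = cis (2 * pi * real_of_int m / real N)"
  have "z \<noteq> 1"
  proof
    assume "z = 1"
    then have "cos (2 * pi * real_of_int m / real N) = 1"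
      by (metis z_def cis.sel(1) one_complex.sel(1))
    then obtain n :: int where "2 * pi * real_of_int m / real N = real_of_int n * 2 * pi"
      by (auto simp: cos_one_2pi_int)
    then have "real_of_int m = real_of_int (n * int N)"
      using assms by (simp add: field_simps)
    then have m: "m = n * int N" by linarith
    then have "n \<noteq> 0" using assms by auto
    then have "int N * 1 \<le> int N * \<bar>n\<bar>" by (intro mult_left_mono) auto
    then show False using assms(3) m by (simp add: abs_mult mult.commute)
  qed
  moreover have "z ^ N = 1"
  proof -
    have "z ^ N = cis (real N * (2 * pi * real_of_int m / real N))"
      unfolding z_def by (rule Complex.DeMoivre)
    also have "real N * (2 * pi * real_of_int m / real N) = 2 * pi * real_of_int m"
      using assms by simp
    finally show ?thesis by (simp add: cis_multiple_2pi)
  qed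
  ultimately have "(\<Sum>k<N. z ^ k) = 0"
    by (subst sum_gp_strict) auto
  then have "Re (\<Sum>k<N. z ^ k) = 0" by simp
  then show ?thesis
    by (simp add: z_def Complex.DeMoivre mult_ac)
qed

context semi_inner_product
begin

lemma pair_space: "semi_inner_product (V \<times> V) (pair_form B)"
proof
  show "subspace (V \<times> V)" using subsp by (intro subspace_Times)
  fix u v assume "u \<in> V \<times> V" "v \<in> V \<times> V"
  then show "pair_form B u v = pair_form B v u"
    using B_sym[of "fst u" "fst v"] B_sym[of "snd u" "snd v"] by (auto simp: pair_form_def)
qed (auto simp: pair_form_def B_add B_scale B_nonneg distrib_left)

interpretation P: semi_inner_product "V \<times> V" "pair_form B"
  by (rule pair_space)

lemma pair_nrm_power2: "u \<in> V \<Longrightarrow> v \<in> V \<Longrightarrow> (P.nrm (u, v))\<^sup>2 = (nrm u)\<^sup>2 + (nrm v)\<^sup>2"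
  by (subst P.nrm_power2) (auto simp: nrm_power2 pair_form_def)

lemma pair_nrm_le: "u \<in> V \<Longrightarrow> v \<in> V \<Longrightarrow> P.nrm (u, v) \<le> nrm u + nrm v"
  by (rule power2_le_imp_le) (auto simp: pair_nrm_power2 power2_sum)

lemma pair_eqv_iff: "P.eqv x y \<longleftrightarrow> fst x \<simeq> fst y \<and> snd x \<simeq> snd y"
proof (cases "x \<in> V \<times> V \<and> y \<in> V \<times> V")
  case True
  then have "(P.nrm (x - y))\<^sup>2 = (nrm (fst x - fst y))\<^sup>2 + (nrm (snd x - snd y))\<^sup>2"
    using pair_nrm_power2[of "fst x - fst y" "snd x - snd y"] by (auto simp: minus_prod_def)
  then have "P.nrm (x - y) = 0 \<longleftrightarrow> nrm (fst x - fst y) = 0 \<and> nrm (snd x - snd y) = 0"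
    using sum_power2_eq_zero_iff[of "nrm (fst x - fst y)" "nrm (snd x - snd y)"]
      power_eq_0_iff[of "P.nrm (x - y)" 2] by simp
  then show ?thesis using True by (auto simp: eqv_def P.eqv_def)
qed (auto simp: eqv_def P.eqv_def mem_Times_iff)

lemma cscale_in [simp, intro]: "w \<in> V \<times> V \<Longrightarrow> cscale z w \<in> V \<times> V"
  by (auto simp: cscale_def)

lemma nrm_cscale: "w \<in> V \<times> V \<Longrightarrow> P.nrm (cscale z w) = cmod z * P.nrm w"
proof -
  assume w: "w \<in> V \<times> V"
  obtain u v where uv: "w = (u, v)" "u \<in> V" "v \<in> V" using w by auto
  have "pair_form B (cscale z w) (cscale z w) = ((Re z)\<^sup>2 + (Im z)\<^sup>2) * pair_form B w w"
    using B_quadratic[of "Re z *\<^sub>R u" v "- Im z"] B_quadratic[of "Im z *\<^sub>R u" v "Re z"] uv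
    by (simp add: pair_form_def cscale_def B_scale B_scale_right algebra_simps power2_eq_square)
  then show ?thesis
    by (simp add: P.nrm_def real_sqrt_mult cmod_def)
qed

lemma cscale_eqv: "P.eqv v w \<Longrightarrow> P.eqv (cscale z v) (cscale z w)"
  unfolding pair_eqv_iff cscale_def by (auto intro!: eqv_add eqv_diff eqv_scale)

text \<open>Expanding the squares leaves the sums of \<open>cos (2\<pi>k(j - l)/N)\<close> over \<open>k\<close>, which vanish off the
  diagonal. Starting the phases at \<open>Suc 0\<close> only rotates the coefficients; it is the indexing that
  arises from backward differences.\<close>
lemma Parseval:
  assumes N: "N > 0" and w: "\<And>j. j < N \<Longrightarrow> w j \<in> V"
  shows "(\<Sum>k<N. (P.nrm (\<Sum>j<N. cscale (cis (- (2 * pi * real k / real N * real (Suc j)))) (w j, 0)))\<^sup>2)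
      = real N * (\<Sum>j<N. (nrm (w j))\<^sup>2)"
proof -
  let ?\<theta> = "\<lambda>k. 2 * pi * real k / real N"
  have in_V: "(\<Sum>j<N. d j *\<^sub>R w j) \<in> V" for d :: "nat \<Rightarrow> real"
    using w by (intro V_sum V_closed) auto
  have sq: "(nrm (\<Sum>j<N. d j *\<^sub>R w j))\<^sup>2 = (\<Sum>j<N. \<Sum>l<N. d j * d l * B (w j) (w l))" for d
  proof -
    have "(nrm (\<Sum>j<N. d j *\<^sub>R w j))\<^sup>2 = (\<Sum>j<N. d j * B (w j) (\<Sum>j<N. d j *\<^sub>R w j))"
      unfolding nrm_power2[OF in_V] using w in_V by (intro B_sum_left) auto
    also have "\<dots> = (\<Sum>j<N. d j * (\<Sum>l<N. d l * B (w j) (w l)))"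
      using w by (intro sum.cong refl arg_cong2[where f = "(*)"] B_sum_right) auto
    finally show ?thesis by (simp only: sum_distrib_left mult.assoc)
  qed
  have expand: "(P.nrm (\<Sum>j<N. cscale (cis (- (?\<theta> k * real (Suc j)))) (w j, 0)))\<^sup>2
      = (\<Sum>j<N. \<Sum>l<N. cos (?\<theta> k * real_of_int (int j - int l)) * B (w j) (w l))" for k
  proof -
    let ?c = "\<lambda>j. cos (?\<theta> k * real (Suc j))" and ?s = "\<lambda>j. - sin (?\<theta> k * real (Suc j))"
    have trig: "(?c j * ?c l + ?s j * ?s l) = cos (?\<theta> k * real_of_int (int j - int l))" for j l
    proof -
      have "?c j * ?c l + ?s j * ?s l = cos (?\<theta> k * real (Suc j) - ?\<theta> k * real (Suc l))"
        by (simp only: cos_diff minus_mult_minus)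
      also have "?\<theta> k * real (Suc j) - ?\<theta> k * real (Suc l) = ?\<theta> k * real_of_int (int j - int l)"
        using N by (simp add: field_simps)
      finally show ?thesis .
    qed
    have "(\<Sum>j<N. cscale (cis (- (?\<theta> k * real (Suc j)))) (w j, 0))
        = (\<Sum>j<N. ?c j *\<^sub>R w j, \<Sum>j<N. ?s j *\<^sub>R w j)"
      by (simp add: cscale_def sum_prod)
    then have "(P.nrm (\<Sum>j<N. cscale (cis (- (?\<theta> k * real (Suc j)))) (w j, 0)))\<^sup>2
        = (nrm (\<Sum>j<N. ?c j *\<^sub>R w j))\<^sup>2 + (nrm (\<Sum>j<N. ?s j *\<^sub>R w j))\<^sup>2"
      by (simp only: pair_nrm_power2[OF in_V in_V])
    also have "\<dots> = (\<Sum>j<N. \<Sum>l<N. ?c j * ?c l * B (w j) (w l)) + (\<Sum>j<N. \<Sum>l<N. ?s j * ?s l * B (w j) (w l))"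
      by (simp only: sq)
    also have "(\<Sum>j<N. \<Sum>l<N. ?c j * ?c l * B (w j) (w l)) + (\<Sum>j<N. \<Sum>l<N. ?s j * ?s l * B (w j) (w l))
        = (\<Sum>j<N. \<Sum>l<N. (?c j * ?c l + ?s j * ?s l) * B (w j) (w l))"
      by (simp add: sum.distrib distrib_right)
    also have "\<dots> = (\<Sum>j<N. \<Sum>l<N. cos (?\<theta> k * real_of_int (int j - int l)) * B (w j) (w l))"
      by (simp only: trig)
    finally show ?thesis .
  qed
  have "(\<Sum>k<N. (P.nrm (\<Sum>j<N. cscale (cis (- (?\<theta> k * real (Suc j)))) (w j, 0)))\<^sup>2)
      = (\<Sum>k<N. \<Sum>j<N. \<Sum>l<N. cos (?\<theta> k * real_of_int (int j - int l)) * B (w j) (w l))"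
    by (rule sum.cong[OF refl expand])
  also have "\<dots> = (\<Sum>j<N. \<Sum>l<N. (\<Sum>k<N. cos (?\<theta> k * real_of_int (int j - int l))) * B (w j) (w l))"
    unfolding sum_distrib_right by (subst sum.swap, rule sum.cong[OF refl], rule sum.swap)
  also have "\<dots> = (\<Sum>j<N. \<Sum>l<N. if l = j then real N * B (w j) (w j) else 0)"
  proof (intro sum.cong refl)
    fix j l assume jl: "j \<in> {..<N}" "l \<in> {..<N}"
    show "(\<Sum>k<N. cos (?\<theta> k * real_of_int (int j - int l))) * B (w j) (w l)
        = (if l = j then real N * B (w j) (w j) else 0)"
    proof (cases "l = j")
      case False
      then have "(\<Sum>k<N. cos (?\<theta> k * real_of_int (int j - int l))) = 0"
        using jl by (intro sum_cos_roots_of_unity[OF N]) auto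
      then show ?thesis using False by simp
    qed simp
  qed
  also have "\<dots> = real N * (\<Sum>j<N. (nrm (w j))\<^sup>2)"
    using w by (simp add: nrm_power2 sum_distrib_left)
  finally show ?thesis .
qed

end

section \<open>Resolvent estimates for generators\<close>

context seminormed_semigroup
begin

interpretation P: semi_inner_product "V \<times> V" "pair_form B"
  by (rule pair_space)

text \<open>The complexified semigroup multiplied by \<open>exp(-\<mu>t)\<close>. Its generator is \<open>A - \<mu>\<close>, so that a lower
  bound for \<open>\<mu> - A\<close> is an instance of the lower bound for generators.\<close>
definition rotated :: "complex \<Rightarrow> real \<Rightarrow> 'a \<times> 'a \<Rightarrow> 'a \<times> 'a" where
  "rotated \<mu> t w = cscale (exp (- \<mu> * of_real t)) (S t (fst w), S t (snd w))"

lemma cscale_S_eqv: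
  "0 \<le> t \<Longrightarrow> w \<in> V \<times> V \<Longrightarrow>
    P.eqv (S t (fst (cscale z w)), S t (snd (cscale z w))) (cscale z (S t (fst w), S t (snd w)))"
  using S_linear[of t "fst w" "snd w" "Re z" "- Im z"] S_linear[of t "fst w" "snd w" "Im z" "Re z"]
  by (auto simp: pair_eqv_iff cscale_def)

lemma rotated_semigroup: "seminormed_semigroup (V \<times> V) (pair_form B) (rotated \<mu>)"
proof (intro seminormed_semigroup.intro pair_space seminormed_semigroup_axioms.intro)
  fix t :: real and u v :: "'a \<times> 'a" and \<alpha> \<beta> :: real
  assume t: "0 \<le> t" and u: "u \<in> V \<times> V"
  show "rotated \<mu> t u \<in> V \<times> V" using t u by (auto simp: rotated_def)
  assume v: "v \<in> V \<times> V"
  let ?e = "exp (- \<mu> * of_real t)"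
  have "P.eqv (rotated \<mu> t (\<alpha> *\<^sub>R u + \<beta> *\<^sub>R v))
      (cscale ?e (\<alpha> *\<^sub>R (S t (fst u), S t (snd u)) + \<beta> *\<^sub>R (S t (fst v), S t (snd v))))"
    unfolding rotated_def using t u v
    by (intro cscale_eqv) (auto simp: pair_eqv_iff intro!: S_linear)
  then show "P.eqv (rotated \<mu> t (\<alpha> *\<^sub>R u + \<beta> *\<^sub>R v)) (\<alpha> *\<^sub>R rotated \<mu> t u + \<beta> *\<^sub>R rotated \<mu> t v)"
    by (simp only: cscale_add_right cscale_scaleR rotated_def)
next
  fix t :: real assume t: "0 \<le> t"
  obtain C where C: "\<forall>u\<in>V. nrm (S t u) \<le> C * nrm u" using S_bounded[OF t] by blast
  have "P.nrm (rotated \<mu> t u) \<le> cmod (exp (- \<mu> * of_real t)) * \<bar>C\<bar> * P.nrm u" if u: "u \<in> V \<times> V" for u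
  proof -
    have *: "(nrm (S t x))\<^sup>2 \<le> (\<bar>C\<bar> * nrm x)\<^sup>2" if "x \<in> V" for x
    proof (intro power_mono)
      have "nrm (S t x) \<le> C * nrm x" using C that by blast
      also have "\<dots> \<le> \<bar>C\<bar> * nrm x" using that by (intro mult_right_mono) auto
      finally show "nrm (S t x) \<le> \<bar>C\<bar> * nrm x" .
    qed (use that t in auto)
    have "(P.nrm (S t (fst u), S t (snd u)))\<^sup>2 \<le> (\<bar>C\<bar> * P.nrm u)\<^sup>2"
      using *[of "fst u"] *[of "snd u"] u t pair_nrm_power2[of "fst u" "snd u"]
      by (auto simp: pair_nrm_power2 power_mult_distrib distrib_left)
    then have "P.nrm (S t (fst u), S t (snd u)) \<le> \<bar>C\<bar> * P.nrm u"
      by (rule power2_le_imp_le) (use u in auto)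
    then show ?thesis
      using u t by (auto simp: rotated_def nrm_cscale mult.assoc intro!: mult_left_mono)
  qed
  then show "\<exists>C. \<forall>u\<in>V \<times> V. P.nrm (rotated \<mu> t u) \<le> C * P.nrm u" by blast
next
  fix u assume "u \<in> V \<times> V"
  then show "P.eqv (rotated \<mu> 0 u) u"
    by (auto simp: rotated_def pair_eqv_iff intro: S_zero)
next
  fix s t :: real and u assume st: "0 \<le> s" "0 \<le> t" and u: "u \<in> V \<times> V"
  let ?e = "\<lambda>t::real. exp (- \<mu> * of_real t)"
  have "?e (s + t) = ?e s * ?e t" by (simp add: algebra_simps flip: exp_add)
  then have split: "rotated \<mu> (s + t) u = cscale (?e s) (cscale (?e t) (S (s + t) (fst u), S (s + t) (snd u)))"
    by (simp only: rotated_def cscale_mult)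
  have "P.eqv (cscale (?e s) (cscale (?e t) (S (s + t) (fst u), S (s + t) (snd u)))) (cscale (?e s) (cscale (?e t) (S s (S t (fst u)), S s (S t (snd u)))))"
    using st u by (intro cscale_eqv) (auto simp: pair_eqv_iff intro!: S_add)
  moreover have "P.eqv (cscale (?e s) (cscale (?e t) (S s (S t (fst u)), S s (S t (snd u))))) (rotated \<mu> s (rotated \<mu> t u))"
    unfolding rotated_def
    by (intro cscale_eqv P.eqv_sym[OF cscale_S_eqv[OF st(1), of "(S t (fst u), S t (snd u))", simplified]])
      (use st u in auto)
  ultimately show "P.eqv (rotated \<mu> (s + t) u) (rotated \<mu> s (rotated \<mu> t u))"
    unfolding split by (rule P.eqv_trans)
qed

lemma rotated_gen:
  assumes "gen u f" "gen v g"
  shows "seminormed_semigroup.gen (V \<times> V) (pair_form B) (rotated \<mu>) (u, v) ((f, g) - cscale \<mu> (u, v))"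
proof -
  interpret R: seminormed_semigroup "V \<times> V" "pair_form B" "rotated \<mu>" by (rule rotated_semigroup)
  note V = gen_in[OF assms(1)] gen_in[OF assms(2)]
  let ?e = "\<lambda>t::real. exp (- \<mu> * of_real t)"
  let ?q = "\<lambda>u f t. (1 / t) *\<^sub>R (S t u - u) - f"
  let ?Q = "\<lambda>t. (1 / t) *\<^sub>R (rotated \<mu> t (u, v) - (u, v)) - ((f, g) - cscale \<mu> (u, v))"
  have regroup: "c *\<^sub>R (x - w) - (y - z) = c *\<^sub>R (x - x') - y' + (c *\<^sub>R (x' - w) + z) + (y' - y)"
    for c and w x x' y y' z :: "'a \<times> 'a"
    by (simp add: algebra_simps)
  have "((\<lambda>t. P.nrm (?Q t)) \<longlongrightarrow> 0) (at_right 0)"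
  proof (rule tendsto_sandwich[where f = "\<lambda>_. 0"])
    let ?b = "\<lambda>t. cmod (?e t) * (nrm (?q u f t) + nrm (?q v g t)) + cmod ((?e t - 1) / of_real t + \<mu>) * P.nrm (u, v)
        + cmod (?e t - 1) * P.nrm (f, g)"
    have "((\<lambda>z. exp (- \<mu> * z)) has_field_derivative - \<mu>) (at 0)"
      by (auto intro!: derivative_eq_intros)
    then have "((\<lambda>h. (exp (- \<mu> * h) - 1) / h) \<longlongrightarrow> - \<mu>) (at 0)"
      by (simp add: has_field_derivative_iff)
    moreover have "filterlim (of_real :: real \<Rightarrow> complex) (at 0) (at_right 0)"
      unfolding filterlim_at
      by (auto intro!: tendsto_eq_intros eventually_mono[OF eventually_at_right_less])
    ultimately have "((\<lambda>t. (?e t - 1) / of_real t) \<longlongrightarrow> - \<mu>) (at_right 0)"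
      by (rule filterlim_compose)
    then have lim1: "((\<lambda>t. (?e t - 1) / of_real t + \<mu>) \<longlongrightarrow> 0) (at_right 0)"
      using tendsto_add[OF _ tendsto_const[of \<mu>], of _ "- \<mu>"] by simp
    have lim2: "(?e \<longlongrightarrow> 1) (at_right 0)"
      by (auto intro!: tendsto_eq_intros)
    have "(?b \<longlongrightarrow> cmod 1 * (0 + 0) + cmod 0 * P.nrm (u, v) + cmod (1 - 1) * P.nrm (f, g)) (at_right 0)"
      using assms unfolding gen_def by (intro tendsto_intros lim1 lim2) auto
    then show "(?b \<longlongrightarrow> 0) (at_right 0)" by simp
    show "\<forall>\<^sub>F t in at_right 0. 0 \<le> P.nrm (?Q t)"
    proof (rule eventually_mono[OF eventually_at_right_less])
      fix t :: real assume t: "0 < t"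
      have uv: "(u, v) \<in> V \<times> V" "(f, g) \<in> V \<times> V" using V by auto
      have "?Q t \<in> V \<times> V"
        using R.S_in[of t "(u, v)"] uv t by (intro P.V_closed(3,4) cscale_in) auto
      then show "0 \<le> P.nrm (?Q t)" by (rule P.nrm_ge0)
    qed
    show "\<forall>\<^sub>F t in at_right 0. P.nrm (?Q t) \<le> ?b t"
    proof (rule eventually_mono[OF eventually_at_right_less])
      fix t :: real assume t: "0 < t"
      have e: "cscale ((?e t - 1) / of_real t + \<mu>) (u, v)
          = (1 / t) *\<^sub>R (cscale (?e t) (u, v) - (u, v)) + cscale \<mu> (u, v)"
      proof -
        have "(?e t - 1) / of_real t = of_real (1 / t) * (?e t - 1)" by simp
        then show ?thesis
          by (simp only: cscale_add_left cscale_mult cscale_of_real cscale_diff_left cscale_simps)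
      qed
      have "?Q t = cscale (?e t) (?q u f t, ?q v g t) + cscale ((?e t - 1) / of_real t + \<mu>) (u, v)
          + cscale (?e t - 1) (f, g)"
      proof -
        have "(?q u f t, ?q v g t) = (1 / t) *\<^sub>R ((S t u, S t v) - (u, v)) - (f, g)" by simp
        then show ?thesis
          by (simp only: e rotated_def fst_conv snd_conv cscale_diff_right cscale_diff_left cscale_scaleR
              cscale_simps regroup)
      qed
      also have "P.nrm \<dots> \<le> P.nrm (cscale (?e t) (?q u f t, ?q v g t)) 
          + P.nrm (cscale ((?e t - 1) / of_real t + \<mu>) (u, v)) + P.nrm (cscale (?e t - 1) (f, g))"
        using V t by (intro order_trans[OF P.nrm_triangle] add_mono P.nrm_triangle) auto
      also have "\<dots> = cmod (?e t) * P.nrm (?q u f t, ?q v g t) + cmod ((?e t - 1) / of_real t + \<mu>) * P.nrm (u, v)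
        + cmod (?e t - 1) * P.nrm (f, g)"
        using V t by (simp add: nrm_cscale)
      also have "\<dots> \<le> ?b t"
        using V t by (intro add_mono mult_left_mono pair_nrm_le) auto
      finally show "P.nrm (?Q t) \<le> ?b t" .
    qed
  qed simp
  then show ?thesis
    unfolding R.gen_def using V by (intro conjI P.V_closed(3) cscale_in SigmaI)
qed

end

context seminormed_semigroup
begin

interpretation P: semi_inner_product "V \<times> V" "pair_form B"
  by (rule pair_space)

lemma complex_lower_bound:
  assumes "C \<ge> 0" "Re \<mu> + \<omega> > 0"
    and bound: "\<And>t u. \<lbrakk>0 \<le> t; u \<in> V\<rbrakk> \<Longrightarrow> nrm (S t u) \<le> C * exp (- \<omega> * t) * nrm u"
    and gen: "gen u f" "gen v g"
  shows "P.nrm (u, v) \<le> C / (Re \<mu> + \<omega>) * P.nrm (cscale \<mu> (u, v) - (f, g))"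
proof -
  interpret R: seminormed_semigroup "V \<times> V" "pair_form B" "rotated \<mu>" by (rule rotated_semigroup)
  have "P.nrm (rotated \<mu> t w) \<le> C * exp (- (Re \<mu> + \<omega>) * t) * P.nrm w" if t: "0 \<le> t" and w: "w \<in> V \<times> V" for t w
  proof -
    have *: "(nrm (S t x))\<^sup>2 \<le> (C * exp (- \<omega> * t) * nrm x)\<^sup>2" if "x \<in> V" for x
      using bound[OF t that] that t by (intro power_mono) auto
    have "(P.nrm (S t (fst w), S t (snd w)))\<^sup>2 \<le> (C * exp (- \<omega> * t) * P.nrm w)\<^sup>2"
      using *[of "fst w"] *[of "snd w"] w t pair_nrm_power2[of "fst w" "snd w"]
      by (auto simp: pair_nrm_power2 power_mult_distrib distrib_left)
    then have "P.nrm (S t (fst w), S t (snd w)) \<le> C * exp (- \<omega> * t) * P.nrm w"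
      by (rule power2_le_imp_le) (use w assms(1) in auto)
    then have "exp (- Re \<mu> * t) * P.nrm (S t (fst w), S t (snd w)) 
        \<le> exp (- Re \<mu> * t) * (C * exp (- \<omega> * t) * P.nrm w)"
      by (intro mult_left_mono) auto
    also have "\<dots> = C * exp (- (Re \<mu> + \<omega>) * t) * P.nrm w"
      by (simp add: algebra_simps flip: exp_add)
    finally show ?thesis
      using w t by (auto simp: rotated_def nrm_cscale norm_exp_eq_Re)
  qed
  from R.generator_lower_bound[OF assms(2,1) this rotated_gen[OF gen]]
  have "P.nrm (u, v) \<le> C / (Re \<mu> + \<omega>) * P.nrm ((f, g) - cscale \<mu> (u, v))" by simp
  then show ?thesis
    using P.nrm_minus_commute[of "(f, g)" "cscale \<mu> (u, v)"] gen gen_in by auto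
qed

definition imag_axis_bound :: "real \<Rightarrow> bool" where
  "imag_axis_bound K \<longleftrightarrow> (\<forall>t u v f g. gen u f \<longrightarrow> gen v g \<longrightarrow>
     P.nrm (u, v) \<le> K * P.nrm (cscale (\<i> * of_real t) (u, v) - (f, g)))"

text \<open>Two bounds complement each other. A contraction semigroup satisfies
  \<open>\<parallel>u\<parallel> \<le> \<parallel>(\<mu> - A)u\<parallel> / Re \<mu>\<close>, which is good for large \<open>Re \<mu>\<close>; for small \<open>Re \<mu>\<close> the term
  \<open>(Re \<mu>)u\<close> is absorbed into the bound on the imaginary axis.\<close>
lemma half_plane_bound:
  assumes contr: "\<And>t u. \<lbrakk>0 \<le> t; u \<in> V\<rbrakk> \<Longrightarrow> nrm (S t u) \<le> nrm u"
    and K: "imag_axis_bound K" "K > 0" and \<mu>: "Re \<mu> \<ge> 0" and gen: "gen u f" "gen v g"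
  shows "P.nrm (u, v) \<le> 2 * K * P.nrm (cscale \<mu> (u, v) - (f, g))"
proof (cases "2 * K * Re \<mu> \<ge> 1")
  note V = gen_in[OF gen(1)] gen_in[OF gen(2)]
  case True
  then have pos: "Re \<mu> > 0" using K(2) \<mu> by (cases "Re \<mu> = 0") auto
  have "P.nrm (u, v) \<le> 1 / (Re \<mu> + 0) * P.nrm (cscale \<mu> (u, v) - (f, g))"
    using contr gen pos by (intro complex_lower_bound) auto
  also have "\<dots> \<le> 2 * K * P.nrm (cscale \<mu> (u, v) - (f, g))"
    using True pos V by (intro mult_right_mono P.nrm_ge0 P.V_closed) (auto simp: field_simps)
  finally show ?thesis .
next
  note V = gen_in[OF gen(1)] gen_in[OF gen(2)]
  case False
  have "\<i> * of_real (Im \<mu>) = \<mu> - of_real (Re \<mu>)" by (simp add: complex_eq_iff)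
  then have "cscale (\<i> * of_real (Im \<mu>)) (u, v) - (f, g)
      = (cscale \<mu> (u, v) - (f, g)) - Re \<mu> *\<^sub>R (u, v)"
    by (simp only: cscale_diff_left cscale_of_real) (simp only: algebra_simps)
  then have "P.nrm (u, v) \<le> K * P.nrm ((cscale \<mu> (u, v) - (f, g)) - Re \<mu> *\<^sub>R (u, v))"
    using K(1) gen unfolding imag_axis_bound_def by metis
  also have "\<dots> \<le> K * (P.nrm (cscale \<mu> (u, v) - (f, g)) + P.nrm (Re \<mu> *\<^sub>R (u, v)))"
    using K V by (intro mult_left_mono P.nrm_triangle_diff P.V_closed) auto
  also have "\<dots> = K * P.nrm (cscale \<mu> (u, v) - (f, g)) + K * Re \<mu> * P.nrm (u, v)"
    using V \<mu> by (subst P.nrm_scale) (auto simp: algebra_simps)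
  also have "\<dots> \<le> K * P.nrm (cscale \<mu> (u, v) - (f, g)) + 1 / 2 * P.nrm (u, v)"
    using False V by (intro add_left_mono mult_right_mono P.nrm_ge0) auto
  finally show ?thesis by simp
qed

text \<open>The discrete Fourier transform of \<open>w (Suc i) - w i\<close> is \<open>1 - exp(-\<i>\<theta>)\<close> times that of \<open>w\<close>, because
  \<open>w\<close> vanishes at both ends. So the transform of the residual is \<open>d(\<mu> - A)\<close> applied to the transform
  of \<open>w\<close>, where \<open>\<mu> = (1 - exp(-\<i>\<theta>))/d\<close> has nonnegative real part. (Forward differences would give
  \<open>Re \<mu> \<le> 0\<close>, a half-plane into which the bound on the imaginary axis does not extend.)
  Parseval's identity turns the bounds for all \<open>\<theta>\<close> into the estimate of sums.\<close>
lemma discrete_resolvent_estimate: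
  assumes contr: "\<And>t u. \<lbrakk>0 \<le> t; u \<in> V\<rbrakk> \<Longrightarrow> nrm (S t u) \<le> nrm u"
    and K: "imag_axis_bound K" "K > 0" and d: "d > 0" and N: "N > 0"
    and gen: "\<And>i. gen (w i) (F i)" and w0: "w 0 = 0" "w N = 0"
  shows "(\<Sum>i<N. (nrm (w (Suc i)))\<^sup>2) \<le> (2 * K / d)\<^sup>2 * (\<Sum>i<N. (nrm (w (Suc i) - w i - d *\<^sub>R F (Suc i)))\<^sup>2)"
proof -
  have V: "w i \<in> V" "F i \<in> V" for i using gen_in[OF gen[of i]] by auto
  define r where "r i = w (Suc i) - w i - d *\<^sub>R F (Suc i)" for i
  define T where "T \<theta> x = (\<Sum>i<N. cscale (cis (- (\<theta> * real (Suc i)))) (x i, 0))" for \<theta> and x :: "nat \<Rightarrow> 'a"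
  have T_in: "T \<theta> x \<in> V \<times> V" if "\<And>i. x i \<in> V" for \<theta> x
    unfolding T_def using that by (intro P.V_sum cscale_in) auto
  have est: "P.nrm (T \<theta> (\<lambda>i. w (Suc i))) \<le> 2 * K / d * P.nrm (T \<theta> r)" for \<theta>
  proof -
    let ?w = "T \<theta> (\<lambda>i. w (Suc i))" and ?F = "T \<theta> (\<lambda>i. F (Suc i))"
    define \<mu> where "\<mu> = (1 - cis (- \<theta>)) / of_real d"
    have \<mu>: "Re \<mu> \<ge> 0" using d by (simp add: \<mu>_def)
    have "(\<Sum>i<N. cscale (cis (- (\<theta> * real (Suc i)))) (w i, 0)) = cscale (cis (- \<theta>)) ?w"
    proof -
      have "(\<Sum>i<N. cscale (cis (- (\<theta> * real (Suc i)))) (w i, 0)) 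
          = (\<Sum>i<N. cscale (cis (- \<theta>)) (cscale (cis (- (\<theta> * real i))) (w i, 0)))"
        by (simp add: cis_mult algebra_simps flip: cscale_mult)
      also have "\<dots> = cscale (cis (- \<theta>)) (\<Sum>i<N. cscale (cis (- (\<theta> * real i))) (w i, 0))"
        by (simp add: cscale_sum_right)
      also have "(\<Sum>i<N. cscale (cis (- (\<theta> * real i))) (w i, 0))
          = (\<Sum>i<Suc N. cscale (cis (- (\<theta> * real i))) (w i, 0))"
        using w0 by (simp flip: zero_prod_def)
      also have "\<dots> = ?w"
        using w0 by (subst sum.lessThan_Suc_shift) (simp add: T_def flip: zero_prod_def)
      finally show ?thesis .
    qed
    then have "T \<theta> r = ?w - cscale (cis (- \<theta>)) ?w - d *\<^sub>R ?F"
    proof -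
      have e: "(r i, 0) = (w (Suc i), 0) - (w i, 0) - d *\<^sub>R (F (Suc i), 0)" for i
        by (simp add: r_def)
      have "T \<theta> r = ?w - (\<Sum>i<N. cscale (cis (- (\<theta> * real (Suc i)))) (w i, 0)) - d *\<^sub>R ?F"
        unfolding T_def e cscale_diff_right cscale_scaleR by (simp only: sum_subtractf scaleR_sum_right)
      then show ?thesis
        using \<open>(\<Sum>i<N. cscale (cis (- (\<theta> * real (Suc i)))) (w i, 0)) = cscale (cis (- \<theta>)) ?w\<close> by simp
    qed
    also have "\<dots> = d *\<^sub>R (cscale \<mu> ?w - ?F)"
    proof -
      have "d *\<^sub>R cscale \<mu> ?w = cscale (of_real d * \<mu>) ?w"
        by (simp only: cscale_mult cscale_of_real)
      also have "of_real d * \<mu> = 1 - cis (- \<theta>)" using d by (simp add: \<mu>_def)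
      finally show ?thesis by (simp add: cscale_diff_left scaleR_diff_right)
    qed
    finally have Tr: "P.nrm (T \<theta> r) = d * P.nrm (cscale \<mu> ?w - ?F)"
      using d T_in V by (simp add: P.nrm_scale cscale_in)
    have T_pair: "T \<theta> x = (\<Sum>i<N. cos (\<theta> * real (Suc i)) *\<^sub>R x i, \<Sum>i<N. (- sin (\<theta> * real (Suc i))) *\<^sub>R x i)" for x
      by (simp add: T_def cscale_def sum_prod)
    have "P.nrm ?w \<le> 2 * K * P.nrm (cscale \<mu> ?w - ?F)"
      unfolding T_pair by (intro half_plane_bound[OF contr K \<mu>] gen_sum gen)
    then show ?thesis using Tr d by simp
  qed
  have rV: "r i \<in> V" for i using V by (simp add: r_def)
  let ?\<theta> = "\<lambda>k. 2 * pi * real k / real N"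
  have "real N * (\<Sum>i<N. (nrm (w (Suc i)))\<^sup>2) = (\<Sum>k<N. (P.nrm (T (?\<theta> k) (\<lambda>i. w (Suc i))))\<^sup>2)"
    unfolding T_def by (rule Parseval[symmetric]) (use N V in auto)
  also have "\<dots> \<le> (\<Sum>k<N. (2 * K / d * P.nrm (T (?\<theta> k) r))\<^sup>2)"
    using T_in V by (intro sum_mono power_mono est P.nrm_ge0) auto
  also have "\<dots> = (2 * K / d)\<^sup>2 * (\<Sum>k<N. (P.nrm (T (?\<theta> k) r))\<^sup>2)"
    by (simp only: power_mult_distrib sum_distrib_left)
  also have "(\<Sum>k<N. (P.nrm (T (?\<theta> k) r))\<^sup>2) = real N * (\<Sum>i<N. (nrm (r i))\<^sup>2)"
    unfolding T_def by (rule Parseval) (use N rV in auto)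
  finally have le: "real N * (\<Sum>i<N. (nrm (w (Suc i)))\<^sup>2) \<le> (2 * K / d)\<^sup>2 * (real N * (\<Sum>i<N. (nrm (r i))\<^sup>2))" .
  have cancel: "x \<le> c * y" if "real N * x \<le> c * (real N * y)" for x y c :: real
    using that N by (simp add: mult.left_commute)
  show ?thesis using cancel[OF le] unfolding r_def .
qed

end

text \<open>On the middle half of the interval the tent function is at least \<open>1/4\<close>.\<close>
lemma tent_square_sum:
  assumes "n > 0"
  shows "real n / 8 \<le> (\<Sum>i<4 * n. (real (min (Suc i) (4 * n - Suc i)) / real (4 * n))\<^sup>2)"
proof -
  let ?tent = "\<lambda>i. real (min i (4 * n - i)) / real (4 * n)"
  have "real n / 8 = (\<Sum>i\<in>{n..<3 * n}. (1 / 4)\<^sup>2)"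
    by (simp add: power2_eq_square)
  also have "\<dots> \<le> (\<Sum>i\<in>{n..<3 * n}. (?tent (Suc i))\<^sup>2)"
  proof (intro sum_mono power_mono)
    fix i assume "i \<in> {n..<3 * n}"
    then have "n \<le> min (Suc i) (4 * n - Suc i)" by auto
    then have "real n / real (4 * n) \<le> ?tent (Suc i)"
      by (intro divide_right_mono) auto
    then show "1 / 4 \<le> ?tent (Suc i)" using assms by simp
  qed auto
  also have "\<dots> \<le> (\<Sum>i<4 * n. (?tent (Suc i))\<^sup>2)"
    by (intro sum_mono2) auto
  finally show ?thesis .
qed

context seminormed_semigroup
begin

text \<open>The discrete estimate is applied to the orbit multiplied by a tent function. The residual consists
  of the slope \<open>1/N\<close> of the tent and the consistency error \<open>d \<cdot> \<epsilon> d\<close> of the backward Euler scheme, while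
  the left-hand side is at least \<open>N/32\<close> times \<open>(nrm (S \<tau> u))\<^sup>2\<close>, as the orbit decreases in norm.
  Since \<open>d = \<tau>/N\<close>, this gives \<open>nrm (S \<tau> u) \<le> sqrt 128 \<cdot> K (nrm u / \<tau> + \<epsilon> d)\<close>, and \<open>d\<close> tends to \<open>0\<close>.\<close>
lemma contraction_decay:
  assumes contr: "\<And>t u. \<lbrakk>0 \<le> t; u \<in> V\<rbrakk> \<Longrightarrow> nrm (S t u) \<le> nrm u"
    and cont: "\<And>u. u \<in> V \<Longrightarrow> ((\<lambda>t. nrm (S t u - u)) \<longlongrightarrow> 0) (at_right 0)"
    and K: "imag_axis_bound K" "K > 0" and gen: "gen u f" and \<tau>: "\<tau> > 0"
  shows "nrm (S \<tau> u) \<le> 12 * K / \<tau> * nrm u"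
proof -
  note V = gen_in[OF gen]
  define \<epsilon> where "\<epsilon> d = nrm ((1 / d) *\<^sub>R (S d u - u) - f) + nrm (S d f - f)" for d
  have \<epsilon>0: "\<epsilon> d \<ge> 0" if "d > 0" for d using V that by (simp add: \<epsilon>_def)
  have main: "nrm (S \<tau> u) \<le> 12 * K * (nrm u / \<tau> + \<epsilon> (\<tau> / real (4 * n)))" if n: "n > 0" for n
  proof -
    \<comment> \<open>A multiple of four, so that the middle half of the tent has integral end points.\<close>
    define N where "N = 4 * n"
    have N: "N > 0" using n by (simp add: N_def)
    define d where "d = \<tau> / real N"
    have d: "d > 0" using N \<tau> by (simp add: d_def)
    have Nd: "real N * d = \<tau>" using N by (simp add: d_def)
    define tent where "tent i = real (min i (N - i)) / real N" for i
    define w where "w i = tent i *\<^sub>R S (real i * d) u" for i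
    define F where "F i = tent i *\<^sub>R S (real i * d) f" for i
    have gens: "gen (w i) (F i)" for i
      unfolding w_def F_def using gen d by (intro gen_scale gen_semigroup) auto
    have ends: "w 0 = 0" "w N = 0" by (auto simp: w_def tent_def)
    have tent01: "0 \<le> tent i" "tent i \<le> 1" for i using N by (auto simp: tent_def min_def field_simps)
    have tent_diff: "\<bar>tent (Suc i) - tent i\<bar> \<le> 1 / real N" if "i < N" for i
    proof -
      have "\<bar>real (min (Suc i) (N - Suc i)) - real (min i (N - i))\<bar> \<le> 1" using that by (auto simp: min_def)
      then show ?thesis using N by (simp add: tent_def flip: diff_divide_distrib abs_divide)
          (simp add: divide_le_cancel abs_divide)
    qed
    let ?S = "\<lambda>i. S (real i * d)"
    have SV: "?S i v \<in> V" if "v \<in> V" for i v using d that by (intro S_in) auto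
    have defect: "nrm (?S (Suc i) u - ?S i u - d *\<^sub>R ?S (Suc i) f) \<le> d * \<epsilon> d" for i
    proof -
      have t: "0 \<le> real i * d" using d by simp
      have step: "?S (Suc i) v \<simeq> ?S i (S d v)" if "v \<in> V" for v
        using S_add[OF t, of d v] d that by (simp add: algebra_simps)
      have "?S (Suc i) u - ?S i u - d *\<^sub>R ?S (Suc i) f \<simeq> ?S i (S d u) - ?S i u - d *\<^sub>R ?S i (S d f)"
        using V SV by (intro eqv_diff eqv_scale step eqv_refl) auto
      also have "\<dots> \<simeq> ?S i (S d u - u) - ?S i (d *\<^sub>R S d f)"
        using V d t by (intro eqv_diff eqv_sym[OF S_diff] eqv_sym[OF S_scale]) auto
      also have "\<dots> \<simeq> ?S i (S d u - u - d *\<^sub>R S d f)"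
        using V d t by (intro eqv_sym[OF S_diff]) auto
      finally have "nrm (?S (Suc i) u - ?S i u - d *\<^sub>R ?S (Suc i) f) = nrm (?S i (S d u - u - d *\<^sub>R S d f))"
        by (rule eqv_nrm)
      also have "\<dots> \<le> nrm (S d u - u - d *\<^sub>R S d f)"
        using V d t by (intro contr) auto
      also have "S d u - u - d *\<^sub>R S d f = d *\<^sub>R (((1 / d) *\<^sub>R (S d u - u) - f) - (S d f - f))"
        using d by (simp add: algebra_simps)
      also have "nrm \<dots> = d * nrm (((1 / d) *\<^sub>R (S d u - u) - f) - (S d f - f))"
        using d V by (subst nrm_scale) auto
      also have "\<dots> \<le> d * \<epsilon> d"
        unfolding \<epsilon>_def using d V by (intro mult_left_mono nrm_triangle_diff) auto
      finally show ?thesis .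
    qed
    have resid: "nrm (w (Suc i) - w i - d *\<^sub>R F (Suc i)) \<le> d * (nrm u / \<tau> + \<epsilon> d)" if i: "i < N" for i
    proof -
      have "w (Suc i) - w i - d *\<^sub>R F (Suc i)
          = (tent (Suc i) - tent i) *\<^sub>R ?S i u + tent (Suc i) *\<^sub>R (?S (Suc i) u - ?S i u - d *\<^sub>R ?S (Suc i) f)"
        unfolding w_def F_def by (simp add: algebra_simps)
      also have "nrm \<dots> \<le> nrm ((tent (Suc i) - tent i) *\<^sub>R ?S i u) + nrm (tent (Suc i) *\<^sub>R (?S (Suc i) u - ?S i u - d *\<^sub>R ?S (Suc i) f))"
        using V by (intro nrm_triangle V_closed SV)
      also have "\<dots> = \<bar>tent (Suc i) - tent i\<bar> * nrm (?S i u) + \<bar>tent (Suc i)\<bar> * nrm (?S (Suc i) u - ?S i u - d *\<^sub>R ?S (Suc i) f)"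
        using V by (simp only: nrm_scale V_closed SV)
      also have "\<dots> \<le> (1 / real N) * nrm u + 1 * (d * \<epsilon> d)"
        using V SV tent01 tent_diff[OF i] d defect by (intro add_mono mult_mono contr) auto
      also have "1 / real N = d / \<tau>" using N \<tau> by (simp add: d_def)
      finally show ?thesis by (simp add: algebra_simps)
    qed
    have "(nrm (S \<tau> u))\<^sup>2 * (real n / 8) \<le> (nrm (S \<tau> u))\<^sup>2 * (\<Sum>i<N. (tent (Suc i))\<^sup>2)"
      using tent_square_sum[OF n] by (intro mult_left_mono) (auto simp: N_def tent_def)
    also have "\<dots> = (\<Sum>i<N. (tent (Suc i) * nrm (S \<tau> u))\<^sup>2)"
      by (simp add: sum_distrib_left power_mult_distrib mult.commute)
    also have "\<dots> \<le> (\<Sum>i<N. (nrm (w (Suc i)))\<^sup>2)"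
    proof (intro sum_mono power_mono)
      fix i assume i: "i \<in> {..<N}"
      have le: "real (Suc i) * d \<le> \<tau>"
        using i d mult_right_mono[of "real (Suc i)" "real N" d] Nd by simp
      have "S \<tau> u \<simeq> S (\<tau> - real (Suc i) * d) (?S (Suc i) u)"
        using S_add[of "\<tau> - real (Suc i) * d" "real (Suc i) * d" u] le d V by simp
      then have "nrm (S \<tau> u) \<le> nrm (?S (Suc i) u)"
        using eqv_nrm[of "S \<tau> u"] contr[of "\<tau> - real (Suc i) * d" "?S (Suc i) u"] le SV[OF V(1), of "Suc i"]
        by simp
      then show "tent (Suc i) * nrm (S \<tau> u) \<le> nrm (w (Suc i))"
        unfolding w_def nrm_scale[OF SV[OF V(1)]] abs_of_nonneg[OF tent01(1)]
        by (intro mult_left_mono tent01)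
    qed (use tent01 V \<tau> in auto)
    also have "\<dots> \<le> (2 * K / d)\<^sup>2 * (\<Sum>i<N. (nrm (w (Suc i) - w i - d *\<^sub>R F (Suc i)))\<^sup>2)"
      by (rule discrete_resolvent_estimate[OF contr K d N gens ends])
    also have "\<dots> \<le> (2 * K / d)\<^sup>2 * (\<Sum>i<N. (d * (nrm u / \<tau> + \<epsilon> d))\<^sup>2)"
      using resid gen_in[OF gens] by (intro mult_left_mono sum_mono power_mono) auto
    also have "\<dots> = 4 * real N * (K * (nrm u / \<tau> + \<epsilon> d))\<^sup>2"
      using d by (simp add: power2_eq_square)
    also have "\<dots> = 16 * real n * (K * (nrm u / \<tau> + \<epsilon> d))\<^sup>2" by (simp add: N_def)
    finally have "(nrm (S \<tau> u))\<^sup>2 * real n \<le> (128 * (K * (nrm u / \<tau> + \<epsilon> d))\<^sup>2) * real n"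
      by (simp add: mult_ac)
    then have "(nrm (S \<tau> u))\<^sup>2 \<le> 128 * (K * (nrm u / \<tau> + \<epsilon> d))\<^sup>2" using n by simp
    also have "\<dots> \<le> (12 * K * (nrm u / \<tau> + \<epsilon> d))\<^sup>2" by (simp add: power_mult_distrib mult.assoc)
    finally have "nrm (S \<tau> u) \<le> 12 * K * (nrm u / \<tau> + \<epsilon> d)"
      by (rule power2_le_imp_le) (use V \<tau> K \<epsilon>0[OF d] in auto)
    then show ?thesis by (simp add: d_def N_def)
  qed
  have "filterlim (\<lambda>n. \<tau> / real (4 * n)) (at_right 0) sequentially"
  proof -
    have "(\<lambda>n. \<tau> / 4 * inverse (real n)) \<longlonglongrightarrow> \<tau> / 4 * 0"
      by (intro tendsto_mult tendsto_const lim_inverse_n)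
    then have "(\<lambda>n. \<tau> / real (4 * n)) \<longlonglongrightarrow> 0" by (simp add: field_simps)
    moreover have "\<forall>\<^sub>F n in sequentially. \<tau> / real (4 * n) \<in> {0<..}"
      using \<tau> by (intro eventually_sequentiallyI[of 1]) auto
    ultimately show ?thesis
      by (simp add: filterlim_at eventually_conj_iff)
        (auto elim: eventually_mono)
  qed
  moreover have "(\<epsilon> \<longlongrightarrow> 0 + 0) (at_right 0)"
    unfolding \<epsilon>_def using gen cont[OF V(2)] by (intro tendsto_add) (auto simp: gen_def)
  ultimately have "(\<lambda>n. \<epsilon> (\<tau> / real (4 * n))) \<longlonglongrightarrow> 0"
    by (auto intro: filterlim_compose)
  then have "(\<lambda>n. 12 * K * (nrm u / \<tau> + \<epsilon> (\<tau> / real (4 * n)))) \<longlonglongrightarrow> 12 * K * (nrm u / \<tau> + 0)"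
    by (intro tendsto_intros)
  then have "nrm (S \<tau> u) \<le> 12 * K * (nrm u / \<tau> + 0)"
    by (rule LIMSEQ_le_const) (use main in \<open>auto intro!: exI[of _ 1]\<close>)
  then show ?thesis by simp
qed

text \<open>For \<open>\<tau> = 24 K\<close> the preceding bound makes \<open>S(\<tau>)\<close> halve the norm, first on the domain of the
  generator and by density everywhere; iterating gives the exponential decay.\<close>
lemma contraction_exp_stable:
  assumes contr: "\<And>t u. \<lbrakk>0 \<le> t; u \<in> V\<rbrakk> \<Longrightarrow> nrm (S t u) \<le> nrm u"
    and cont: "\<And>u. u \<in> V \<Longrightarrow> ((\<lambda>t. nrm (S t u - u)) \<longlongrightarrow> 0) (at_right 0)"
    and K: "imag_axis_bound K" "K > 0"
    and dense: "\<And>v e. v \<in> V \<Longrightarrow> e > 0 \<Longrightarrow> \<exists>u f. gen u f \<and> nrm (v - u) < e"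
  shows "\<exists>C\<ge>1. \<exists>\<omega>>0. \<forall>t\<ge>0. \<forall>u\<in>V. nrm (S t u) \<le> C * exp (- \<omega> * t) * nrm u"
proof -
  define \<tau> where "\<tau> = 24 * K"
  have \<tau>: "\<tau> > 0" using K by (simp add: \<tau>_def)
  have half: "nrm (S \<tau> v) \<le> nrm v / 2" if v: "v \<in> V" for v
  proof (rule field_le_epsilon)
    fix e :: real assume e: "e > 0"
    obtain u f where u: "gen u f" "nrm (v - u) < e / 2"
      using dense[OF v, of "e / 2"] e by auto
    have uV: "u \<in> V" using gen_in[OF u(1)] by simp
    have "nrm (S \<tau> v) \<le> nrm (S \<tau> u) + nrm (S \<tau> v - S \<tau> u)"
      using v uV \<tau> by (intro nrm_triangle_sub) auto
    also have "nrm (S \<tau> v - S \<tau> u) = nrm (S \<tau> (v - u))"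
      using v uV \<tau> by (intro eqv_nrm eqv_sym[OF S_diff]) auto
    also have "\<dots> \<le> nrm (v - u)" using v uV \<tau> by (intro contr) auto
    finally have 1: "nrm (S \<tau> v) \<le> nrm (S \<tau> u) + nrm (v - u)" by simp
    have 2: "nrm (S \<tau> u) \<le> nrm u / 2"
      using contraction_decay[OF contr cont K u(1) \<tau>] K by (simp add: \<tau>_def)
    have "nrm u \<le> nrm v + nrm (v - u)"
      using nrm_triangle_sub[OF uV v] nrm_minus_commute[OF uV v] by simp
    then show "nrm (S \<tau> v) \<le> nrm v / 2 + e" using 1 2 u(2) e by argo
  qed
  have iter: "nrm (S t v) \<le> (1 / 2) ^ n * nrm v" if "v \<in> V" "real n * \<tau> \<le> t" for n t v
    using that
  proof (induction n arbitrary: t)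
    case 0
    then show ?case using contr[of t v] by simp
  next
    case (Suc n)
    have t: "real n * \<tau> \<le> t - \<tau>" "0 \<le> t - \<tau>"
      using Suc.prems \<tau> by (auto simp: algebra_simps intro: order_trans[rotated])
    have "nrm (S t v) = nrm (S \<tau> (S (t - \<tau>) v))"
      using S_add[of \<tau> "t - \<tau>" v] t \<tau> Suc.prems by (intro eqv_nrm) auto
    also have "\<dots> \<le> nrm (S (t - \<tau>) v) / 2" using t Suc.prems by (intro half) auto
    also have "\<dots> \<le> (1 / 2) ^ n * nrm v / 2" using Suc.IH[OF _ t(1)] Suc.prems by simp
    finally show ?case by simp
  qed
  have "nrm (S t v) \<le> 2 * exp (- (ln 2 / \<tau>) * t) * nrm v" if v: "v \<in> V" and t: "0 \<le> t" for t v
  proof -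
    define n where "n = nat \<lfloor>t / \<tau>\<rfloor>"
    have pos: "0 \<le> t / \<tau>" using t \<tau> by simp
    have n: "real n \<le> t / \<tau>" "t / \<tau> < real n + 1" using pos unfolding n_def by linarith+
    have "nrm (S t v) \<le> (1 / 2) ^ n * nrm v"
      using iter[OF v, of n t] n(1) \<tau> by (simp add: field_simps)
    also have "(1 / 2 :: real) ^ n = exp (- (real n * ln 2))"
      by (simp add: exp_minus exp_of_nat_mult power_one_over inverse_eq_divide)
    also have "\<dots> \<le> exp (ln 2 - t / \<tau> * ln 2)"
    proof -
      have "(t / \<tau>) * ln 2 \<le> (real n + 1) * ln 2" using n(2) by (intro mult_right_mono) auto
      then show ?thesis by (simp add: algebra_simps)
    qed
    also have "\<dots> = 2 * exp (- (ln 2 / \<tau>) * t)" by (simp add: exp_diff exp_minus field_simps)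
    finally show ?thesis using v by (simp add: mult_right_mono)
  qed
  moreover have "ln 2 / \<tau> > 0" using \<tau> by simp
  ultimately show ?thesis by (meson one_le_numeral)
qed

end

section \<open>Smooth steps\<close>

text \<open>Recursion on the derivative, rather than differentiability of all iterated derivatives up to a
  given order, makes closure under sums and products an induction.\<close>
primrec times_differentiable :: "nat \<Rightarrow> (real \<Rightarrow> real) \<Rightarrow> bool" where
  "times_differentiable 0 f \<longleftrightarrow> True"
| "times_differentiable (Suc n) f \<longleftrightarrow> (\<forall>x. f differentiable (at x)) \<and> times_differentiable n (deriv f)"

lemma times_differentiable_Suc:
  assumes "\<And>x. (f has_real_derivative f' x) (at x)"
  shows "times_differentiable (Suc n) f \<longleftrightarrow> times_differentiable n f'"
proof -
  have "deriv f = f'" using assms by (auto intro: DERIV_imp_deriv)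
  moreover have "f differentiable (at x)" for x using assms real_differentiable_def by blast
  ultimately show ?thesis by simp
qed

lemma times_differentiable_SucE:
  assumes "times_differentiable (Suc n) f"
  obtains f' where "\<And>x. (f has_real_derivative f' x) (at x)" "times_differentiable n f'"
  using assms by (metis DERIV_deriv_iff_real_differentiable times_differentiable.simps(2))

lemma times_differentiable_lower: "times_differentiable (Suc n) f \<Longrightarrow> times_differentiable n f"
  by (induction n arbitrary: f) auto

lemma times_differentiable_const: "times_differentiable n (\<lambda>_. c)"
proof (induction n arbitrary: c)
  case (Suc n)
  show ?case by (subst times_differentiable_Suc[of _ "\<lambda>_. 0"]) (auto simp: Suc)
qed simp

lemma times_differentiable_add:
  "times_differentiable n f \<Longrightarrow> times_differentiable n g \<Longrightarrow> times_differentiable n (\<lambda>x. f x + g x)"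
proof (induction n arbitrary: f g)
  case (Suc n)
  obtain f' g' where "\<And>x. (f has_real_derivative f' x) (at x)" "times_differentiable n f'"
    "\<And>x. (g has_real_derivative g' x) (at x)" "times_differentiable n g'"
    using Suc.prems by (meson times_differentiable_SucE)
  then show ?case
    using Suc.IH[of f' g']
    by (subst times_differentiable_Suc[of _ "\<lambda>x. f' x + g' x"]) (auto intro!: derivative_eq_intros)
qed simp

lemma times_differentiable_mult:
  "times_differentiable n f \<Longrightarrow> times_differentiable n g \<Longrightarrow> times_differentiable n (\<lambda>x. f x * g x)"
proof (induction n arbitrary: f g)
  case (Suc n)
  obtain f' g' where d: "\<And>x. (f has_real_derivative f' x) (at x)" "times_differentiable n f'"
    "\<And>x. (g has_real_derivative g' x) (at x)" "times_differentiable n g'"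
    using Suc.prems by (meson times_differentiable_SucE)
  have "times_differentiable n (\<lambda>x. f' x * g x + f x * g' x)"
    using Suc d times_differentiable_lower by (intro times_differentiable_add Suc.IH) auto
  then show ?case
    by (subst times_differentiable_Suc[of _ "\<lambda>x. f' x * g x + f x * g' x"])
      (auto intro!: derivative_eq_intros d)
qed simp

lemma times_differentiable_affine:
  "times_differentiable n f \<Longrightarrow> times_differentiable n (\<lambda>x. f (c * x + d))"
proof (induction n arbitrary: f)
  case (Suc n)
  obtain f' where d: "\<And>x. (f has_real_derivative f' x) (at x)" "times_differentiable n f'"
    using Suc.prems by (meson times_differentiable_SucE)
  have "((\<lambda>x. f (c * x + d)) has_real_derivative c * f' (c * x + d)) (at x)" for x
    by (rule DERIV_cong[OF DERIV_chain2[OF d(1)]]) (auto intro!: derivative_eq_intros)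
  then show ?case
    using Suc.IH[OF d(2)] times_differentiable_mult[OF times_differentiable_const]
    by (subst times_differentiable_Suc[of _ "\<lambda>x. c * f' (c * x + d)"]) auto
qed simp

lemma test_functionI:
  assumes "\<And>n. times_differentiable n \<phi>" "a < c" "d < b" "\<And>x. x \<notin> {c..d} \<Longrightarrow> \<phi> x = 0"
  shows "test_function a b \<phi>"
proof -
  have "times_differentiable (Suc n) f \<Longrightarrow> (deriv ^^ n) f differentiable_on UNIV" for n f
  proof (induction n arbitrary: f)
    case 0
    then show ?case by (auto simp: differentiable_on_def)
  next
    case (Suc n)
    have "(deriv ^^ n) (deriv f) differentiable_on UNIV" using Suc.prems by (intro Suc.IH) simp
    then show ?case by (simp only: funpow_Suc_right o_def)
  qed
  then show ?thesis using assms unfolding test_function_def by blast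
qed

text \<open>The functions \<open>x\<^sup>-\<^sup>k exp(-1/x)\<close>, extended by zero. Their derivatives are linear combinations of
  members of the family, so all of them are smooth.\<close>
definition flat :: "nat \<Rightarrow> real \<Rightarrow> real" where
  "flat k x = (if x > 0 then (1 / x) ^ k * exp (- (1 / x)) else 0)"

lemma flat_derivative: "(flat k has_real_derivative (flat (k + 2) x - real k * flat (k + 1) x)) (at x)"
proof -
  consider "x > 0" | "x < 0" | "x = 0" by linarith
  then show ?thesis
  proof cases
    case 1
    have "((\<lambda>y. (1 / y) ^ k * exp (- (1 / y))) has_real_derivative
        (flat (k + 2) x - real k * flat (k + 1) x)) (at x)"
    proof -
      have "x * x ^ (k - Suc 0) = x ^ k" if "k > 0"
        using that by (metis Suc_pred power_Suc)
      then show ?thesis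
        using 1 by (cases "k = 0")
          (auto intro!: derivative_eq_intros simp: flat_def field_simps power2_eq_square)
    qed
    moreover have "\<forall>\<^sub>F y in nhds x. flat k y = (1 / y) ^ k * exp (- (1 / y))"
      by (rule eventually_mono[OF eventually_nhds_in_open[of "{0<..}"]]) (use 1 in \<open>auto simp: flat_def\<close>)
    ultimately show ?thesis by (subst DERIV_cong_ev[OF refl]) auto
  next
    case 2
    have "\<forall>\<^sub>F y in nhds x. flat k y = 0"
      by (rule eventually_mono[OF eventually_nhds_in_open[of "{..<0}"]]) (use 2 in \<open>auto simp: flat_def\<close>)
    then show ?thesis using 2 by (subst DERIV_cong_ev[OF refl]) (auto simp: flat_def)
  next
    case 3
    have "((\<lambda>h. (flat k (0 + h) - flat k 0) / h) \<longlongrightarrow> 0) (at 0)"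
    proof (rule filterlim_split_at)
      show "((\<lambda>h. (flat k (0 + h) - flat k 0) / h) \<longlongrightarrow> 0) (at_left 0)"
        by (intro tendsto_eventually eventually_mono[OF eventually_at_left_real[of "-1" 0]])
          (auto simp: flat_def)
      have "((\<lambda>h. (inverse h) ^ Suc k / exp (inverse h)) \<longlongrightarrow> (0::real)) (at_right 0)"
        by (rule filterlim_compose[OF tendsto_power_div_exp_0 filterlim_inverse_at_top_right])
      then show "((\<lambda>h. (flat k (0 + h) - flat k 0) / h) \<longlongrightarrow> 0) (at_right 0)"
        by (rule tendsto_cong[THEN iffD1, rotated], intro eventually_mono[OF eventually_at_right_less])
          (auto simp: flat_def field_simps exp_minus)
    qed
    then show ?thesis using 3 by (simp add: DERIV_def flat_def)
  qed
qed

lemma times_differentiable_flat: "times_differentiable n (flat k)"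
proof (induction n arbitrary: k)
  case (Suc n)
  have "times_differentiable n (\<lambda>x. flat (k + 2) x + (- real k) * flat (k + 1) x)"
    by (intro times_differentiable_add times_differentiable_mult times_differentiable_const Suc)
  then show ?case
    by (subst times_differentiable_Suc[OF flat_derivative]) simp
qed simp

lemma antiderivative_exists:
  fixes f :: "real \<Rightarrow> real"
  assumes "continuous_on UNIV f"
  obtains F where "\<And>x. (F has_real_derivative f x) (at x)" "F 0 = 0"
proof -
  have "\<exists>F. \<forall>x::real. -\<infinity> < ereal x \<longrightarrow> ereal x < \<infinity> \<longrightarrow> (F has_vector_derivative f x) (at x)"
    using assms by (intro einterval_antiderivative) (auto simp: continuous_on_eq_continuous_at)
  then obtain F where F: "\<And>x. (F has_real_derivative f x) (at x)"
    by (auto simp: has_real_derivative_iff_has_vector_derivative)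
  show thesis
    by (rule that[of "\<lambda>x. F x - F 0"]) (auto intro!: derivative_eq_intros F)
qed

text \<open>The step is the normalized antiderivative of the bump \<open>flat 0 x \<cdot> flat 0 (1 - x)\<close>.\<close>
lemma smooth_step_exists:
  obtains s :: "real \<Rightarrow> real" where "\<And>n. times_differentiable n s" "\<And>x. x \<le> 0 \<Longrightarrow> s x = 0"
    "\<And>x. 1 \<le> x \<Longrightarrow> s x = 1" "\<And>x. 0 \<le> s x" "\<And>x. s x \<le> 1"
proof -
  define \<beta> where "\<beta> x = flat 0 x * flat 0 (-1 * x + 1)" for x
  have \<beta>_smooth: "times_differentiable n \<beta>" for n
    unfolding \<beta>_def by (intro times_differentiable_mult times_differentiable_affine times_differentiable_flat)
  have \<beta>0: "\<beta> x \<ge> 0" for x by (simp add: \<beta>_def flat_def)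
  have \<beta>pos: "\<beta> x > 0" if "0 < x" "x < 1" for x using that by (simp add: \<beta>_def flat_def)
  have \<beta>zero: "\<beta> x = 0" if "x \<le> 0 \<or> 1 \<le> x" for x using that by (auto simp: \<beta>_def flat_def)
  have "\<beta> differentiable (at x)" for x using \<beta>_smooth[of "Suc 0"] by simp
  then have cont: "continuous_on UNIV \<beta>"
    by (intro differentiable_imp_continuous_on) (auto simp: differentiable_on_def)
  obtain F where F: "\<And>x. (F has_real_derivative \<beta> x) (at x)" "F 0 = 0"
    using antiderivative_exists[OF cont] by blast
  have F_cont: "continuous_on A F" for A
    by (meson F(1) DERIV_continuous_on has_field_derivative_at_within)
  have const: "F y = F x" if "x < y" "\<And>z. x < z \<Longrightarrow> z < y \<Longrightarrow> \<beta> z = 0" for x y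
  proof (rule DERIV_isconst_end[OF that(1) F_cont])
    fix z assume "x < z" "z < y"
    then show "DERIV F z :> 0" using F(1)[of z] that(2) by simp
  qed
  have mono: "F x \<le> F y" if "x \<le> y" for x y
  proof (rule DERIV_nonneg_imp_nondecreasing[OF that])
    fix z show "\<exists>y. DERIV F z :> y \<and> 0 \<le> y" by (intro exI[of _ "\<beta> z"] conjI F(1) \<beta>0)
  qed
  have "F 0 < F 1"
  proof (rule DERIV_pos_imp_increasing_open[of 0 1 F])
    fix z :: real assume "0 < z" "z < 1"
    then show "\<exists>y. DERIV F z :> y \<and> 0 < y" by (intro exI[of _ "\<beta> z"] conjI F(1) \<beta>pos)
  qed (simp_all add: F_cont)
  then have F1: "F 1 > 0" using F(2) by simp
  have left: "F x = 0" if "x \<le> 0" for x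
  proof (cases "x < 0")
    case True
    have "F 0 = F x" by (rule const[OF True]) (simp add: \<beta>zero)
    then show ?thesis using F(2) by simp
  qed (use that F(2) in auto)
  have right: "F x = F 1" if "1 \<le> x" for x
  proof (cases "1 < x")
    case True
    show ?thesis by (rule const[OF True]) (simp add: \<beta>zero)
  qed (use that in auto)
  have "times_differentiable n F" for n
    using times_differentiable_Suc[OF F(1)] \<beta>_smooth times_differentiable_lower by blast
  then have smooth: "times_differentiable n (\<lambda>x. (1 / F 1) * F x)" for n
    by (intro times_differentiable_mult times_differentiable_const)
  have range: "0 \<le> F x" "F x \<le> F 1" for x
    using mono[of 0 x] left[of x] F(2) mono[of x 1] right[of x] by (cases "x \<le> 0"; cases "x \<le> 1"; simp)+
  show thesis
  proof (rule that)
    show "times_differentiable n (\<lambda>x. (1 / F 1) * F x)" for n by (rule smooth)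
    show "0 \<le> (1 / F 1) * F x" "(1 / F 1) * F x \<le> 1" for x
      using F1 range[of x] by simp_all
    show "(1 / F 1) * F x = 0" if "x \<le> 0" for x using left[OF that] by simp
    show "(1 / F 1) * F x = 1" if "1 \<le> x" for x using right[OF that] F1 by simp
  qed
qed

lemma test_function_continuous:
  assumes "test_function a b \<phi>"
  shows "(\<phi> has_real_derivative deriv \<phi> x) (at x)" "continuous_on A \<phi>" "continuous_on A (deriv \<phi>)"
proof -
  have 0: "((deriv ^^ 0) \<phi>) differentiable_on UNIV" and 1: "((deriv ^^ 1) \<phi>) differentiable_on UNIV"
    using assms unfolding test_function_def by blast+
  show "(\<phi> has_real_derivative deriv \<phi> x) (at x)" using 0
    by (simp add: differentiable_on_def DERIV_deriv_iff_real_differentiable)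
  show "continuous_on A \<phi>" "continuous_on A (deriv \<phi>)"
    using 0 1 by (auto dest!: differentiable_imp_continuous_on intro: continuous_on_subset)
qed

section \<open>Weak derivatives that vanish\<close>

lemma AE_lebesgue_on_negligible:
  assumes "S \<in> sets lebesgue"
  shows "(AE x in lebesgue_on S. P x) \<longleftrightarrow> negligible {x \<in> S. \<not> P x}"
proof -
  have "(AE x in lebesgue_on S. P x) \<longleftrightarrow> (AE x in lebesgue. x \<in> S \<longrightarrow> P x)"
    using assms by (subst AE_restrict_space_iff) auto
  also have "\<dots> \<longleftrightarrow> {x \<in> S. \<not> P x} \<in> null_sets lebesgue"
    by (simp add: completion.AE_iff_null_sets)
  finally show ?thesis by (simp add: negligible_iff_null_sets)
qed

lemma Lebesgue_points:
  fixes f :: "real \<Rightarrow> 'e::euclidean_space"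
  assumes f: "f absolutely_integrable_on {a..b}"
  obtains N where "negligible N"
    "\<And>x. x \<in> {a<..<b} - N \<Longrightarrow> ((\<lambda>h. integral {x..x + h} f /\<^sub>R h) \<longlongrightarrow> f x) (at_right 0)"
proof -
  define g where "g x = (if x \<in> {a..b} then f x else 0)" for x
  have "g integrable_on UNIV"
    using f integrable_restrict_UNIV[of "{a..b}" f]
    by (simp only: g_def[abs_def] absolutely_integrable_on_def)
  then have int: "g integrable_on cbox c d" for c d by (rule integrable_on_subcbox) auto
  obtain N where N: "negligible N" "\<And>x e. \<lbrakk>x \<notin> N; 0 < e\<rbrakk> \<Longrightarrow>
      \<exists>d>0. \<forall>h. 0 < h \<and> h < d \<longrightarrow> norm (integral (cbox x (x + h *\<^sub>R One)) g /\<^sub>R h ^ DIM(real) - g x) < e"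
    using integrable_ccontinuous_explicit[OF int] by blast
  show thesis
  proof (rule that[OF N(1)])
    fix x assume x: "x \<in> {a<..<b} - N"
    show "((\<lambda>h. integral {x..x + h} f /\<^sub>R h) \<longlongrightarrow> f x) (at_right 0)"
    proof (rule tendstoI)
      fix e :: real assume "e > 0"
      then obtain d where d: "d > 0"
        "\<And>h. 0 < h \<Longrightarrow> h < d \<Longrightarrow> norm (integral {x..x + h} g /\<^sub>R h - g x) < e"
        using N(2)[of x e] x by (auto simp: Basis_real_def)
      have "dist (integral {x..x + h} f /\<^sub>R h) (f x) < e" if h: "0 < h" "h < min d (b - x)" for h
      proof -
        have "integral {x..x + h} g = integral {x..x + h} f"
          using x h by (intro integral_cong) (auto simp: g_def)
        then show ?thesis using d(2)[of h] h x by (simp add: dist_norm g_def)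
      qed
      moreover have "\<forall>\<^sub>F h in at_right 0. h \<in> {0<..<min d (b - x)}"
        using x d by (intro eventually_at_right_real) auto
      ultimately show "\<forall>\<^sub>F h in at_right 0. dist (integral {x..x + h} f /\<^sub>R h) (f x) < e"
        by (auto elim: eventually_mono)
    qed
  qed
qed

lemma test_product_integrable:
  fixes f :: "real \<Rightarrow> 'e::euclidean_space"
  assumes "f absolutely_integrable_on {a..b}" "continuous_on {a..b} p"
  shows "(\<lambda>x. p x *\<^sub>R f x) absolutely_integrable_on {a..b}"
proof (rule absolutely_integrable_bounded_measurable_product[where h = "(*\<^sub>R)" and f = p, OF _ _ _ _ assms(1)])
  show "bilinear ((*\<^sub>R) :: real \<Rightarrow> 'e \<Rightarrow> 'e)"
    using bounded_bilinear_scaleR bilinear_conv_bounded_bilinear by blast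
  show "p \<in> borel_measurable (lebesgue_on {a..b})"
    by (rule continuous_imp_measurable_on_sets_lebesgue[OF assms(2)]) auto
  show "bounded (p ` {a..b})"
    using assms(2) compact_imp_bounded compact_continuous_image by blast
qed auto

lemma lebesgue_on_open_interval:
  fixes f :: "real \<Rightarrow> 'e::euclidean_space"
  shows "integrable (lebesgue_on {a<..<b}) f \<longleftrightarrow> f absolutely_integrable_on {a..b}"
    and "f absolutely_integrable_on {a..b} \<Longrightarrow> (LINT x|lebesgue_on {a<..<b}. f x) = integral {a..b} f"
proof -
  show *: "integrable (lebesgue_on {a<..<b}) f \<longleftrightarrow> f absolutely_integrable_on {a..b}"
    using absolutely_integrable_on_open_interval[of a b f]
    by (simp add: set_integrable_def integrable_restrict_space)
  assume "f absolutely_integrable_on {a..b}"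
  then show "(LINT x|lebesgue_on {a<..<b}. f x) = integral {a..b} f"
    using * lebesgue_integral_eq_integral[where S = "{a<..<b}" and f = f] integral_open_interval_real[of a b f]
    by simp
qed

text \<open>The lemma of du Bois-Reymond. Let \<open>P\<close> be a smooth plateau on \<open>{0..h}\<close>. The difference of its
  translates by \<open>c\<close> and \<open>d\<close> is the derivative of a test function, namely of the difference of the
  translated antiderivatives, which are constant to the right of the plateau. As the plateaus tend to
  the indicator of the interval, the integrals of \<open>f\<close> over \<open>{c..c + h}\<close> and \<open>{d..d + h}\<close> turn out to be
  equal, and \<open>f\<close> takes the same value at any two Lebesgue points.\<close>

lemma weak_derivative_zero_imp_const:
  fixes f :: "real \<Rightarrow> 'e::euclidean_space"
  assumes ab: "a < b" and f: "f absolutely_integrable_on {a..b}"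
    and weak: "\<And>\<phi>. test_function a b \<phi> \<Longrightarrow> integral {a..b} (\<lambda>x. deriv \<phi> x *\<^sub>R f x) = 0"
  obtains c where "AE x in lebesgue_on {a<..<b}. f x = c"
proof -
  obtain s :: "real \<Rightarrow> real" where s: "\<And>n. times_differentiable n s" "\<And>x. x \<le> 0 \<Longrightarrow> s x = 0"
    "\<And>x. 1 \<le> x \<Longrightarrow> s x = 1" "\<And>x. 0 \<le> s x" "\<And>x. s x \<le> 1"
    using smooth_step_exists by blast
  have translate: "integral {c..c + h} f = integral {d..d + h} f"
    if c: "a < c" "c + h < b" and d: "a < d" "d + h < b" and h: "h > 0" for c d h
  proof -
    define P where "P n x = s (real n * x) * s (real n * (h - x))" for n :: nat and x
    have P_smooth: "times_differentiable m (P n)" for m n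
    proof -
      have "times_differentiable m (\<lambda>x. s (real n * x + 0) * s (- real n * x + real n * h))"
        by (intro times_differentiable_mult times_differentiable_affine s)
      then show ?thesis by (simp add: P_def[abs_def] algebra_simps)
    qed
    have P01: "0 \<le> P n x" "P n x \<le> 1" for n x
      using s(4,5) by (auto simp: P_def intro: mult_le_one)
    have P_out: "P n x = 0" if "x \<le> 0 \<or> h \<le> x" for n x
      using that s(2) by (auto simp: P_def mult_nonneg_nonpos)
    have P_cont: "continuous_on A (P n)" for A n
    proof -
      have "\<forall>x. P n differentiable (at x)" using P_smooth[of "Suc 0" n] by simp
      then show ?thesis
        by (intro differentiable_imp_continuous_on) (auto simp: differentiable_on_def intro: differentiable_at_withinI)
    qed
    have P_lim: "(\<lambda>n. P n x) \<longlonglongrightarrow> (if 0 < x \<and> x < h then 1 else 0)" for x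
    proof (cases "0 < x \<and> x < h")
      case True
      obtain m :: nat where m: "real m > max (1 / x) (1 / (h - x))" using reals_Archimedean2 by blast
      have "P n x = 1" if "n \<ge> m" for n
      proof -
        have n: "real n > 1 / x" "real n > 1 / (h - x)" using m that by (auto intro: less_le_trans)
        have "real n * x \<ge> 1" "real n * (h - x) \<ge> 1"
          using n True by (auto simp: field_simps)
        then show ?thesis using s(3) by (simp add: P_def)
      qed
      then have "\<forall>\<^sub>F n in sequentially. P n x = 1" by (rule eventually_sequentiallyI)
      then show ?thesis using True by (simp add: tendsto_eventually)
    next
      case False
      then have "P n x = 0" for n using P_out[of x n] by auto
      then show ?thesis using False by auto
    qed
    have shift_lim: "(\<lambda>n. integral {a..b} (\<lambda>x. P n (x - c) *\<^sub>R f x)) \<longlonglongrightarrow> integral {c..c + h} f"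
      if c: "a < c" "c + h < b" for c
    proof -
      have "(\<lambda>n. integral {a..b} (\<lambda>x. P n (x - c) *\<^sub>R f x)) \<longlonglongrightarrow>
          integral {a..b} (\<lambda>x. (if 0 < x - c \<and> x - c < h then 1 else 0) *\<^sub>R f x)"
      proof (rule dominated_convergence(2))
        show "(\<lambda>x. P n (x - c) *\<^sub>R f x) integrable_on {a..b}" for n
        proof -
          have "(\<lambda>x. P n (x - c) *\<^sub>R f x) absolutely_integrable_on {a..b}"
            by (intro test_product_integrable f continuous_on_compose2[OF P_cont[of UNIV n]] continuous_intros) auto
          then show ?thesis by (simp add: absolutely_integrable_on_def)
        qed
        show "(\<lambda>x. norm (f x)) integrable_on {a..b}" using f by (simp add: absolutely_integrable_on_def)
        show "norm (P n (x - c) *\<^sub>R f x) \<le> norm (f x)" if "x \<in> {a..b}" for n x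
          using P01[of n "x - c"] by (simp add: mult_left_le_one_le)
        show "(\<lambda>n. P n (x - c) *\<^sub>R f x) \<longlonglongrightarrow> (if 0 < x - c \<and> x - c < h then 1 else 0) *\<^sub>R f x"
          if "x \<in> {a..b}" for x by (intro tendsto_intros P_lim)
      qed
      also have "integral {a..b} (\<lambda>x. (if 0 < x - c \<and> x - c < h then 1 else 0) *\<^sub>R f x)
          = integral {a..b} (\<lambda>x. if x \<in> {c<..<c + h} then f x else 0)"
        by (intro integral_cong) auto
      also have "\<dots> = integral {c<..<c + h} f"
        using c h by (subst Henstock_Kurzweil_Integration.integral_restrict_Int) (auto intro: arg_cong2[where f = integral])
      also have "\<dots> = integral {c..c + h} f"
        using integral_open_interval_real[of c "c + h" f] by simp
      finally show ?thesis .
    qed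
    have eq: "integral {a..b} (\<lambda>x. P n (x - c) *\<^sub>R f x) = integral {a..b} (\<lambda>x. P n (x - d) *\<^sub>R f x)" for n
    proof -
      obtain G where G: "\<And>x. (G has_real_derivative P n x) (at x)" "G 0 = 0"
        using antiderivative_exists[OF P_cont] by blast
      have G_cont: "continuous_on A G" for A
        by (meson G(1) DERIV_continuous_on has_field_derivative_at_within)
      have G_const: "G y = G x" if "x < y" "y \<le> 0 \<or> h \<le> x" for x y
      proof (rule DERIV_isconst_end[OF that(1) G_cont])
        fix z assume "x < z" "z < y"
        then show "DERIV G z :> 0" using G(1)[of z] that(2) P_out[of z n] by auto
      qed
      have G_left: "G x = 0" if "x \<le> 0" for x using G_const[of x 0] that G(2) by (cases "x = 0") auto
      have G_right: "G x = G h" if "h \<le> x" for x using G_const[of h x] that by (cases "x = h") auto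
      define \<phi> where "\<phi> x = G (1 * x + (- c)) + (-1) * G (1 * x + (- d))" for x
      have G_smooth: "times_differentiable m G" for m
        using times_differentiable_Suc[OF G(1)] P_smooth times_differentiable_lower by blast
      have "test_function a b \<phi>"
      proof (rule test_functionI)
        show "times_differentiable m \<phi>" for m
          unfolding \<phi>_def
          by (intro times_differentiable_add times_differentiable_mult times_differentiable_const
              times_differentiable_affine G_smooth)
        show "a < min c d" "max c d + h < b" using c d by (simp_all add: min_def max_def)
        show "\<phi> x = 0" if "x \<notin> {min c d..max c d + h}" for x
        proof (cases "x < min c d")
          case True
          then show ?thesis using G_left[of "x - c"] G_left[of "x - d"] by (simp add: \<phi>_def)
        next
          case False
          then have "h \<le> x - c" "h \<le> x - d" using that by auto
          then show ?thesis using G_right[of "x - c"] G_right[of "x - d"] by (simp add: \<phi>_def)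
        qed
      qed
      moreover have "(\<phi> has_real_derivative P n (x - c) - P n (x - d)) (at x)" for x
      proof -
        have "((\<lambda>x. G (x + - e)) has_real_derivative P n (x - e)) (at x)" for e
          by (rule DERIV_cong[OF DERIV_chain2[OF G(1)]]) (auto intro!: derivative_eq_intros)
        from DERIV_diff[OF this[of c] this[of d]] show ?thesis by (simp add: \<phi>_def[abs_def])
      qed
      then have "deriv \<phi> = (\<lambda>x. P n (x - c) - P n (x - d))" by (auto intro: DERIV_imp_deriv)
      ultimately have "integral {a..b} (\<lambda>x. (P n (x - c) - P n (x - d)) *\<^sub>R f x) = 0"
        using weak[of \<phi>] by simp
      moreover have "(\<lambda>x. P n (x - e) *\<^sub>R f x) integrable_on {a..b}" for e
      proof -
        have "(\<lambda>x. P n (x - e) *\<^sub>R f x) absolutely_integrable_on {a..b}"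
          by (intro test_product_integrable f continuous_on_compose2[OF P_cont[of UNIV n]] continuous_intros) auto
        then show ?thesis by (simp add: absolutely_integrable_on_def)
      qed
      ultimately show ?thesis by (simp add: scaleR_diff_left integral_diff)
    qed
    show ?thesis
      using LIMSEQ_unique[OF shift_lim[OF c]] shift_lim[OF d] eq by simp
  qed
  obtain N where N: "negligible N"
    "\<And>x. x \<in> {a<..<b} - N \<Longrightarrow> ((\<lambda>h. integral {x..x + h} f /\<^sub>R h) \<longlongrightarrow> f x) (at_right 0)"
    using Lebesgue_points[OF f] by blast
  have "\<not> {a<..<b} \<subseteq> N"
    using N(1) ab negligible_subset[of N "{a<..<b}"] negligible_interval(2)[of a b] by auto
  then obtain y where y: "y \<in> {a<..<b} - N" by blast
  have "f x = f y" if x: "x \<in> {a<..<b} - N" for x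
  proof -
    have "\<forall>\<^sub>F h in at_right 0. h \<in> {0<..<min (b - x) (b - y)}"
      using x y by (intro eventually_at_right_real) auto
    then have "\<forall>\<^sub>F h in at_right 0. integral {x..x + h} f /\<^sub>R h = integral {y..y + h} f /\<^sub>R h"
      by (rule eventually_mono) (use translate[of x _ y] x y in auto)
    then have "((\<lambda>h. integral {y..y + h} f /\<^sub>R h) \<longlongrightarrow> f x) (at_right 0)"
      using N(2)[OF x] tendsto_cong by fast
    from tendsto_unique[OF _ this N(2)[OF y]] show ?thesis by simp
  qed
  then have "AE x in lebesgue_on {a<..<b}. f x = f y"
    by (subst AE_lebesgue_on_negligible) (auto intro: negligible_subset[OF N(1)])
  then show thesis by (rule that)
qed

section \<open>Functions with an integrable derivative\<close>

text \<open>Fubini's theorem for \<open>g s\<close> times \<open>h t\<close> on the square \<open>{a..c} \<times> {a..c}\<close>, which is split along the diagonal.\<close>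
lemma fubini_product:
  fixes g :: "real \<Rightarrow> 'p::euclidean_space" and h :: "real \<Rightarrow> 'q::euclidean_space"
    and bil :: "'p \<Rightarrow> 'q \<Rightarrow> 'r::euclidean_space"
  assumes "bounded_bilinear bil"
    and g: "g absolutely_integrable_on {a..c}" and h: "h absolutely_integrable_on {a..c}"
  shows "(\<lambda>s. bil (g s) (integral {a..s} h)) absolutely_integrable_on {a..c}" (is ?A)
    and "(\<lambda>s. bil (integral {a..s} g) (h s)) absolutely_integrable_on {a..c}" (is ?B)
    and "bil (integral {a..c} g) (integral {a..c} h)
      = integral {a..c} (\<lambda>s. bil (g s) (integral {a..s} h)) + integral {a..c} (\<lambda>s. bil (integral {a..s} g) (h s))" (is ?C)
proof -
  interpret bounded_bilinear bil by fact
  let ?M = "lebesgue_on {a..c}"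
  interpret M: finite_measure ?M by (rule finite_measure_lebesgue_on) simp
  interpret MM: pair_sigma_finite ?M ?M ..
  have absint: "u absolutely_integrable_on {a..c} \<longleftrightarrow> integrable ?M u" for u :: "real \<Rightarrow> 'e::euclidean_space"
    by (simp add: set_integrable_def integrable_restrict_space)
  have gM [measurable]: "integrable ?M g" and hM [measurable]: "integrable ?M h"
    using g h absint by auto
  have [measurable]: "(\<lambda>x. x) \<in> borel_measurable ?M"
    by (intro measurable_restrict_space1 measurable_completion) simp
  have [measurable]: "(\<lambda>p. bil (g (fst p)) (h (snd p))) \<in> borel_measurable (?M \<Otimes>\<^sub>M ?M)"
    by (rule borel_measurable_continuous_Pair) (auto intro!: continuous_intros continuous_on)
  have int: "integrable (?M \<Otimes>\<^sub>M ?M) (\<lambda>p. bil (g (fst p)) (h (snd p)))"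
  proof -
    obtain K where K: "\<And>x y. norm (bil x y) \<le> norm x * norm y * K" using bounded by blast
    have "integrable (?M \<Otimes>\<^sub>M ?M) (\<lambda>p. norm (g (fst p)) * norm (h (snd p)) * K)"
    proof (rule integrable_mult_left, rule MM.Fubini_integrable)
      show "(\<lambda>p. norm (g (fst p)) * norm (h (snd p))) \<in> borel_measurable (?M \<Otimes>\<^sub>M ?M)" by measurable
      show "integrable ?M (\<lambda>x. \<integral>y. norm (norm (g (fst (x, y))) * norm (h (snd (x, y)))) \<partial>?M)"
        using gM hM by simp
      show "AE x in ?M. integrable ?M (\<lambda>y. norm (g (fst (x, y))) * norm (h (snd (x, y))))"
        using hM by simp
    qed
    then show ?thesis
      by (rule Bochner_Integration.integrable_bound) (auto intro!: AE_I2 order_trans[OF K])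
  qed
  have partial: "(\<integral>t. indicator {..s} t *\<^sub>R u t \<partial>?M) = integral {a..s} u"
    "(\<integral>t. indicator {..<s} t *\<^sub>R u t \<partial>?M) = integral {a..s} u"
    "integrable ?M (\<lambda>t. indicator {..s} t *\<^sub>R u t)" "integrable ?M (\<lambda>t. indicator {..<s} t *\<^sub>R u t)"
    if s: "s \<in> {a..c}" and u: "integrable ?M u" for s and u :: "real \<Rightarrow> 'e::euclidean_space"
  proof -
    have sets: "{..s} \<inter> {a..c} \<in> sets ?M" "{..<s} \<inter> {a..c} \<in> sets ?M"
      unfolding sets_restrict_space
      by (rule image_eqI[of _ _ "{..s}"]; force) (rule image_eqI[of _ _ "{..<s}"]; force)
    have i: "indicator {..s} t *\<^sub>R u t = indicator ({..s} \<inter> {a..c}) t *\<^sub>R u t"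
      "indicator {..<s} t *\<^sub>R u t = indicator ({..<s} \<inter> {a..c}) t *\<^sub>R u t" if "t \<in> space ?M" for t
      using that by (auto simp: indicator_def)
    show 1: "integrable ?M (\<lambda>t. indicator {..s} t *\<^sub>R u t)"
      using integrable_mult_indicator[OF sets(1) u] by (subst Bochner_Integration.integrable_cong[OF refl i(1)])
    show 2: "integrable ?M (\<lambda>t. indicator {..<s} t *\<^sub>R u t)"
      using integrable_mult_indicator[OF sets(2) u] by (subst Bochner_Integration.integrable_cong[OF refl i(2)])
    have "(\<integral>t. indicator {..s} t *\<^sub>R u t \<partial>?M) = integral {a..c} (\<lambda>t. indicator {..s} t *\<^sub>R u t)"
      using 1 by (intro lebesgue_integral_eq_integral) auto
    also have "\<dots> = integral {a..c} (\<lambda>t. if t \<in> {a..s} then u t else 0)"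
      by (intro integral_cong) (auto simp: indicator_def)
    also have "\<dots> = integral {a..s} u"
      using s by (subst Henstock_Kurzweil_Integration.integral_restrict_Int) (auto intro: arg_cong2[where f = integral])
    finally show 3: "(\<integral>t. indicator {..s} t *\<^sub>R u t \<partial>?M) = integral {a..s} u" .
    have "AE t in ?M. t \<noteq> s"
      by (subst AE_lebesgue_on_negligible) (auto intro: negligible_subset[of "{s}"])
    then have "(\<integral>t. indicator {..<s} t *\<^sub>R u t \<partial>?M) = (\<integral>t. indicator {..s} t *\<^sub>R u t \<partial>?M)"
      using 1 2 by (intro integral_cong_AE) (auto elim!: eventually_mono simp: indicator_def)
    then show "(\<integral>t. indicator {..<s} t *\<^sub>R u t \<partial>?M) = integral {a..s} u" using 3 by simp
  qed
  let ?L = "{p \<in> space (?M \<Otimes>\<^sub>M ?M). snd p \<le> fst p}" and ?U = "{p \<in> space (?M \<Otimes>\<^sub>M ?M). fst p < snd p}"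
  have [measurable]: "?L \<in> sets (?M \<Otimes>\<^sub>M ?M)" "?U \<in> sets (?M \<Otimes>\<^sub>M ?M)" by measurable
  let ?f = "\<lambda>p. bil (g (fst p)) (h (snd p))"
  have intL: "integrable (?M \<Otimes>\<^sub>M ?M) (\<lambda>(s, t). indicator ?L (s, t) *\<^sub>R ?f (s, t))"
    and intU: "integrable (?M \<Otimes>\<^sub>M ?M) (\<lambda>(s, t). indicator ?U (s, t) *\<^sub>R ?f (s, t))"
    using integrable_mult_indicator[OF _ int, of ?L] integrable_mult_indicator[OF _ int, of ?U]
    by (simp_all add: case_prod_unfold)
  have inner_L: "(\<integral>t. indicator ?L (s, t) *\<^sub>R ?f (s, t) \<partial>?M) = bil (g s) (integral {a..s} h)"
    if s: "s \<in> space ?M" for s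
  proof -
    have "(\<integral>t. indicator ?L (s, t) *\<^sub>R ?f (s, t) \<partial>?M) = (\<integral>t. bil (g s) (indicator {..s} t *\<^sub>R h t) \<partial>?M)"
      using s by (intro Bochner_Integration.integral_cong refl)
        (auto simp: indicator_def space_pair_measure zero_right scaleR_right)
    also have "\<dots> = bil (g s) (\<integral>t. indicator {..s} t *\<^sub>R h t \<partial>?M)"
      using s by (intro integral_bounded_linear bounded_linear_right partial hM) auto
    finally show ?thesis using s partial(1)[OF _ hM] by simp
  qed
  have inner_U: "(\<integral>s. indicator ?U (s, t) *\<^sub>R ?f (s, t) \<partial>?M) = bil (integral {a..t} g) (h t)"
    if t: "t \<in> space ?M" for t
  proof -
    have "(\<integral>s. indicator ?U (s, t) *\<^sub>R ?f (s, t) \<partial>?M) = (\<integral>s. bil (indicator {..<t} s *\<^sub>R g s) (h t) \<partial>?M)"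
      using t by (intro Bochner_Integration.integral_cong refl)
        (auto simp: indicator_def space_pair_measure zero_left scaleR_left)
    also have "\<dots> = bil (\<integral>s. indicator {..<t} s *\<^sub>R g s \<partial>?M) (h t)"
      using t by (intro integral_bounded_linear bounded_linear_left partial gM) auto
    finally show ?thesis using t partial(2)[OF _ gM] by simp
  qed
  have iA: "integrable ?M (\<lambda>s. bil (g s) (integral {a..s} h))"
    by (rule Bochner_Integration.integrable_cong[OF refl inner_L, THEN iffD1, OF _ MM.integrable_fst[OF intL]])
  have iB: "integrable ?M (\<lambda>t. bil (integral {a..t} g) (h t))"
    by (rule Bochner_Integration.integrable_cong[OF refl inner_U, THEN iffD1, OF _ MM.integrable_snd[OF intU]])
  show ?A ?B using iA iB absint by auto
  have "bil (integral {a..c} g) (integral {a..c} h) = (\<integral>s. bil (g s) (integral {a..c} h) \<partial>?M)"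
    using gM by (simp add: lebesgue_integral_eq_integral[OF gM, symmetric]
        integral_bounded_linear[OF bounded_linear_left])
  also have "\<dots> = (\<integral>s. (\<integral>t. ?f (s, t) \<partial>?M) \<partial>?M)"
    by (simp add: lebesgue_integral_eq_integral[OF hM, symmetric]
        integral_bounded_linear[OF bounded_linear_right hM])
  also have "\<dots> = integral\<^sup>L (?M \<Otimes>\<^sub>M ?M) ?f"
    using MM.integral_fst'[OF int] by simp
  also have "\<dots> = integral\<^sup>L (?M \<Otimes>\<^sub>M ?M) (\<lambda>(s, t). indicator ?L (s, t) *\<^sub>R ?f (s, t) + indicator ?U (s, t) *\<^sub>R ?f (s, t))"
    by (intro Bochner_Integration.integral_cong) (auto simp: indicator_def)
  also have "\<dots> = integral\<^sup>L (?M \<Otimes>\<^sub>M ?M) (\<lambda>(s, t). indicator ?L (s, t) *\<^sub>R ?f (s, t))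
      + integral\<^sup>L (?M \<Otimes>\<^sub>M ?M) (\<lambda>(s, t). indicator ?U (s, t) *\<^sub>R ?f (s, t))"
    using Bochner_Integration.integral_add[OF intL intU] by (simp add: case_prod_unfold)
  also have "integral\<^sup>L (?M \<Otimes>\<^sub>M ?M) (\<lambda>(s, t). indicator ?L (s, t) *\<^sub>R ?f (s, t))
      = (\<integral>s. bil (g s) (integral {a..s} h) \<partial>?M)"
    by (rule trans[OF MM.integral_fst[OF intL, symmetric] Bochner_Integration.integral_cong[OF refl inner_L]])
  also have "integral\<^sup>L (?M \<Otimes>\<^sub>M ?M) (\<lambda>(s, t). indicator ?U (s, t) *\<^sub>R ?f (s, t))
      = (\<integral>t. bil (integral {a..t} g) (h t) \<partial>?M)"
    by (rule trans[OF MM.integral_snd[OF intU, symmetric] Bochner_Integration.integral_cong[OF refl inner_U]])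
  finally show ?C
    using iA iB by (simp add: lebesgue_integral_eq_integral)
qed

text \<open>\<open>f\<close> is absolutely continuous with derivative \<open>g\<close>, stated in the integrated form so that values at
  every point of the closed interval are available.\<close>
definition primitive :: "real \<Rightarrow> real \<Rightarrow> (real \<Rightarrow> 'e::euclidean_space) \<Rightarrow> (real \<Rightarrow> 'e) \<Rightarrow> bool" where
  "primitive a b f g \<longleftrightarrow> g absolutely_integrable_on {a..b} \<and> (\<forall>x\<in>{a..b}. f x = f a + integral {a..x} g)"

lemma primitiveI:
  "g absolutely_integrable_on {a..b} \<Longrightarrow> (\<And>x. x \<in> {a..b} \<Longrightarrow> f x = f a + integral {a..x} g) \<Longrightarrow>
    primitive a b f g"
  unfolding primitive_def by blast

lemma primitiveD: "primitive a b f g \<Longrightarrow> x \<in> {a..b} \<Longrightarrow> f x = f a + integral {a..x} g"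
  unfolding primitive_def by blast

lemma primitive_absolutely_integrable: "primitive a b f g \<Longrightarrow> g absolutely_integrable_on {a..b}"
  by (simp add: primitive_def)

lemma primitive_integrable: "primitive a b f g \<Longrightarrow> x \<in> {a..b} \<Longrightarrow> g integrable_on {a..x}"
  unfolding primitive_def absolutely_integrable_on_def by (auto intro: integrable_subinterval_real)

lemma primitive_continuous: "primitive a b f g \<Longrightarrow> continuous_on {a..b} f"
proof -
  assume *: "primitive a b f g"
  then have "g integrable_on {a..b}" by (simp add: primitive_def absolutely_integrable_on_def)
  then have "continuous_on {a..b} (\<lambda>x. f a + integral {a..x} g)"
    by (intro continuous_intros indefinite_integral_continuous_1)
  then show ?thesis by (rule continuous_on_eq) (rule primitiveD[OF *, symmetric])
qed

lemma primitive_linear: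
  assumes "bounded_linear T" "primitive a b f g"
  shows "primitive a b (\<lambda>x. T (f x)) (\<lambda>x. T (g x))"
proof -
  interpret bounded_linear T by fact
  have "(\<lambda>x. T (g x)) absolutely_integrable_on {a..b}"
    using absolutely_integrable_linear[OF primitive_absolutely_integrable[OF assms(2)] assms(1)] by (simp add: o_def)
  moreover have "T (f x) = T (f a) + integral {a..x} (\<lambda>x. T (g x))" if "x \<in> {a..b}" for x
  proof -
    have "f x = f a + integral {a..x} g" using assms(2) that unfolding primitive_def by blast
    then have "T (f x) = T (f a) + T (integral {a..x} g)" by (simp only: add)
    then show ?thesis
      using integral_linear[OF primitive_integrable[OF assms(2) that] assms(1)] by (simp add: o_def)
  qed
  ultimately show ?thesis by (rule primitiveI)
qed

lemma primitive_add:
  assumes "primitive a b f g" "primitive a b f' g'"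
  shows "primitive a b (\<lambda>x. f x + f' x) (\<lambda>x. g x + g' x)"
proof -
  have "f x + f' x = f a + f' a + integral {a..x} (\<lambda>x. g x + g' x)" if x: "x \<in> {a..b}" for x
    unfolding primitiveD[OF assms(1) x] primitiveD[OF assms(2) x]
    using integral_add[OF primitive_integrable[OF assms(1) x] primitive_integrable[OF assms(2) x]]
    by simp
  moreover have "(\<lambda>x. g x + g' x) absolutely_integrable_on {a..b}"
    using assms by (intro set_integral_add primitive_absolutely_integrable)
  ultimately show ?thesis by (rule primitiveI[rotated])
qed

lemma primitive_diff:
  assumes "primitive a b f g" "primitive a b f' g'"
  shows "primitive a b (\<lambda>x. f x - f' x) (\<lambda>x. g x - g' x)"
  using primitive_add[OF assms(1) primitive_linear[OF bounded_linear_minus[OF bounded_linear_ident] assms(2)]]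
  by simp

lemma primitive_integral:
  assumes "g absolutely_integrable_on {a..b}"
  shows "primitive a b (\<lambda>x. integral {a..x} g) g"
  using assms by (simp add: primitive_def)

lemma primitive_const: "primitive a b (\<lambda>_. c) (\<lambda>_. 0)"
  by (simp add: primitive_def)

lemma primitive_C1:
  assumes "\<And>x. x \<in> {a..b} \<Longrightarrow> (f has_vector_derivative f' x) (at x within {a..b})" "continuous_on {a..b} f'"
  shows "primitive a b f f'"
proof -
  have "f x = f a + integral {a..x} f'" if x: "x \<in> {a..b}" for x
  proof -
    have "(f' has_integral f x - f a) {a..x}"
    proof (rule fundamental_theorem_of_calculus)
      show "(f has_vector_derivative f' y) (at y within {a..x})" if "y \<in> {a..x}" for y
        by (rule has_vector_derivative_within_subset[OF assms(1)]) (use that x in auto)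
    qed (use x in auto)
    then show ?thesis by (simp add: integral_unique)
  qed
  with absolutely_integrable_continuous_real[OF assms(2)] show ?thesis by (rule primitiveI)
qed

lemma primitive_cong:
  assumes "primitive a b f g" "\<And>x. x \<in> {a..b} \<Longrightarrow> f' x = f x" "\<And>x. x \<in> {a<..<b} \<Longrightarrow> g' x = g x"
  shows "primitive a b f' g'"
proof (rule primitiveI)
  have neg: "negligible {a, b}" by simp
  show "g' absolutely_integrable_on {a..b}"
    using assms(3) by (intro absolutely_integrable_spike[OF primitive_absolutely_integrable[OF assms(1)] neg]) auto
  fix x assume x: "x \<in> {a..b}"
  have "integral {a..x} g' = integral {a..x} g"
    using x assms(3) by (intro integral_spike[OF neg]) auto
  then show "f' x = f' a + integral {a..x} g'"
    using primitiveD[OF assms(1) x] assms(2)[OF x] assms(2)[of a] x by simp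
qed

lemma primitive_product:
  fixes bil :: "'p::euclidean_space \<Rightarrow> 'q::euclidean_space \<Rightarrow> 'r::euclidean_space"
  assumes "bounded_bilinear bil" and f: "primitive a b f f'" and g: "primitive a b g g'"
  shows "primitive a b (\<lambda>x. bil (f x) (g x)) (\<lambda>x. bil (f' x) (g x) + bil (f x) (g' x))"
proof -
  interpret bounded_bilinear bil by fact
  let ?F = "\<lambda>x. integral {a..x} f'" and ?G = "\<lambda>x. integral {a..x} g'"
  have abs: "f' absolutely_integrable_on {a..x}" "g' absolutely_integrable_on {a..x}" if "x \<in> {a..b}" for x
    using that f g by (auto intro!: absolutely_integrable_on_subinterval dest!: primitive_absolutely_integrable)
  note fub = fubini_product[OF assms(1) abs]
  have core: "primitive a b (\<lambda>x. bil (?F x) (?G x)) (\<lambda>x. bil (f' x) (?G x) + bil (?F x) (g' x))"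
  proof (cases "a \<le> b")
    case True
    then have b: "b \<in> {a..b}" by simp
    have "bil (?F x) (?G x) = integral {a..x} (\<lambda>x. bil (f' x) (?G x) + bil (?F x) (g' x))"
      if x: "x \<in> {a..b}" for x
    proof -
      have "(\<lambda>s. bil (f' s) (?G s)) integrable_on {a..x}" "(\<lambda>s. bil (?F s) (g' s)) integrable_on {a..x}"
        using fub(1,2)[OF x x] by (auto simp: absolutely_integrable_on_def)
      then show ?thesis using fub(3)[OF x x] by (simp add: integral_add)
    qed
    then show ?thesis
      using set_integral_add(1)[OF fub(1)[OF b b] fub(2)[OF b b]] True by (simp add: primitive_def zero_left)
  qed (simp add: primitive_def)
  have 1: "primitive a b (\<lambda>x. bil (?F x) (g a)) (\<lambda>x. bil (f' x) (g a))"
    by (intro primitive_linear[OF bounded_linear_left] primitive_integral primitive_absolutely_integrable[OF f])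
  have 2: "primitive a b (\<lambda>x. bil (f a) (?G x)) (\<lambda>x. bil (f a) (g' x))"
    by (intro primitive_linear[OF bounded_linear_right] primitive_integral primitive_absolutely_integrable[OF g])
  show ?thesis
  proof (rule primitive_cong)
    show "primitive a b (\<lambda>x. bil (f a) (g a) + (bil (?F x) (?G x) + (bil (?F x) (g a) + bil (f a) (?G x))))
       (\<lambda>x. 0 + (bil (f' x) (?G x) + bil (?F x) (g' x) + (bil (f' x) (g a) + bil (f a) (g' x))))"
      by (intro primitive_add primitive_const core 1 2)
    have eq: "f x = f a + ?F x" "g x = g a + ?G x" if "x \<in> {a..b}" for x
      using f g that unfolding primitive_def by blast+
    show "bil (f x) (g x) = bil (f a) (g a) + (bil (?F x) (?G x) + (bil (?F x) (g a) + bil (f a) (?G x)))"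
      if "x \<in> {a..b}" for x unfolding eq[OF that] by (simp add: add_left add_right)
    show "bil (f' x) (g x) + bil (f x) (g' x)
       = 0 + (bil (f' x) (?G x) + bil (?F x) (g' x) + (bil (f' x) (g a) + bil (f a) (g' x)))"
      if "x \<in> {a<..<b}" for x using eq[of x] that by (simp add: add_left add_right)
  qed
qed

text \<open>The integral of the difference over every subinterval is zero, so by Lebesgue's differentiation
  theorem it vanishes almost everywhere.\<close>
lemma primitive_derivative_unique:
  assumes "primitive a b f g" "primitive a b f g'"
  shows "AE x in lebesgue_on {a<..<b}. g x = g' x"
proof -
  let ?h = "\<lambda>x. g x - g' x"
  have h: "primitive a b (\<lambda>_. 0) ?h" using primitive_diff[OF assms] by simp
  obtain N where N: "negligible N"
    "\<And>x. x \<in> {a<..<b} - N \<Longrightarrow> ((\<lambda>t. integral {x..x + t} ?h /\<^sub>R t) \<longlongrightarrow> ?h x) (at_right 0)"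
    using Lebesgue_points[OF primitive_absolutely_integrable[OF h]] by blast
  have "?h x = 0" if x: "x \<in> {a<..<b} - N" for x
  proof -
    have "\<forall>\<^sub>F t in at_right 0. integral {x..x + t} ?h /\<^sub>R t = 0"
    proof (rule eventually_mono)
      show "\<forall>\<^sub>F t in at_right 0. t \<in> {0<..<b - x}" using x by (intro eventually_at_right_real) auto
      fix t assume t: "t \<in> {0<..<b - x}"
      have "integral {a..x} ?h + integral {x..x + t} ?h = integral {a..x + t} ?h"
        using x t by (intro Henstock_Kurzweil_Integration.integral_combine primitive_integrable[OF h]) auto
      moreover have "integral {a..x} ?h = 0" "integral {a..x + t} ?h = 0"
        using primitiveD[OF h, of x] primitiveD[OF h, of "x + t"] x t by auto
      ultimately show "integral {x..x + t} ?h /\<^sub>R t = 0" by simp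
    qed
    then have "((\<lambda>t. integral {x..x + t} ?h /\<^sub>R t) \<longlongrightarrow> 0) (at_right 0)" by (rule tendsto_eventually)
    from tendsto_unique[OF _ N(2)[OF x] this] show ?thesis by simp
  qed
  then show ?thesis
    by (subst AE_lebesgue_on_negligible) (auto intro!: negligible_subset[OF N(1)])
qed

text \<open>Integration by parts. The functions \<open>f'\<close> and \<open>g'\<close> only need to agree with \<open>f\<close> and \<open>g\<close> inside the
  interval: for \<open>u = H\<inverse> f\<close> the function \<open>H u\<close> agrees with \<open>f\<close> where \<open>H\<close> is known to be invertible.\<close>
lemma primitive_imp_weak_deriv:
  assumes f: "primitive a b f g" and ab: "a < b"
    and f': "\<And>x. x \<in> {a<..<b} \<Longrightarrow> f' x = f x" and g': "\<And>x. x \<in> {a<..<b} \<Longrightarrow> g' x = g x"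
  shows "has_weak_deriv a b f' g'"
proof -
  have f_abs: "f absolutely_integrable_on {a..b}"
    using primitive_continuous[OF f] by (rule absolutely_integrable_continuous_real)
  note g_abs = primitive_absolutely_integrable[OF f]
  have loc: "locally_integrable a b u'" if "u absolutely_integrable_on {a..b}" "\<And>x. x \<in> {a<..<b} \<Longrightarrow> u' x = u x"
    for u u' :: "real \<Rightarrow> 'a"
    unfolding locally_integrable_def
  proof (intro allI impI)
    fix c d assume cd: "a < c" "d < b"
    have "u absolutely_integrable_on {c..d}"
      using cd by (intro absolutely_integrable_on_subinterval[OF that(1)]) auto
    then show "u' absolutely_integrable_on {c..d}"
      by (rule absolutely_integrable_spike[OF _ negligible_empty]) (use cd that(2) in auto)
  qed
  have "(LINT x|lebesgue_on {a<..<b}. deriv \<phi> x *\<^sub>R f' x) = - (LINT x|lebesgue_on {a<..<b}. \<phi> x *\<^sub>R g' x)"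
    if \<phi>: "test_function a b \<phi>" for \<phi>
  proof -
    have p\<phi>: "primitive a b \<phi> (deriv \<phi>)"
      using test_function_continuous[OF \<phi>]
      by (intro primitive_C1) (auto simp: has_real_derivative_iff_has_vector_derivative[symmetric]
          intro: has_field_derivative_at_within)
    have ends: "\<phi> a = 0" "\<phi> b = 0"
      using \<phi> unfolding test_function_def by (metis atLeastAtMost_iff linorder_not_less)+
    have "primitive a b (\<lambda>x. \<phi> x *\<^sub>R f x) (\<lambda>x. deriv \<phi> x *\<^sub>R f x + \<phi> x *\<^sub>R g x)"
      by (rule primitive_product[OF bounded_bilinear_scaleR p\<phi> f])
    from primitiveD[OF this, of b]
    have 0: "integral {a..b} (\<lambda>x. deriv \<phi> x *\<^sub>R f x + \<phi> x *\<^sub>R g x) = 0"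
      using ends ab by simp
    have 1: "(\<lambda>x. deriv \<phi> x *\<^sub>R f x) absolutely_integrable_on {a..b}"
      and 2: "(\<lambda>x. \<phi> x *\<^sub>R g x) absolutely_integrable_on {a..b}"
      using test_function_continuous[OF \<phi>] by (auto intro: test_product_integrable f_abs g_abs)
    have "(LINT x|lebesgue_on {a<..<b}. deriv \<phi> x *\<^sub>R f' x) = integral {a..b} (\<lambda>x. deriv \<phi> x *\<^sub>R f x)"
      unfolding lebesgue_on_open_interval(2)[OF 1, symmetric]
      by (intro Bochner_Integration.integral_cong refl) (simp add: f')
    moreover have "(LINT x|lebesgue_on {a<..<b}. \<phi> x *\<^sub>R g' x) = integral {a..b} (\<lambda>x. \<phi> x *\<^sub>R g x)"
      unfolding lebesgue_on_open_interval(2)[OF 2, symmetric]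
      by (intro Bochner_Integration.integral_cong refl) (simp add: g')
    ultimately show ?thesis
      using 0 1 2 by (simp add: integral_add absolutely_integrable_on_def eq_neg_iff_add_eq_0)
  qed
  then show ?thesis using loc[OF f_abs f'] loc[OF g_abs g'] by (simp add: has_weak_deriv_def)
qed

text \<open>The difference of \<open>f\<close> and a primitive of \<open>g\<close> has weak derivative zero.\<close>
lemma weak_deriv_imp_primitive:
  fixes f :: "real \<Rightarrow> 'e::euclidean_space"
  assumes ab: "a < b" and weak: "has_weak_deriv a b f g"
    and f: "f absolutely_integrable_on {a..b}" and g: "g absolutely_integrable_on {a..b}"
  obtains v where "primitive a b v g" "AE x in lebesgue_on {a<..<b}. f x = v x"
proof -
  let ?G = "\<lambda>x. integral {a..x} g"
  have G: "primitive a b ?G g" using primitive_integral[OF g] .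
  have G_abs: "?G absolutely_integrable_on {a..b}"
    using primitive_continuous[OF G] by (rule absolutely_integrable_continuous_real)
  have weakG: "has_weak_deriv a b ?G g" by (rule primitive_imp_weak_deriv[OF G ab]) auto
  have "integral {a..b} (\<lambda>x. deriv \<phi> x *\<^sub>R (f x - ?G x)) = 0" if \<phi>: "test_function a b \<phi>" for \<phi>
  proof -
    have 1: "(\<lambda>x. deriv \<phi> x *\<^sub>R f x) absolutely_integrable_on {a..b}"
      and 2: "(\<lambda>x. deriv \<phi> x *\<^sub>R ?G x) absolutely_integrable_on {a..b}"
      using test_function_continuous[OF \<phi>] by (auto intro: test_product_integrable f G_abs)
    have "integral {a..b} (\<lambda>x. deriv \<phi> x *\<^sub>R f x) = integral {a..b} (\<lambda>x. deriv \<phi> x *\<^sub>R ?G x)"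
      using weak weakG \<phi> unfolding has_weak_deriv_def
      by (simp add: lebesgue_on_open_interval(2)[OF 1, symmetric] lebesgue_on_open_interval(2)[OF 2, symmetric])
    then show ?thesis using 1 2
      by (simp add: scaleR_diff_right integral_diff absolutely_integrable_on_def)
  qed
  moreover have "(\<lambda>x. f x - ?G x) absolutely_integrable_on {a..b}"
    using f G_abs by (rule set_integral_diff)
  ultimately obtain c where c: "AE x in lebesgue_on {a<..<b}. f x - ?G x = c"
    using weak_derivative_zero_imp_const[OF ab] by blast
  have "primitive a b (\<lambda>x. c + ?G x) (\<lambda>x. 0 + g x)" by (intro primitive_add primitive_const G)
  moreover have "AE x in lebesgue_on {a<..<b}. f x = c + ?G x"
    using c by (auto elim: eventually_mono simp: algebra_simps)
  ultimately show thesis using that by simp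
qed

lemma continuous_AE_eq_imp_eq:
  fixes f g :: "real \<Rightarrow> 'e::euclidean_space"
  assumes ab: "a < b" and cont: "continuous_on {a..b} f" "continuous_on {a..b} g"
    and ae: "AE x in lebesgue_on {a<..<b}. f x = g x" and x: "x \<in> {a..b}"
  shows "f x = g x"
proof -
  let ?S = "{x \<in> {a<..<b}. f x = g x}"
  have neg: "negligible {x \<in> {a<..<b}. f x \<noteq> g x}" using ae by (simp add: AE_lebesgue_on_negligible)
  have "x \<in> closure ?S"
  proof (rule ccontr)
    assume "x \<notin> closure ?S"
    then obtain e where e: "e > 0" "ball x e \<inter> ?S = {}"
      by (metis closure_approachable disjoint_iff dist_commute mem_ball)
    have "{max a (x - e)<..<min b (x + e)} \<subseteq> {x \<in> {a<..<b}. f x \<noteq> g x}"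
      using e(2) by (auto simp: ball_def dist_real_def disjoint_iff abs_if split: if_splits)
    then have "negligible {max a (x - e)<..<min b (x + e)}" using neg negligible_subset by blast
    then show False using negligible_interval(2)[of "max a (x - e)" "min b (x + e)"] x e(1) ab by auto
  qed
  moreover have "closure ?S \<subseteq> {x \<in> {a..b}. f x - g x = 0}"
    by (intro closure_minimal continuous_closed_preimage_constant continuous_on_diff cont) auto
  ultimately show ?thesis by auto
qed

lemma cont_rep_eq:
  fixes f v :: "real \<Rightarrow> 'e::euclidean_space"
  assumes ab: "a < b" and v: "continuous_on {a..b} v" "AE x in lebesgue_on {a<..<b}. f x = v x" and x: "x \<in> {a..b}"
  shows "cont_rep a b f x = v x"
proof -
  have "\<exists>g. continuous_on {a..b} g \<and> (AE x in lebesgue_on {a<..<b}. g x = f x)"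
    using v by (auto simp: eq_commute)
  from someI_ex[OF this, folded cont_rep_def]
  have "continuous_on {a..b} (cont_rep a b f)" "AE x in lebesgue_on {a<..<b}. cont_rep a b f x = f x"
    by (auto simp: cont_rep_def)
  with v show ?thesis
    by (intro continuous_AE_eq_imp_eq[OF ab _ _ _ x]) auto
qed

lemma abs_continuous_on_imp_continuous_on:
  assumes "abs_continuous_on a b f"
  shows "continuous_on {a..b} f"
  unfolding continuous_on_iff
proof (intro ballI allI impI)
  fix x e :: real assume x: "x \<in> {a..b}" and e: "0 < e"
  obtain d where d: "d > 0" and ac: "\<And>(n::nat) c d'.
      (\<forall>k<n. a \<le> c k \<and> c k \<le> d' k \<and> d' k \<le> b) \<and>
        (\<forall>j<n. \<forall>k<n. j \<noteq> k \<longrightarrow> d' j \<le> c k \<or> d' k \<le> c j) \<and>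
        (\<Sum>k<n. d' k - c k) < d \<Longrightarrow> (\<Sum>k<n. norm (f (d' k) - f (c k))) < e"
    using assms e unfolding abs_continuous_on_def by blast
  have *: "norm (f z - f y) < e" if "y \<in> {a..b}" "z \<in> {a..b}" "y \<le> z" "z - y < d" for y z
    using ac[of 1 "\<lambda>_. y" "\<lambda>_. z"] that by auto
  show "\<exists>d>0. \<forall>x'\<in>{a..b}. dist x' x < d \<longrightarrow> dist (f x') (f x) < e"
  proof (intro exI[of _ d] conjI ballI impI d)
    fix y assume y: "y \<in> {a..b}" "dist y x < d"
    then show "dist (f y) (f x) < e"
      using *[of x y] *[of y x] x
      by (cases "x \<le> y") (auto simp: dist_norm norm_minus_commute)
  qed
qed

lemma primitive_cong_AE:
  assumes "primitive a b f g" "AE x in lebesgue_on {a<..<b}. g' x = g x"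
  shows "primitive a b f g'"
proof (rule primitiveI)
  have neg: "negligible ({x \<in> {a<..<b}. g' x \<noteq> g x} \<union> {a, b})"
    using assms(2) by (auto simp: AE_lebesgue_on_negligible)
  show "g' absolutely_integrable_on {a..b}"
    by (intro absolutely_integrable_spike[OF primitive_absolutely_integrable[OF assms(1)] neg]) auto
  fix x assume x: "x \<in> {a..b}"
  have "integral {a..x} g' = integral {a..x} g"
    using x by (intro integral_spike[OF neg]) auto
  then show "f x = f a + integral {a..x} g'"
    using primitiveD[OF assms(1) x] by simp
qed

section \<open>Real and complex matrices\<close>

lemma matrix_inv_vector:
  fixes A :: "'a::field^'n^'n"
  assumes "invertible A"
  shows "A *v (matrix_inv A *v x) = x" "matrix_inv A *v (A *v x) = x"
proof -
  have "A ** matrix_inv A = mat 1 \<and> matrix_inv A ** A = mat 1"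
    using assms unfolding invertible_def matrix_inv_def by (rule someI_ex)
  then show "A *v (matrix_inv A *v x) = x" "matrix_inv A *v (A *v x) = x"
    by (simp_all add: matrix_vector_mul_assoc)
qed

lemma inner_symmetric_matrix:
  fixes A :: "real^'n^'n"
  assumes "transpose A = A"
  shows "(A *v x) \<bullet> y = x \<bullet> (A *v y)"
  using assms dot_lmul_matrix[of x A y] transpose_matrix_vector[of A x] by simp

lemma inner_transpose_matrix:
  fixes A :: "real^'n^'m"
  shows "(A *v x) \<bullet> y = x \<bullet> (transpose A *v y)"
  using dot_lmul_matrix[of y A x] transpose_matrix_vector[of A y] by (simp add: inner_commute)

lemma injective_bound_imp_invertible:
  fixes A :: "'a::field^'n^'n"
  assumes "\<And>x. A *v x = 0 \<Longrightarrow> x = 0"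
  shows "invertible A"
proof -
  have "inj ((*v) A)"
  proof (rule injI)
    fix x y assume "A *v x = A *v y"
    then have "A *v (x - y) = 0" by (simp add: matrix_vector_mult_diff_distrib)
    then show "x = y" using assms by force
  qed
  then show ?thesis
    using invertible_left_inverse matrix_left_invertible_injective by blast
qed

definition vec_Re :: "complex^'n \<Rightarrow> real^'n" where "vec_Re z = (\<chi> i. Re (z $ i))"
definition vec_Im :: "complex^'n \<Rightarrow> real^'n" where "vec_Im z = (\<chi> i. Im (z $ i))"
definition vec_Complex :: "real^'n \<Rightarrow> real^'n \<Rightarrow> complex^'n" where
  "vec_Complex r s = (\<chi> i. Complex (r $ i) (s $ i))"

lemma vec_Re_Im_Complex [simp]: "vec_Re (vec_Complex r s) = r" "vec_Im (vec_Complex r s) = s"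
  "vec_Complex (vec_Re z) (vec_Im z) = z"
  by (simp_all add: vec_Re_def vec_Im_def vec_Complex_def vec_eq_iff)

lemma vec_complex_eqI: "vec_Re z = vec_Re w \<Longrightarrow> vec_Im z = vec_Im w \<Longrightarrow> z = w"
  by (metis vec_Re_Im_Complex(3))

lemma bounded_linear_vec_Re: "bounded_linear (vec_Re :: complex^'n \<Rightarrow> real^'n)"
  and bounded_linear_vec_Im: "bounded_linear (vec_Im :: complex^'n \<Rightarrow> real^'n)"
  unfolding vec_Re_def[abs_def] vec_Im_def[abs_def]
  by (auto simp: linear_conv_bounded_linear[symmetric] linear_iff vec_eq_iff)

lemma bounded_linear_vec_Complex: "bounded_linear (\<lambda>r :: real^'n. vec_Complex r 0)"
    "bounded_linear (\<lambda>s :: real^'n. vec_Complex 0 s)"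
  unfolding vec_Complex_def
  by (auto simp: linear_conv_bounded_linear[symmetric] linear_iff vec_eq_iff complex_eq_iff)

lemma vec_Complex_split: "vec_Complex r s = vec_Complex r 0 + vec_Complex 0 s"
  by (simp add: vec_Complex_def vec_eq_iff complex_eq_iff)

lemma vec_Re_cmat [simp]: "vec_Re (cmat A *v z) = A *v vec_Re z"
  and vec_Im_cmat [simp]: "vec_Im (cmat A *v z) = A *v vec_Im z"
  by (simp_all add: vec_Re_def vec_Im_def cmat_def matrix_vector_mult_def vec_eq_iff)

lemma mat_vector: "mat c *v z = c *s (z :: 'a::comm_ring_1^'n)"
  by (simp add: mat_def matrix_vector_mult_def vec_eq_iff vector_scalar_mult_def if_distrib
      if_distribR cong: if_cong)

lemma vec_Re_mat_ii [simp]: "vec_Re (mat (\<i> * complex_of_real t) *v z) = - t *\<^sub>R vec_Im z"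
  and vec_Im_mat_ii [simp]: "vec_Im (mat (\<i> * complex_of_real t) *v z) = t *\<^sub>R vec_Re z"
  by (simp_all add: vec_Re_def vec_Im_def mat_vector vec_eq_iff)

lemma vec_Re_simps [simp]: "vec_Re (x + y) = vec_Re x + vec_Re y" "vec_Re (x - y) = vec_Re x - vec_Re y"
    "vec_Re (- x) = - vec_Re x" "vec_Re (c *\<^sub>R x) = c *\<^sub>R vec_Re x" "vec_Re 0 = 0"
  and vec_Im_simps [simp]: "vec_Im (x + y) = vec_Im x + vec_Im y" "vec_Im (x - y) = vec_Im x - vec_Im y"
    "vec_Im (- x) = - vec_Im x" "vec_Im (c *\<^sub>R x) = c *\<^sub>R vec_Im x" "vec_Im 0 = 0"
  by (simp_all add: vec_Re_def vec_Im_def vec_eq_iff)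

lemma inner_vec_complex: "z \<bullet> w = vec_Re z \<bullet> vec_Re w + vec_Im z \<bullet> vec_Im w"
  by (simp add: inner_vec_def vec_Re_def vec_Im_def inner_complex_def sum.distrib)

lemma norm_vec_complex_power2: "(norm z)\<^sup>2 = (norm (vec_Re z))\<^sup>2 + (norm (vec_Im z))\<^sup>2"
  by (simp add: power2_norm_eq_inner inner_vec_complex)

lemma norm_matrix_le_columns:
  fixes A :: "complex^'n^'m"
  assumes "\<And>z. norm (A *v z) \<le> C * norm z"
  shows "norm A \<le> real CARD('m) * real CARD('n) * C"
proof -
  have entry: "norm (A $ i $ j) \<le> C" for i j
  proof -
    have "(A *v axis j 1) $ i = A $ i $ j"
      by (simp add: matrix_vector_mult_def axis_def if_distrib cong: if_cong)
    then have "norm (A $ i $ j) \<le> norm (A *v axis j 1)"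
      by (metis Finite_Cartesian_Product.norm_nth_le)
    also have "\<dots> \<le> C" using assms[of "axis j 1"] by (simp add: norm_axis_1)
    finally show ?thesis .
  qed
  have "norm A \<le> (\<Sum>i\<in>UNIV. norm (A $ i))" by (simp add: norm_vec_def L2_set_le_sum)
  also have "\<dots> \<le> (\<Sum>i\<in>(UNIV :: 'm set). \<Sum>j\<in>(UNIV :: 'n set). C)"
  proof (rule sum_mono)
    fix i
    have "norm (A $ i) \<le> (\<Sum>j\<in>UNIV. norm (A $ i $ j))" by (simp add: norm_vec_def L2_set_le_sum)
    also have "\<dots> \<le> (\<Sum>j\<in>(UNIV :: 'n set). C)" by (intro sum_mono entry)
    finally show "norm (A $ i) \<le> (\<Sum>j\<in>(UNIV :: 'n set). C)" .
  qed
  finally show ?thesis by simp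
qed

lemma norm_vstack_power2: "(norm (vstack x y))\<^sup>2 = (norm x)\<^sup>2 + (norm y)\<^sup>2"
  for x :: "'e::real_normed_vector^'p" and y :: "'e^'q"
proof -
  have n: "(norm z)\<^sup>2 = (\<Sum>i\<in>UNIV. (norm (z $ i))\<^sup>2)" for z :: "'e^'r::finite"
    by (simp add: norm_vec_def L2_set_def sum_nonneg)
  show ?thesis
    unfolding n by (subst UNIV_Plus_UNIV[symmetric], subst sum.Plus) (simp_all add: vstack_def)
qed

lemma norm_vstack_zero: "norm (vstack x (0 :: 'e::real_normed_vector^'q)) = norm (x :: 'e^'p)"
proof -
  have "(norm (vstack x (0 :: 'e^'q)))\<^sup>2 = (norm x)\<^sup>2" by (simp add: norm_vstack_power2)
  then show ?thesis by (metis norm_ge_zero power2_eq_iff_nonneg)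
qed

lemma vstack_vector: "vstack A B *v z = vstack (A *v z) (B *v z)"
  by (simp add: vstack_def vec_eq_iff matrix_vector_mult_def split: sum.split)

lemma vstack_add: "vstack x y + vstack x' y' = vstack (x + x') (y + y')"
  and vstack_diff: "vstack x y - vstack x' y' = vstack (x - x') (y - y')" for x :: "'e::ab_group_add^'p"
  by (simp_all add: vstack_def vec_eq_iff split: sum.split)

lemma vec_Re_vstack: "vec_Re (vstack x y) = vstack (vec_Re x) (vec_Re y)"
  and vec_Im_vstack: "vec_Im (vstack x y) = vstack (vec_Im x) (vec_Im y)"
  by (simp_all add: vstack_def vec_eq_iff vec_Re_def vec_Im_def split: sum.split)

lemma cmat_inverse_vector:
  assumes "invertible A"
  shows "cmat A *v (cmat (matrix_inv A) *v z) = z" "cmat (matrix_inv A) *v (cmat A *v z) = z"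
  by (rule vec_complex_eqI; simp add: matrix_inv_vector[OF assms])+

lemma coeff_vector:
  "ph_coeff H P1 P0 t x *v z
    = cmat (matrix_inv P1) *v (mat (\<i> * complex_of_real t) *v (cmat (matrix_inv (H x)) *v z) - cmat P0 *v z)"
  by (simp add: ph_coeff_def matrix_vector_mult_diff_rdistrib flip: matrix_vector_mul_assoc)

lemma op_norm_bound: "norm (A *v z) \<le> op_norm A * norm z"
  unfolding op_norm_def by (rule onorm) simp

lemma bounded_linear_matrix_eval: "bounded_linear (\<lambda>A :: complex^'n^'m. A *v z)"
  by (auto simp: linear_conv_bounded_linear[symmetric] linear_iff matrix_vector_mult_def
      vec_eq_iff scaleR_sum_right distrib_right sum.distrib)

lemma bounded_bilinear_matrix_vector:
  "bounded_bilinear (\<lambda>(A :: real^'n^'m) x. A *v x)"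
  by (intro bilinear_conv_bounded_bilinear[THEN iffD1])
    (auto simp: bilinear_def linear_iff algebra_simps matrix_vector_mult_add_rdistrib scaleR_matrix_vector_assoc
      matrix_vector_mult_scaleR)

lemma borel_measurable_vec_componentwise:
  fixes f :: "'a \<Rightarrow> real^'n"
  assumes "\<And>i. (\<lambda>x. f x $ i) \<in> borel_measurable M"
  shows "f \<in> borel_measurable M"
proof -
  have "f x = (\<Sum>i\<in>UNIV. f x $ i *\<^sub>R axis i 1)" for x
    by (simp add: vec_eq_iff axis_def if_distrib cong: if_cong)
  then have "f = (\<lambda>x. \<Sum>i\<in>UNIV. f x $ i *\<^sub>R axis i 1)" by blast
  moreover have "(\<lambda>x. \<Sum>i\<in>UNIV. f x $ i *\<^sub>R axis i (1::real)) \<in> borel_measurable M"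
    using assms by measurable
  ultimately show ?thesis by simp
qed

lemma borel_measurable_vec_nth:
  fixes f :: "'a \<Rightarrow> 'b::euclidean_space^'n"
  assumes "f \<in> borel_measurable M"
  shows "(\<lambda>x. f x $ i) \<in> borel_measurable M"
  using assms borel_measurable_continuous_onI[OF linear_continuous_on[OF bounded_linear_vec_nth], of i] by measurable

lemma borel_measurable_det:
  fixes A :: "'a \<Rightarrow> real^'n^'n"
  assumes "\<And>i j. (\<lambda>x. A x $ i $ j) \<in> borel_measurable M"
  shows "(\<lambda>x. det (A x)) \<in> borel_measurable M"
  unfolding det_def using assms by measurable

section \<open>Square-integrable functions on an interval\<close>

lemma bounded_imp_L2:
  assumes "f \<in> borel_measurable (lebesgue_on {a<..<b})" "\<And>x. x \<in> {a<..<b} \<Longrightarrow> norm (f x) \<le> C"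
  shows "f \<in> L2 a b"
proof -
  interpret finite_measure "lebesgue_on {a<..<b}" by (rule finite_measure_lebesgue_on) simp
  have "integrable (lebesgue_on {a<..<b}) (\<lambda>x. (norm (f x))\<^sup>2)"
    using assms by (intro integrable_const_bound[of _ "C\<^sup>2"])
      (auto intro!: AE_I2 power_mono simp: abs_le_square_iff)
  then show ?thesis using assms by (simp add: L2_def)
qed

lemma L2_absolutely_integrable:
  assumes "f \<in> L2 a b"
  shows "f absolutely_integrable_on {a..b}"
proof -
  interpret finite_measure "lebesgue_on {a<..<b}" by (rule finite_measure_lebesgue_on) simp
  have "integrable (lebesgue_on {a<..<b}) f"
  proof (rule Bochner_Integration.integrable_bound)
    show "integrable (lebesgue_on {a<..<b}) (\<lambda>x. 1 + (norm (f x))\<^sup>2)"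
      using assms by (auto simp: L2_def)
    have "y \<le> 1 + y\<^sup>2" for y :: real using zero_le_power2[of "y - 1 / 2"] by (simp add: power2_eq_square algebra_simps)
    then show "AE x in lebesgue_on {a<..<b}. norm (f x) \<le> norm (1 + (norm (f x))\<^sup>2)"
      by (intro AE_I2) (auto intro: order_trans[OF _ abs_ge_self])
  qed (use assms in \<open>auto simp: L2_def\<close>)
  then show ?thesis by (simp add: lebesgue_on_open_interval(1))
qed

lemma L2_add:
  assumes f: "f \<in> L2 a b" and g: "g \<in> L2 a b"
  shows "(\<lambda>x. f x + g x) \<in> L2 a b"
proof -
  have "integrable (lebesgue_on {a<..<b}) (\<lambda>x. (norm (f x + g x))\<^sup>2)"
  proof (rule Bochner_Integration.integrable_bound)
    show "integrable (lebesgue_on {a<..<b}) (\<lambda>x. 2 * (norm (f x))\<^sup>2 + 2 * (norm (g x))\<^sup>2)"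
      using assms by (auto simp: L2_def)
    have "(norm (f x + g x))\<^sup>2 \<le> 2 * (norm (f x))\<^sup>2 + 2 * (norm (g x))\<^sup>2" for x
    proof -
      have "(norm (f x + g x))\<^sup>2 \<le> (norm (f x) + norm (g x))\<^sup>2" by (intro power_mono norm_triangle_ineq) auto
      also have "\<dots> \<le> 2 * (norm (f x))\<^sup>2 + 2 * (norm (g x))\<^sup>2"
        using zero_le_power2[of "norm (f x) - norm (g x)"] by (simp add: power2_eq_square algebra_simps)
      finally show ?thesis .
    qed
    then show "AE x in lebesgue_on {a<..<b}. norm ((norm (f x + g x))\<^sup>2) \<le> norm (2 * (norm (f x))\<^sup>2 + 2 * (norm (g x))\<^sup>2)"
      by (intro AE_I2) (auto intro: order_trans[OF _ abs_ge_self])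
  qed (use assms in \<open>auto simp: L2_def\<close>)
  then show ?thesis using assms by (auto simp: L2_def)
qed

lemma L2_linear:
  fixes T :: "'e::euclidean_space \<Rightarrow> 'f::euclidean_space"
  assumes "bounded_linear T" and f: "f \<in> L2 a b"
  shows "(\<lambda>x. T (f x)) \<in> L2 a b"
proof -
  obtain K where K: "\<And>x. norm (T x) \<le> norm x * K" using bounded_linear.bounded[OF assms(1)] by blast
  have [measurable]: "f \<in> borel_measurable (lebesgue_on {a<..<b})" using f by (simp add: L2_def)
  have meas: "(\<lambda>x. T (f x)) \<in> borel_measurable (lebesgue_on {a<..<b})"
    using borel_measurable_continuous_onI[of T] linear_continuous_on[OF assms(1)] by measurable
  have "integrable (lebesgue_on {a<..<b}) (\<lambda>x. (norm (T (f x)))\<^sup>2)"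
  proof (rule Bochner_Integration.integrable_bound)
    show "integrable (lebesgue_on {a<..<b}) (\<lambda>x. K\<^sup>2 * (norm (f x))\<^sup>2)" using f by (simp add: L2_def)
    have "(norm (T y))\<^sup>2 \<le> K\<^sup>2 * (norm y)\<^sup>2" for y
      using power_mono[OF K[of y] norm_ge_zero, of 2] by (simp add: power_mult_distrib mult.commute)
    then show "AE x in lebesgue_on {a<..<b}. norm ((norm (T (f x)))\<^sup>2) \<le> norm (K\<^sup>2 * (norm (f x))\<^sup>2)"
      by (intro AE_I2) auto
  qed (use meas in auto)
  then show ?thesis using meas by (simp add: L2_def)
qed

text \<open>The Cauchy-Schwarz inequality, in the form that \<open>norm (f x)\<close> has nonnegative variance.\<close>
lemma integral_norm_power2_le:
  fixes f :: "real \<Rightarrow> 'e::euclidean_space"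
  assumes ab: "a < b" and f: "f \<in> L2 a b"
  shows "(LINT x|lebesgue_on {a<..<b}. norm (f x))\<^sup>2 \<le> (b - a) * (LINT x|lebesgue_on {a<..<b}. (norm (f x))\<^sup>2)"
proof -
  let ?M = "lebesgue_on {a<..<b}"
  interpret finite_measure ?M by (rule finite_measure_lebesgue_on) simp
  define I where "I = (LINT x|?M. norm (f x))"
  have meas: "measure ?M {a<..<b} = b - a" using ab by (simp add: measure_restrict_space)
  have int: "integrable ?M (\<lambda>x. norm (f x))" "integrable ?M (\<lambda>x. (norm (f x))\<^sup>2)"
    using L2_absolutely_integrable[OF f] f by (auto simp: lebesgue_on_open_interval(1)[symmetric] L2_def)
  have "0 \<le> (LINT x|?M. ((b - a) * norm (f x) - I)\<^sup>2)" by simp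
  also have "(\<lambda>x. ((b - a) * norm (f x) - I)\<^sup>2)
      = (\<lambda>x. (b - a)\<^sup>2 * (norm (f x))\<^sup>2 - (2 * (b - a) * I * norm (f x) - I\<^sup>2))"
    by (simp add: power2_eq_square algebra_simps fun_eq_iff)
  also have "(LINT x|?M. (b - a)\<^sup>2 * (norm (f x))\<^sup>2 - (2 * (b - a) * I * norm (f x) - I\<^sup>2))
      = (b - a)\<^sup>2 * (LINT x|?M. (norm (f x))\<^sup>2) - (2 * (b - a) * I * I - (b - a) * I\<^sup>2)"
    using int by (subst Bochner_Integration.integral_diff; (subst Bochner_Integration.integral_diff)?)
      (auto simp: I_def[symmetric] meas)
  finally have "(b - a) * I\<^sup>2 \<le> (b - a) * ((b - a) * (LINT x|?M. (norm (f x))\<^sup>2))"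
    by (simp add: power2_eq_square algebra_simps)
  then show ?thesis using ab by (simp add: I_def)
qed

text \<open>Local integrability supplies measurability on the whole open interval, by exhaustion.\<close>
lemma locally_integrable_bounded:
  fixes f :: "real \<Rightarrow> 'e::euclidean_space"
  assumes f: "locally_integrable a b f" and bound: "\<And>x. x \<in> {a<..<b} \<Longrightarrow> norm (f x) \<le> C"
  shows "f absolutely_integrable_on {a..b}" "f \<in> L2 a b"
proof -
  have "(\<lambda>x. indicator {a<..<b} x *\<^sub>R f x) \<in> borel_measurable lebesgue"
  proof (rule borel_measurable_LIMSEQ_metric)
    let ?I = "\<lambda>n. {a + inverse (real (Suc n))..b - inverse (real (Suc n))}"
    show "(\<lambda>x. indicator (?I n) x *\<^sub>R f x) \<in> borel_measurable lebesgue" for n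
    proof -
      have "set_integrable lebesgue (?I n) f" using f unfolding locally_integrable_def by simp
      then show ?thesis by (auto simp: set_integrable_def)
    qed
    fix x
    show "(\<lambda>n. indicator (?I n) x *\<^sub>R f x) \<longlonglongrightarrow> indicator {a<..<b} x *\<^sub>R f x"
    proof (cases "x \<in> {a<..<b}")
      case True
      then obtain N where N: "inverse (real (Suc N)) < min (x - a) (b - x)"
        using reals_Archimedean[of "min (x - a) (b - x)"] by auto
      have "indicator (?I n) x *\<^sub>R f x = indicator {a<..<b} x *\<^sub>R f x" if "n \<ge> N" for n
      proof -
        have "inverse (real (Suc n)) \<le> inverse (real (Suc N))" using that by simp
        then have "inverse (real (Suc n)) < x - a" "inverse (real (Suc n)) < b - x" using N by linarith+
        then have "x \<in> ?I n" by simp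
        then show ?thesis using True by simp
      qed
      then show ?thesis by (intro tendsto_eventually eventually_sequentiallyI)
    next
      case False
      have "inverse (real (Suc n)) > 0" for n by simp
      then have "x \<notin> ?I n" for n
        using False by (smt (verit) atLeastAtMost_iff greaterThanLessThan_iff)
      then show ?thesis using False by simp
    qed
  qed
  then have "f \<in> borel_measurable (lebesgue_on {a<..<b})"
    by (subst borel_measurable_restrict_space_iff) auto
  then show "f \<in> L2 a b" by (rule bounded_imp_L2[OF _ bound])
  then show "f absolutely_integrable_on {a..b}" by (rule L2_absolutely_integrable)
qed

locale nonempty_interval =
  fixes a b :: real
  assumes ab: "a < b"
begin

abbreviation L where "L \<equiv> lebesgue_on {a<..<b}"

lemma L2_measurable: "u \<in> L2 a b \<Longrightarrow> u \<in> borel_measurable L"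
  by (simp add: L2_def)

lemma inner_integrable:
  assumes u: "u \<in> L2 a b" and v: "v \<in> L2 a b"
  shows "integrable L (\<lambda>x. (u x :: 'e::euclidean_space) \<bullet> v x)"
proof (rule Bochner_Integration.integrable_bound)
  show "integrable L (\<lambda>x. (norm (u x))\<^sup>2 + (norm (v x))\<^sup>2)" using assms by (simp add: L2_def)
  have "\<bar>x \<bullet> y\<bar> \<le> (norm x)\<^sup>2 + (norm y)\<^sup>2" for x y :: 'e
  proof -
    have "\<bar>x \<bullet> y\<bar> \<le> norm x * norm y" by (rule Cauchy_Schwarz_ineq2)
    also have "\<dots> \<le> (norm x)\<^sup>2 + (norm y)\<^sup>2"
    proof -
      have "0 \<le> (norm x)\<^sup>2 + (norm y)\<^sup>2 - 2 * (norm x * norm y)"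
        using zero_le_power2[of "norm x - norm y"] by (simp add: power2_diff)
      then show ?thesis using mult_nonneg_nonneg[OF norm_ge_zero[of x] norm_ge_zero[of y]] by linarith
    qed
    finally show ?thesis .
  qed
  then show "AE x in L. norm (u x \<bullet> v x) \<le> norm ((norm (u x))\<^sup>2 + (norm (v x))\<^sup>2)"
    by (intro AE_I2) auto
qed (use assms L2_measurable in measurable)

lemma continuous_L2:
  fixes v :: "real \<Rightarrow> 'e::euclidean_space"
  assumes "continuous_on {a..b} v"
  shows "v \<in> L2 a b"
proof -
  have "bounded (v ` {a..b})" using assms compact_imp_bounded compact_continuous_image by blast
  then obtain C where C: "\<And>x. x \<in> {a..b} \<Longrightarrow> norm (v x) \<le> C" unfolding bounded_iff by blast
  have "integrable L v"
    using absolutely_integrable_continuous_real[OF assms] by (simp add: lebesgue_on_open_interval(1))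
  then show ?thesis by (intro bounded_imp_L2[of _ _ _ C] C) auto
qed

lemma L2_diff: "f \<in> L2 a b \<Longrightarrow> g \<in> L2 a b \<Longrightarrow> (\<lambda>x. f x - g x :: 'e::euclidean_space) \<in> L2 a b"
  using L2_add[of f a b "\<lambda>x. - g x"] L2_linear[OF bounded_linear_minus[OF bounded_linear_ident], of g a b]
  by simp

lemma integral_power2_le:
  fixes f :: "real \<Rightarrow> 'e::euclidean_space"
  assumes "f \<in> L2 a b" "AE x in L. norm (f x) \<le> C" "0 \<le> C"
  shows "(LINT x|L. (norm (f x))\<^sup>2) \<le> (b - a) * C\<^sup>2"
proof -
  interpret finite_measure L by (rule finite_measure_lebesgue_on) simp
  have "(LINT x|L. (norm (f x))\<^sup>2) \<le> (LINT x|L. C\<^sup>2)"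
    using assms by (intro integral_mono_AE) (auto simp: L2_def elim!: eventually_mono intro!: power_mono)
  also have "\<dots> = (b - a) * C\<^sup>2" using ab by (simp add: measure_restrict_space)
  finally show ?thesis .
qed

lemma L2_vec_Complex: "r \<in> L2 a b \<Longrightarrow> s \<in> L2 a b \<Longrightarrow> (\<lambda>x. vec_Complex (r x) (s x)) \<in> L2 a b"
  using L2_add[OF L2_linear[OF bounded_linear_vec_Complex(1), of r a b]
      L2_linear[OF bounded_linear_vec_Complex(2), of s a b]]
  by (simp only: vec_Complex_split[symmetric])

lemma primitive_vec_Complex:
  assumes "primitive a b r r'" "primitive a b s s'"
  shows "primitive a b (\<lambda>x. vec_Complex (r x) (s x)) (\<lambda>x. vec_Complex (r' x) (s' x))"
  using primitive_add[OF primitive_linear[OF bounded_linear_vec_Complex(1) assms(1)]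
      primitive_linear[OF bounded_linear_vec_Complex(2) assms(2)]]
  by (simp only: vec_Complex_split[symmetric])

end

context nonempty_interval
begin

text \<open>Cutting off large values and a neighbourhood of the end points leaves room for the averages in the
  next lemma to vanish at the end points.\<close>
lemma truncation_approximation:
  fixes f :: "real \<Rightarrow> 'e::euclidean_space"
  assumes f: "f \<in> L2 a b" and e: "e > 0"
  obtains \<phi> :: "real \<Rightarrow> 'e" and \<delta> N where "\<phi> \<in> borel_measurable L" "\<delta> > 0" "a + \<delta> < b - \<delta>" "\<And>x. norm (\<phi> x) \<le> N"
    "\<And>x. x \<notin> {a + \<delta><..<b - \<delta>} \<Longrightarrow> \<phi> x = 0" "(LINT x|L. (norm (f x - \<phi> x))\<^sup>2) < e"
proof -
  define \<delta> where "\<delta> n = (b - a) / (real n + 3)" for n :: nat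
  define \<phi> where "\<phi> n x = (if x \<in> {a + \<delta> n<..<b - \<delta> n} \<and> norm (f x) \<le> real n then f x else 0)" for n x
  have f_meas [measurable]: "f \<in> borel_measurable L" using f by (simp add: L2_def)
  have id_meas [measurable]: "(\<lambda>x. x) \<in> borel_measurable L"
    by (intro measurable_restrict_space1 measurable_completion) simp
  have \<phi>_meas [measurable]: "\<phi> n \<in> borel_measurable L" for n
    unfolding \<phi>_def[abs_def] greaterThanLessThan_iff by measurable
  have "(\<lambda>n. LINT x|L. (norm (f x - \<phi> n x))\<^sup>2) \<longlonglongrightarrow> (LINT x|L. 0)"
  proof (rule integral_dominated_convergence)
    show "integrable L (\<lambda>x. (norm (f x))\<^sup>2)" using f by (simp add: L2_def)
    show "AE x in L. norm ((norm (f x - \<phi> n x))\<^sup>2) \<le> (norm (f x))\<^sup>2" for n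
      by (intro AE_I2) (simp add: \<phi>_def)
    show "AE x in L. (\<lambda>n. (norm (f x - \<phi> n x))\<^sup>2) \<longlonglongrightarrow> 0"
    proof (rule AE_I2)
      fix x assume "x \<in> space L"
      then have x: "a < x" "x < b" by auto
      have "\<delta> \<longlonglongrightarrow> 0"
        using tendsto_mult_right_zero[OF LIMSEQ_ignore_initial_segment[OF lim_inverse_n, of 3], of "b - a"]
        by (simp add: \<delta>_def[abs_def] divide_inverse)
      then have "\<forall>\<^sub>F n in sequentially. \<delta> n < min (x - a) (b - x)"
        using x by (intro order_tendstoD(2)) auto
      moreover have "\<forall>\<^sub>F n in sequentially. norm (f x) \<le> real n"
        using eventually_ge_at_top[of "nat \<lceil>norm (f x)\<rceil>"] by eventually_elim linarith
      ultimately have "\<forall>\<^sub>F n in sequentially. (norm (f x - \<phi> n x))\<^sup>2 = 0"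
        by eventually_elim (auto simp: \<phi>_def)
      then show "(\<lambda>n. (norm (f x - \<phi> n x))\<^sup>2) \<longlonglongrightarrow> 0" by (rule tendsto_eventually)
    qed
  qed measurable
  then have "\<forall>\<^sub>F n in sequentially. (LINT x|L. (norm (f x - \<phi> n x))\<^sup>2) < e"
    using e by (intro order_tendstoD(2)) auto
  then obtain n where n: "(LINT x|L. (norm (f x - \<phi> n x))\<^sup>2) < e"
    by (auto simp: eventually_sequentially)
  have "\<delta> n \<le> (b - a) / 3" unfolding \<delta>_def using ab by (intro divide_left_mono) auto
  then have gap: "a + \<delta> n < b - \<delta> n" using ab by (simp add: field_simps)
  show thesis
  proof (rule that[OF \<phi>_meas _ gap _ _ n])
    show "\<delta> n > 0" using ab by (simp add: \<delta>_def)
    show "norm (\<phi> n x) \<le> real n" for x by (simp add: \<phi>_def)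
    show "\<phi> n x = 0" if "x \<notin> {a + \<delta> n<..<b - \<delta> n}" for x using that by (auto simp: \<phi>_def)
  qed
qed

text \<open>The averages \<open>(1/h) \<integral> \<phi>\<close> over \<open>{x..x + h}\<close> of a truncation \<open>\<phi>\<close> have the derivative
  \<open>(\<phi> (x + h) - \<phi> x)/h\<close>, vanish at both end points for small \<open>h\<close>, and converge to \<open>\<phi>\<close> almost
  everywhere by Lebesgue's differentiation theorem; they are uniformly bounded, so dominated
  convergence applies.\<close>
lemma L2_dense_primitives:
  fixes f :: "real \<Rightarrow> 'e::euclidean_space"
  assumes f: "f \<in> L2 a b" and e: "e > 0"
  obtains v g where "primitive a b v g" "g \<in> L2 a b" "v a = 0" "v b = 0" "(LINT x|L. (norm (f x - v x))\<^sup>2) < e"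
proof -
  obtain \<phi> :: "real \<Rightarrow> 'e" and \<delta> N where \<phi>: "\<phi> \<in> borel_measurable L" "\<delta> > 0" "a + \<delta> < b - \<delta>" "\<And>x. norm (\<phi> x) \<le> N"
    "\<And>x. x \<notin> {a + \<delta><..<b - \<delta>} \<Longrightarrow> \<phi> x = 0" "(LINT x|L. (norm (f x - \<phi> x))\<^sup>2) < e / 4"
    using truncation_approximation[OF f, of "e / 4"] e by auto
  have N0: "N \<ge> 0" using \<phi>(4)[of a] norm_ge_zero order_trans by blast
  have \<phi>_L2: "\<phi> \<in> L2 a b" by (rule bounded_imp_L2[OF \<phi>(1,4)])
  have \<phi>_abs: "\<phi> absolutely_integrable_on {c..d}" for c d
  proof -
    have "(\<lambda>x. if x \<in> {a..b} then \<phi> x else 0) absolutely_integrable_on UNIV"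
      using L2_absolutely_integrable[OF \<phi>_L2] absolutely_integrable_restrict_UNIV by blast
    moreover have "(\<lambda>x. if x \<in> {a..b} then \<phi> x else 0) = \<phi>" using \<phi>(2,5) by (auto simp: fun_eq_iff)
    ultimately show ?thesis by (metis absolutely_integrable_on_subinterval subset_UNIV)
  qed
  then have \<phi>_int: "\<phi> integrable_on {c..d}" for c d by (simp add: absolutely_integrable_on_def)
  define v where "v h x = (1 / h) *\<^sub>R integral {x..x + h} \<phi>" for h x
  define g where "g h x = (1 / h) *\<^sub>R (\<phi> (x + h) - \<phi> x)" for h x
  have v_le: "norm (v h x) \<le> N" if h: "h > 0" for h x
  proof -
    have "norm (integral {x..x + h} \<phi>) \<le> integral {x..x + h} (\<lambda>_. N)"
      by (rule integral_norm_bound_integral) (auto intro: \<phi>_int \<phi>(4))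
    then show ?thesis using h by (simp add: v_def field_simps)
  qed
  have v_prim: "primitive a b (v h) (g h)" if h: "h > 0" for h
  proof (rule primitiveI)
    have shift_abs: "(\<lambda>x. \<phi> (x + h)) absolutely_integrable_on {a..b}"
    proof -
      have "\<phi> absolutely_integrable_on {a + h..b + h}" by (rule \<phi>_abs)
      then show ?thesis
        unfolding absolutely_integrable_on_def
        using integrable_on_shift_cbox[of \<phi> h a b] integrable_on_shift_cbox[of "\<lambda>x. norm (\<phi> x)" h a b]
        by (simp add: o_def add.commute[of h])
    qed
    show "g h absolutely_integrable_on {a..b}"
      unfolding g_def[abs_def] by (intro absolutely_integrable_scaleR_left set_integral_diff shift_abs \<phi>_abs)
    fix x assume x: "x \<in> {a..b}"
    have "integral {a..x} (\<lambda>y. \<phi> (y + h)) = integral {a + h..x + h} \<phi>"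
      using integral_shift_Icc_real[of a x \<phi> h] by (simp add: o_def add.commute)
    moreover have "(\<lambda>y. \<phi> (y + h)) integrable_on {a..x}"
      using absolutely_integrable_on_subinterval[OF shift_abs, of a x] x by (simp add: absolutely_integrable_on_def)
    ultimately have "integral {a..x} (g h) = (1 / h) *\<^sub>R (integral {a + h..x + h} \<phi> - integral {a..x} \<phi>)"
      unfolding g_def[abs_def] using \<phi>_int[of a x] by (simp add: integral_diff)
    moreover have "integral {a..x} \<phi> + integral {x..x + h} \<phi> = integral {a..a + h} \<phi> + integral {a + h..x + h} \<phi>"
      using x h Henstock_Kurzweil_Integration.integral_combine[of a x "x + h" \<phi>]
        Henstock_Kurzweil_Integration.integral_combine[of a "a + h" "x + h" \<phi>] \<phi>_int by auto
    ultimately show "v h x = v h a + integral {a..x} (g h)"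
      by (simp add: v_def flip: scaleR_add_right) (simp add: algebra_simps)
  qed
  have g_L2: "g h \<in> L2 a b" if h: "h > 0" for h
  proof (rule bounded_imp_L2)
    have "integrable L (g h)"
      using primitive_absolutely_integrable[OF v_prim[OF h]] by (simp add: lebesgue_on_open_interval(1))
    then show "g h \<in> borel_measurable L" by simp
    show "norm (g h x) \<le> 1 / h * (N + N)" for x
    proof -
      have "norm (\<phi> (x + h) - \<phi> x) \<le> N + N" by (intro norm_triangle_le_diff add_mono \<phi>(4))
      then show ?thesis unfolding g_def using h by (simp add: divide_right_mono)
    qed
  qed
  have v_ends: "v h a = 0" "v h b = 0" if h: "0 < h" "h < \<delta>" for h
  proof -
    have "\<phi> x = 0" if "x \<in> {a..a + h} \<union> {b..b + h}" for x
      using that h \<phi>(2) by (intro \<phi>(5)) auto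
    moreover have "integral I \<phi> = 0" if "\<And>x. x \<in> I \<Longrightarrow> \<phi> x = 0" for I
      using Henstock_Kurzweil_Integration.integral_cong[of I \<phi> "\<lambda>_. 0"] that by simp
    ultimately have "integral {a..a + h} \<phi> = 0" "integral {b..b + h} \<phi> = 0" by blast+
    then show "v h a = 0" "v h b = 0" by (simp_all add: v_def)
  qed
  define h where "h n = \<delta> / (real n + 2)" for n :: nat
  have h: "h n > 0" "h n < \<delta>" for n
  proof -
    have "h n \<le> \<delta> / 2" unfolding h_def using \<phi>(2) by (intro divide_left_mono) auto
    then show "h n < \<delta>" using \<phi>(2) by linarith
    show "h n > 0" using \<phi>(2) by (simp add: h_def)
  qed
  have h_lim: "filterlim h (at_right 0) sequentially"
  proof -
    have "h \<longlonglongrightarrow> 0"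
      using tendsto_mult_right_zero[OF LIMSEQ_ignore_initial_segment[OF lim_inverse_n, of 2], of \<delta>]
      by (simp add: h_def[abs_def] divide_inverse add.commute)
    then show ?thesis using h by (intro filterlim_at_withinI) (auto intro!: always_eventually)
  qed
  obtain Z where Z: "negligible Z"
    "\<And>x. x \<in> {a<..<b} - Z \<Longrightarrow> ((\<lambda>t. integral {x..x + t} \<phi> /\<^sub>R t) \<longlongrightarrow> \<phi> x) (at_right 0)"
    using Lebesgue_points[OF \<phi>_abs] by blast
  have vL: "v (h n) \<in> L2 a b" for n by (rule continuous_L2[OF primitive_continuous[OF v_prim[OF h(1)]]])
  interpret finite_measure L by (rule finite_measure_lebesgue_on) simp
  have "(\<lambda>n. LINT x|L. (norm (\<phi> x - v (h n) x))\<^sup>2) \<longlonglongrightarrow> (LINT x|L. 0)"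
  proof (rule integral_dominated_convergence)
    show "integrable L (\<lambda>_. (2 * N)\<^sup>2)" by simp
    have meas: "(\<lambda>x. (norm (\<phi> x - v (h n) x))\<^sup>2) \<in> borel_measurable L" for n
      using L2_diff[OF \<phi>_L2 vL[of n]] by (auto simp: L2_def dest: borel_measurable_integrable)
    then show "(\<lambda>x. (norm (\<phi> x - v (h n) x))\<^sup>2) \<in> borel_measurable L" for n .
    show "AE x in L. norm ((norm (\<phi> x - v (h n) x))\<^sup>2) \<le> (2 * N)\<^sup>2" for n
    proof (rule AE_I2)
      fix x
      have "norm (\<phi> x - v (h n) x) \<le> N + N"
        by (intro norm_triangle_le_diff add_mono \<phi>(4) v_le h)
      then show "norm ((norm (\<phi> x - v (h n) x))\<^sup>2) \<le> (2 * N)\<^sup>2"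
        using power_mono[of "norm (\<phi> x - v (h n) x)" "2 * N" 2] by simp
    qed
    have "{x \<in> {a<..<b}. \<not> (\<lambda>n. (norm (\<phi> x - v (h n) x))\<^sup>2) \<longlonglongrightarrow> 0} \<subseteq> Z"
    proof (clarify, rule ccontr)
      fix x assume x: "x \<in> {a<..<b}" "x \<notin> Z" and no: "\<not> (\<lambda>n. (norm (\<phi> x - v (h n) x))\<^sup>2) \<longlonglongrightarrow> 0"
      have "(\<lambda>n. integral {x..x + h n} \<phi> /\<^sub>R h n) \<longlonglongrightarrow> \<phi> x"
        by (rule filterlim_compose[OF Z(2) h_lim]) (use x in auto)
      then have "(\<lambda>n. v (h n) x) \<longlonglongrightarrow> \<phi> x" by (simp add: v_def divide_inverse)
      then have "(\<lambda>n. (norm (\<phi> x - v (h n) x))\<^sup>2) \<longlonglongrightarrow> (norm (\<phi> x - \<phi> x))\<^sup>2" by (intro tendsto_intros)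
      then show False using no by simp
    qed
    then show "AE x in L. (\<lambda>n. (norm (\<phi> x - v (h n) x))\<^sup>2) \<longlonglongrightarrow> 0"
      by (subst AE_lebesgue_on_negligible) (auto intro: negligible_subset[OF Z(1)])
  qed simp
  then have "\<forall>\<^sub>F n in sequentially. (LINT x|L. (norm (\<phi> x - v (h n) x))\<^sup>2) < e / 4"
    using e by (intro order_tendstoD(2)) auto
  then obtain n where n: "(LINT x|L. (norm (\<phi> x - v (h n) x))\<^sup>2) < e / 4"
    by (auto simp: eventually_sequentially)
  have i1: "integrable L (\<lambda>x. (norm (f x - \<phi> x))\<^sup>2)" and i2: "integrable L (\<lambda>x. (norm (\<phi> x - v (h n) x))\<^sup>2)"
    and i3: "integrable L (\<lambda>x. (norm (f x - v (h n) x))\<^sup>2)"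
    using L2_diff[OF f \<phi>_L2] L2_diff[OF \<phi>_L2 vL[of n]] L2_diff[OF f vL[of n]] by (auto simp: L2_def)
  have "(LINT x|L. (norm (f x - v (h n) x))\<^sup>2) \<le> (LINT x|L. 2 * (norm (f x - \<phi> x))\<^sup>2 + 2 * (norm (\<phi> x - v (h n) x))\<^sup>2)"
  proof (rule integral_mono)
    show "integrable L (\<lambda>x. 2 * (norm (f x - \<phi> x))\<^sup>2 + 2 * (norm (\<phi> x - v (h n) x))\<^sup>2)" using i1 i2 by simp
    fix x
    have "norm (f x - v (h n) x) \<le> norm (f x - \<phi> x) + norm (\<phi> x - v (h n) x)"
      using norm_triangle_sub[of "f x - v (h n) x" "f x - \<phi> x"] by simp
    then have "(norm (f x - v (h n) x))\<^sup>2 \<le> (norm (f x - \<phi> x) + norm (\<phi> x - v (h n) x))\<^sup>2" by (intro power_mono) auto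
    also have "\<dots> \<le> 2 * (norm (f x - \<phi> x))\<^sup>2 + 2 * (norm (\<phi> x - v (h n) x))\<^sup>2"
      using zero_le_power2[of "norm (f x - \<phi> x) - norm (\<phi> x - v (h n) x)"] by (simp add: power2_eq_square algebra_simps)
    finally show "(norm (f x - v (h n) x))\<^sup>2 \<le> 2 * (norm (f x - \<phi> x))\<^sup>2 + 2 * (norm (\<phi> x - v (h n) x))\<^sup>2" .
  qed (rule i3)
  also have "\<dots> = 2 * (LINT x|L. (norm (f x - \<phi> x))\<^sup>2) + 2 * (LINT x|L. (norm (\<phi> x - v (h n) x))\<^sup>2)"
    using i1 i2 by simp
  also have "\<dots> < e" using \<phi>(6) n by simp
  finally show thesis
    by (rule that[OF v_prim[OF h(1)] g_L2[OF h(1)] v_ends(1)[OF h] v_ends(2)[OF h]])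
qed

end

section \<open>The energy space\<close>

locale port_hamiltonian = nonempty_interval a b for a b :: real +
  fixes m M0 :: real and P1 P0 :: "real^'d^'d" and H :: "real \<Rightarrow> real^'d^'d"
  assumes m_pos: "0 < m" and M0_pos: "0 < M0"
    and P1_sym: "transpose P1 = P1" and P1_inv: "invertible P1" and P0_skew: "transpose P0 = - P0"
    and H_meas: "H \<in> borel_measurable (lebesgue_on {a<..<b})"
    and H_sym: "x \<in> {a<..<b} \<Longrightarrow> transpose (H x) = H x"
    and H_lower: "x \<in> {a<..<b} \<Longrightarrow> m * (v \<bullet> v) \<le> v \<bullet> (H x *v v)"
    and H_upper: "x \<in> {a<..<b} \<Longrightarrow> v \<bullet> (H x *v v) \<le> M0 * (v \<bullet> v)"
begin

abbreviation Hinv where "Hinv x \<equiv> matrix_inv (H x)"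

lemma H_invertible: "x \<in> {a<..<b} \<Longrightarrow> invertible (H x)"
proof (rule injective_bound_imp_invertible)
  fix v assume x: "x \<in> {a<..<b}" and v: "H x *v v = 0"
  then have "m * (v \<bullet> v) \<le> 0" using H_lower[OF x, of v] by simp
  then have "v \<bullet> v \<le> 0" using m_pos by (simp add: mult_le_0_iff)
  then show "v = 0" by (metis antisym inner_eq_zero_iff inner_ge_zero)
qed

lemmas H_Hinv = matrix_inv_vector(1)[OF H_invertible]
lemmas Hinv_H = matrix_inv_vector(2)[OF H_invertible]

lemma H_inner: "x \<in> {a<..<b} \<Longrightarrow> (H x *v u) \<bullet> v = u \<bullet> (H x *v v)"
  by (rule inner_symmetric_matrix[OF H_sym])

lemma Hinv_inner: "x \<in> {a<..<b} \<Longrightarrow> (Hinv x *v u) \<bullet> v = u \<bullet> (Hinv x *v v)"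
  using H_inner[of x "Hinv x *v u" "Hinv x *v v"] by (simp add: H_Hinv)

text \<open>The quadratic form of \<open>H x\<close> is nonnegative at \<open>z - H z / M0\<close>.\<close>
lemma H_norm_power2: 
  assumes x: "x \<in> {a<..<b}"
  shows "(norm (H x *v z))\<^sup>2 \<le> M0 * (z \<bullet> (H x *v z))"
proof -
  let ?w = "H x *v z"
  \<comment> \<open>The minimizer of \<open>- 2 * s * (?w \<bullet> ?w) + s\<^sup>2 * (M0 * (?w \<bullet> ?w))\<close>.\<close>
  define s where "s = 1 / M0"
  have "0 \<le> m * ((z - s *\<^sub>R ?w) \<bullet> (z - s *\<^sub>R ?w))" using m_pos by simp
  also have "\<dots> \<le> (z - s *\<^sub>R ?w) \<bullet> (H x *v (z - s *\<^sub>R ?w))" by (rule H_lower[OF x])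
  also have "\<dots> = z \<bullet> ?w - 2 * s * (?w \<bullet> ?w) + s\<^sup>2 * (?w \<bullet> (H x *v ?w))"
    using H_inner[OF x, of z ?w, symmetric]
    by (simp add: algebra_simps matrix_vector_mult_diff_distrib matrix_vector_mult_scaleR inner_diff_left inner_diff_right
        power2_eq_square inner_commute)
  also have "\<dots> \<le> z \<bullet> ?w - 2 * s * (?w \<bullet> ?w) + s\<^sup>2 * (M0 * (?w \<bullet> ?w))"
    by (intro add_left_mono mult_left_mono H_upper[OF x]) auto
  also have "\<dots> = z \<bullet> ?w - (?w \<bullet> ?w) / M0" using M0_pos by (simp add: s_def power2_eq_square field_simps)
  finally show ?thesis using M0_pos by (simp add: power2_norm_eq_inner field_simps)
qed

lemma H_norm: "x \<in> {a<..<b} \<Longrightarrow> norm (H x *v z) \<le> M0 * norm z"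
proof -
  assume x: "x \<in> {a<..<b}"
  have "(norm (H x *v z))\<^sup>2 \<le> M0 * (M0 * (z \<bullet> z))"
    using H_norm_power2[OF x, of z] H_upper[OF x, of z] M0_pos by (meson less_imp_le mult_left_mono order_trans)
  also have "\<dots> = (M0 * norm z)\<^sup>2" by (simp add: power_mult_distrib power2_norm_eq_inner power2_eq_square[of M0])
  finally show ?thesis by (rule power2_le_imp_le) (use M0_pos in auto)
qed

lemma Hinv_norm: "x \<in> {a<..<b} \<Longrightarrow> norm (Hinv x *v y) \<le> norm y / m"
proof -
  assume x: "x \<in> {a<..<b}"
  let ?z = "Hinv x *v y"
  have "m * (norm ?z)\<^sup>2 \<le> ?z \<bullet> y" using H_lower[OF x, of ?z] by (simp add: H_Hinv[OF x] power2_norm_eq_inner)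
  also have "\<dots> \<le> norm ?z * norm y" by (rule norm_cauchy_schwarz)
  finally have "norm ?z * (m * norm ?z) \<le> norm ?z * norm y" by (simp add: power2_eq_square mult_ac)
  then have "m * norm ?z \<le> norm y" by (cases "norm ?z = 0") auto
  then show ?thesis using m_pos by (simp add: field_simps)
qed

lemma H_vector_measurable:
  assumes [measurable]: "v \<in> borel_measurable L"
  shows "(\<lambda>x. H x *v v x) \<in> borel_measurable L"
proof -
  note [measurable] = H_meas
  show ?thesis
    by (rule borel_measurable_continuous_Pair[where H = "\<lambda>A x. A *v x"])
      (auto intro!: bounded_bilinear.continuous_on[OF bounded_bilinear_matrix_vector] continuous_intros)
qed

text \<open>Cramer's rule expresses the entries by determinants.\<close>
lemma Hinv_vector_measurable:
  fixes v :: "real \<Rightarrow> real^'d"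
  assumes v: "v \<in> borel_measurable L"
  shows "(\<lambda>x. Hinv x *v v x) \<in> borel_measurable L"
proof -
  let ?f = "\<lambda>x. \<chi> k. det (\<chi> i j. if j = k then v x $ i else H x $ i $ j) / det (H x)"
  have "(\<lambda>x. Hinv x *v v x) \<in> borel_measurable L \<longleftrightarrow> ?f \<in> borel_measurable L"
  proof (rule measurable_cong)
    fix x assume "x \<in> space L"
    then have x: "x \<in> {a<..<b}" by simp
    have "det (H x) \<noteq> 0" using H_invertible[OF x] invertible_det_nz by blast
    then show "Hinv x *v v x = ?f x" using cramer[of "H x" "Hinv x *v v x" "v x"] by (simp add: H_Hinv[OF x])
  qed
  moreover have "?f \<in> borel_measurable L"
  proof (rule borel_measurable_vec_componentwise)
    fix k
    have "(\<lambda>x. (if j = k then v x $ i else H x $ i $ j)) \<in> borel_measurable L" for i j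
      using borel_measurable_vec_nth[OF v] borel_measurable_vec_nth[OF borel_measurable_vec_nth[OF H_meas]] by auto
    then have "(\<lambda>x. det (\<chi> i j. if j = k then v x $ i else H x $ i $ j)) \<in> borel_measurable L"
      by (intro borel_measurable_det) simp
    moreover have "(\<lambda>x. det (H x)) \<in> borel_measurable L"
      by (intro borel_measurable_det borel_measurable_vec_nth H_meas)
    ultimately show "(\<lambda>x. ?f x $ k) \<in> borel_measurable L" by simp
  qed
  ultimately show ?thesis by simp
qed

lemma H_L2: "u \<in> L2 a b \<Longrightarrow> (\<lambda>x. H x *v u x) \<in> L2 a b"
proof -
  assume u: "u \<in> L2 a b"
  have meas: "(\<lambda>x. H x *v u x) \<in> borel_measurable L" by (rule H_vector_measurable[OF L2_measurable[OF u]])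
  have "integrable L (\<lambda>x. (norm (H x *v u x))\<^sup>2)"
  proof (rule Bochner_Integration.integrable_bound)
    show "integrable L (\<lambda>x. M0\<^sup>2 * (norm (u x))\<^sup>2)" using u by (simp add: L2_def)
    show "AE x in L. norm ((norm (H x *v u x))\<^sup>2) \<le> norm (M0\<^sup>2 * (norm (u x))\<^sup>2)"
      using power_mono[OF H_norm norm_ge_zero, where n = 2] by (intro AE_I2) (auto simp: power_mult_distrib)
  qed (use meas in measurable)
  then show ?thesis using meas by (simp add: L2_def)
qed

lemma Hinv_L2: "v \<in> L2 a b \<Longrightarrow> (\<lambda>x. Hinv x *v v x) \<in> L2 a b"
proof -
  assume v: "v \<in> L2 a b"
  have meas: "(\<lambda>x. Hinv x *v v x) \<in> borel_measurable L" by (rule Hinv_vector_measurable[OF L2_measurable[OF v]])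
  have "integrable L (\<lambda>x. (norm (Hinv x *v v x))\<^sup>2)"
  proof (rule Bochner_Integration.integrable_bound)
    show "integrable L (\<lambda>x. (1 / m)\<^sup>2 * (norm (v x))\<^sup>2)" using v by (simp add: L2_def)
    show "AE x in L. norm ((norm (Hinv x *v v x))\<^sup>2) \<le> norm ((1 / m)\<^sup>2 * (norm (v x))\<^sup>2)"
      using power_mono[OF Hinv_norm norm_ge_zero, where n = 2] by (intro AE_I2) (auto simp: power_divide)
  qed (use meas in measurable)
  then show ?thesis using meas by (simp add: L2_def)
qed

lemma ph_inner_integrable: "u \<in> L2 a b \<Longrightarrow> v \<in> L2 a b \<Longrightarrow> integrable L (\<lambda>x. (H x *v u x) \<bullet> v x)"
  by (intro inner_integrable H_L2)

lemma ph_inner_bounds: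
  assumes u: "u \<in> L2 a b"
  shows "m * (LINT x|L. (norm (u x))\<^sup>2) \<le> ph_inner a b H u u"
    and "ph_inner a b H u u \<le> M0 * (LINT x|L. (norm (u x))\<^sup>2)"
proof -
  have int: "integrable L (\<lambda>x. (norm (u x))\<^sup>2)" using u by (simp add: L2_def)
  have "(LINT x|L. m * (norm (u x))\<^sup>2) \<le> ph_inner a b H u u"
    unfolding ph_inner_def using int ph_inner_integrable[OF u u] H_lower
    by (intro integral_mono) (auto simp: power2_norm_eq_inner inner_commute)
  then show "m * (LINT x|L. (norm (u x))\<^sup>2) \<le> ph_inner a b H u u" by simp
  have "ph_inner a b H u u \<le> (LINT x|L. M0 * (norm (u x))\<^sup>2)"
    unfolding ph_inner_def using int ph_inner_integrable[OF u u] H_upper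
    by (intro integral_mono) (auto simp: power2_norm_eq_inner inner_commute)
  then show "ph_inner a b H u u \<le> M0 * (LINT x|L. (norm (u x))\<^sup>2)" by simp
qed

lemma energy_space: "semi_inner_product (L2 a b) (ph_inner a b H)"
proof
  show "subspace (L2 a b :: (real \<Rightarrow> real^'d) set)"
    using L2_add[of _ a b] L2_linear[OF bounded_linear_scaleR_right, of _ a b]
    by (auto simp: subspace_def plus_fun_def scaleR_fun_def zero_fun_def L2_def[of a b])
next
  fix u v w :: "real \<Rightarrow> real^'d" and c :: real
  assume u: "u \<in> L2 a b" and w: "w \<in> L2 a b"
  show "ph_inner a b H u w = ph_inner a b H w u"
    unfolding ph_inner_def
    by (intro Bochner_Integration.integral_cong refl) (metis H_inner inner_commute space_lebesgue_on)
  show "ph_inner a b H (c *\<^sub>R u) w = c * ph_inner a b H u w"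
    by (simp add: ph_inner_def scaleR_fun_def matrix_vector_mult_scaleR)
  assume v: "v \<in> L2 a b"
  have "ph_inner a b H (u + v) w = (LINT x|L. (H x *v u x) \<bullet> w x + (H x *v v x) \<bullet> w x)"
    unfolding ph_inner_def
    by (intro Bochner_Integration.integral_cong refl) (simp add: matrix_vector_right_distrib inner_add_left)
  also have "\<dots> = ph_inner a b H u w + ph_inner a b H v w"
    unfolding ph_inner_def
    by (rule Bochner_Integration.integral_add[OF ph_inner_integrable[OF u w] ph_inner_integrable[OF v w]])
  finally show "ph_inner a b H (u + v) w = ph_inner a b H u w + ph_inner a b H v w" .
next
  fix u :: "real \<Rightarrow> real^'d" assume "u \<in> L2 a b"
  note ph_inner_bounds(1)[OF this]
  moreover have "0 \<le> m * (LINT x|L. (norm (u x))\<^sup>2)"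
    using m_pos by (intro mult_nonneg_nonneg Bochner_Integration.integral_nonneg_AE AE_I2) auto
  ultimately show "0 \<le> ph_inner a b H u u" by linarith
qed

sublocale E: semi_inner_product "L2 a b" "ph_inner a b H" by (rule energy_space)

lemma energy_nrm: "E.nrm = ph_norm a b H"
  by (simp add: E.nrm_def ph_norm_def fun_eq_iff)

end

section \<open>The domain of the port-Hamiltonian operator\<close>

context port_hamiltonian
begin

text \<open>The state variable of \<open>u\<close> is the continuous representative \<open>v\<close> of \<open>H u\<close>. That the weak derivative chosen
  in the definition of the operator is square-integrable follows from the assumption on the value of
  the operator, since \<open>P1\<close> is invertible.\<close>
lemma domain_state:
  assumes u: "u \<in> ph_dom a b H W" and Au: "ph_op a b H P1 P0 u \<in> L2 a b"
  shows "\<exists>v g. primitive a b v g \<and> g \<in> L2 a b \<and> (AE x in L. H x *v u x = v x) \<and>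
    W *v vstack (v b) (v a) = 0 \<and> (AE x in L. ph_op a b H P1 P0 u x = P1 *v g x + P0 *v v x)"
proof -
  define w where "w = (\<lambda>x. H x *v u x)"
  define g where "g = weak_deriv a b w"
  have w: "w \<in> H1 a b" and bc: "W *v vstack (cont_rep a b w b) (cont_rep a b w a) = 0"
    using u by (auto simp: ph_dom_def w_def)
  have weak: "has_weak_deriv a b w g"
    using w unfolding g_def weak_deriv_def H1_def by (intro someI_ex[of "has_weak_deriv a b w"]) blast
  have w2: "w \<in> L2 a b" using w by (simp add: H1_def)
  have op: "ph_op a b H P1 P0 u x = P1 *v g x + P0 *v w x" for x
    by (simp add: ph_op_def g_def w_def)
  have "(\<lambda>x. matrix_inv P1 *v (ph_op a b H P1 P0 u x - P0 *v w x)) \<in> L2 a b"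
    by (intro L2_linear[OF matrix_vector_mul_bounded_linear] L2_diff Au w2)
  then have g2: "g \<in> L2 a b" by (simp add: op matrix_inv_vector[OF P1_inv])
  obtain v where v: "primitive a b v g" "AE x in L. w x = v x"
    using weak_deriv_imp_primitive[OF ab weak L2_absolutely_integrable[OF w2] L2_absolutely_integrable[OF g2]] by blast
  have "cont_rep a b w x = v x" if "x \<in> {a..b}" for x
    by (rule cont_rep_eq[OF ab primitive_continuous[OF v(1)] v(2) that])
  then have "W *v vstack (v b) (v a) = 0" using bc ab by simp
  moreover have "AE x in L. ph_op a b H P1 P0 u x = P1 *v g x + P0 *v v x"
    using v(2) by (rule eventually_mono) (simp add: op)
  moreover have "AE x in L. H x *v u x = v x" using v(2) by (simp add: w_def)
  ultimately show ?thesis using v(1) g2 by blast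
qed

text \<open>The converse passage. The value of the operator is only determined almost everywhere, because the
  weak derivative in its definition is an arbitrary one.\<close>
lemma state_domain:
  assumes v: "primitive a b v g" and g: "g \<in> L2 a b" and bc: "W *v vstack (v b) (v a) = 0"
  defines "u \<equiv> \<lambda>x. Hinv x *v v x"
  shows "u \<in> ph_dom a b H W"
    and "ph_op a b H P1 P0 u \<in> L2 a b \<Longrightarrow> AE x in L. ph_op a b H P1 P0 u x = P1 *v g x + P0 *v v x"
proof -
  note cont = primitive_continuous[OF v]
  have Hu: "H x *v u x = v x" if "x \<in> {a<..<b}" for x using H_Hinv[OF that] by (simp add: u_def)
  have AE_Hu: "AE x in L. H x *v u x = v x" using Hu by (intro AE_I2) simp
  have u2: "u \<in> L2 a b" unfolding u_def by (rule Hinv_L2[OF continuous_L2[OF cont]])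
  have "has_weak_deriv a b (\<lambda>x. H x *v u x) g"
    by (rule primitive_imp_weak_deriv[OF v ab]) (auto simp: Hu)
  then have "(\<lambda>x. H x *v u x) \<in> H1 a b" using g H_L2[OF u2] unfolding H1_def by blast
  moreover have "W *v vstack (cont_rep a b (\<lambda>x. H x *v u x) b) (cont_rep a b (\<lambda>x. H x *v u x) a) = 0"
    using bc ab by (simp only: cont_rep_eq[OF ab cont AE_Hu] atLeastAtMost_iff order_refl less_imp_le)
  ultimately show dom: "u \<in> ph_dom a b H W" using u2 unfolding ph_dom_def by blast
  assume "ph_op a b H P1 P0 u \<in> L2 a b"
  then obtain v' g' where v': "primitive a b v' g'" "AE x in L. H x *v u x = v' x"
    "AE x in L. ph_op a b H P1 P0 u x = P1 *v g' x + P0 *v v' x"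
    using domain_state[OF dom] by blast
  have "AE x in L. v x = v' x" using AE_Hu v'(2) by eventually_elim simp
  then have eq: "v x = v' x" if "x \<in> {a..b}" for x
    by (rule continuous_AE_eq_imp_eq[OF ab cont primitive_continuous[OF v'(1)] _ that])
  have "primitive a b v g'" by (rule primitive_cong[OF v'(1)]) (auto simp: eq)
  from primitive_derivative_unique[OF v this] v'(3) \<open>AE x in L. v x = v' x\<close>
  show "AE x in L. ph_op a b H P1 P0 u x = P1 *v g x + P0 *v v x" by eventually_elim simp
qed

lemma pair_nrm_bounds:
  assumes "r \<in> L2 a b" "s \<in> L2 a b"
  shows "m * (LINT x|L. (norm (vec_Complex (r x) (s x)))\<^sup>2)
        \<le> (semi_inner_product.nrm (pair_form (ph_inner a b H)) (r, s))\<^sup>2"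
    and "(semi_inner_product.nrm (pair_form (ph_inner a b H)) (r, s))\<^sup>2
        \<le> M0 * (LINT x|L. (norm (vec_Complex (r x) (s x)))\<^sup>2)"
proof -
  have split: "(LINT x|L. (norm (vec_Complex (r x) (s x)))\<^sup>2) = (LINT x|L. (norm (r x))\<^sup>2) + (LINT x|L. (norm (s x))\<^sup>2)"
  proof -
    have "(LINT x|L. (norm (r x))\<^sup>2 + (norm (s x))\<^sup>2) = (LINT x|L. (norm (r x))\<^sup>2) + (LINT x|L. (norm (s x))\<^sup>2)"
      using assms by (intro Bochner_Integration.integral_add) (simp_all add: L2_def)
    then show ?thesis by (simp only: norm_vec_complex_power2 vec_Re_Im_Complex)
  qed
  have nrm: "(semi_inner_product.nrm (pair_form (ph_inner a b H)) (r, s))\<^sup>2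
      = ph_inner a b H r r + ph_inner a b H s s"
    unfolding E.pair_nrm_power2[OF assms] by (simp only: E.nrm_power2 assms)
  show "m * (LINT x|L. (norm (vec_Complex (r x) (s x)))\<^sup>2)
        \<le> (semi_inner_product.nrm (pair_form (ph_inner a b H)) (r, s))\<^sup>2"
    "(semi_inner_product.nrm (pair_form (ph_inner a b H)) (r, s))\<^sup>2
        \<le> M0 * (LINT x|L. (norm (vec_Complex (r x) (s x)))\<^sup>2)"
    unfolding split nrm distrib_left
    using ph_inner_bounds[OF assms(1)] ph_inner_bounds[OF assms(2)] by linarith+
qed

end

context port_hamiltonian
begin

text \<open>Every function \<open>H\<inverse> v\<close> with a primitive \<open>v\<close> that vanishes at both end points belongs to the domain.\<close>
lemma domain_dense:
  assumes u: "u \<in> L2 a b" and e: "e > 0"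
  shows "\<exists>w\<in>ph_dom a b H W. E.nrm (u - w) < e"
proof -
  let ?c = "M0 / m\<^sup>2"
  have c: "?c > 0" using M0_pos m_pos by simp
  have pos: "e\<^sup>2 / ?c > 0" by (rule divide_pos_pos[OF _ c]) (use e in simp)
  obtain v g where v: "primitive a b v g" "g \<in> L2 a b" "v a = 0" "v b = 0"
    "(LINT x|L. (norm (H x *v u x - v x))\<^sup>2) < e\<^sup>2 / ?c"
    by (rule L2_dense_primitives[OF H_L2[OF u] pos]) (rule that; assumption)
  define w where "w = (\<lambda>x. Hinv x *v v x)"
  have bc: "W *v vstack (v b) (v a) = 0"
  proof -
    have "vstack (v b) (v a) = 0" by (simp add: v(3,4) vstack_def vec_eq_iff split: sum.split)
    then show ?thesis by simp
  qed
  have dom: "w \<in> ph_dom a b H W" unfolding w_def by (rule state_domain(1)[OF v(1,2) bc])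
  have wL: "w \<in> L2 a b" using dom by (simp add: ph_dom_def)
  have vL: "v \<in> L2 a b" by (rule continuous_L2[OF primitive_continuous[OF v(1)]])
  have dL: "u - w \<in> L2 a b" using u wL by simp
  have "(LINT x|L. (norm ((u - w) x))\<^sup>2) \<le> (LINT x|L. (1 / m)\<^sup>2 * (norm (H x *v u x - v x))\<^sup>2)"
  proof (rule integral_mono)
    show "integrable L (\<lambda>x. (norm ((u - w) x))\<^sup>2)" using dL by (simp add: L2_def)
    show "integrable L (\<lambda>x. (1 / m)\<^sup>2 * (norm (H x *v u x - v x))\<^sup>2)"
      using L2_diff[OF H_L2[OF u] vL] by (simp add: L2_def)
    fix x assume "x \<in> space L"
    then have x: "x \<in> {a<..<b}" by simp
    have "(u - w) x = Hinv x *v (H x *v u x - v x)"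
      by (simp add: w_def matrix_vector_mult_diff_distrib Hinv_H[OF x])
    then have "norm ((u - w) x) \<le> 1 / m * norm (H x *v u x - v x)" using Hinv_norm[OF x, of "H x *v u x - v x"] by simp
    then have "(norm ((u - w) x))\<^sup>2 \<le> (1 / m * norm (H x *v u x - v x))\<^sup>2" by (intro power_mono) auto
    then show "(norm ((u - w) x))\<^sup>2 \<le> (1 / m)\<^sup>2 * (norm (H x *v u x - v x))\<^sup>2" by (simp only: power_mult_distrib)
  qed
  then have "M0 * (LINT x|L. (norm ((u - w) x))\<^sup>2) \<le> M0 * ((1 / m)\<^sup>2 * (LINT x|L. (norm (H x *v u x - v x))\<^sup>2))"
    using M0_pos by (intro mult_left_mono) simp_all
  then have "(E.nrm (u - w))\<^sup>2 \<le> ?c * (LINT x|L. (norm (H x *v u x - v x))\<^sup>2)"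
    using ph_inner_bounds(2)[OF dL] E.nrm_power2[OF dL] by (simp add: power_divide)
  also have "\<dots> < ?c * (e\<^sup>2 / ?c)" using v(5) c by (rule mult_strict_left_mono)
  also have "\<dots> = e\<^sup>2" using M0_pos m_pos by simp
  finally have "E.nrm (u - w) < e" by (rule power2_less_imp_less) (use e in auto)
  then show ?thesis using dom by blast
qed

end

section \<open>The fundamental solutions\<close>

locale port_hamiltonian_flow = port_hamiltonian a b m M0 P1 P0 H
  for a b m M0 :: real and P1 P0 :: "real^'d^'d" and H :: "real \<Rightarrow> real^'d^'d" +
  fixes \<Phi> :: "real \<Rightarrow> real \<Rightarrow> complex^'d^'d" and K :: real
  assumes fund: "fundamental_solution a b (ph_coeff H P1 P0 t) (\<Phi> t)"
    and flow_bound: "x \<in> {a<..<b} \<Longrightarrow> op_norm (\<Phi> t x) \<le> K" and K_pos: "0 < K"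
begin

abbreviation solves where
  "solves t v f \<equiv> primitive a b v (\<lambda>x. ph_coeff H P1 P0 t x *v v x - cmat (matrix_inv P1) *v f x)"

lemma coeff_bound:
  obtains C where "\<And>x z. x \<in> {a<..<b} \<Longrightarrow> norm (ph_coeff H P1 P0 t x *v z) \<le> C * norm z" "C > 0"
proof -
  obtain k1 where k1: "k1 > 0" "\<And>z. norm (cmat (matrix_inv P1) *v z) \<le> norm z * k1"
    using bounded_linear.pos_bounded[OF matrix_vector_mul_bounded_linear] by blast
  obtain k0 where k0: "k0 > 0" "\<And>z. norm (cmat P0 *v z) \<le> norm z * k0"
    using bounded_linear.pos_bounded[OF matrix_vector_mul_bounded_linear] by blast
  show thesis
  proof (rule that)
    fix x and z :: "complex^'d" assume x: "x \<in> {a<..<b}"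
    have 1: "norm (cmat (Hinv x) *v z) \<le> norm z / m"
    proof (rule power2_le_imp_le)
      have "(norm (cmat (Hinv x) *v z))\<^sup>2 = (norm (Hinv x *v vec_Re z))\<^sup>2 + (norm (Hinv x *v vec_Im z))\<^sup>2"
        by (simp add: norm_vec_complex_power2[of "cmat (Hinv x) *v z"])
      also have "\<dots> \<le> (norm (vec_Re z) / m)\<^sup>2 + (norm (vec_Im z) / m)\<^sup>2"
        by (intro add_mono power_mono Hinv_norm x) auto
      also have "\<dots> = (norm z / m)\<^sup>2"
        by (simp add: power_divide norm_vec_complex_power2[of z] add_divide_distrib)
      finally show "(norm (cmat (Hinv x) *v z))\<^sup>2 \<le> (norm z / m)\<^sup>2" .
    qed (use m_pos in auto)
    have 2: "norm (mat (\<i> * complex_of_real t) *v w) = \<bar>t\<bar> * norm w" for w :: "complex^'d"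
    proof -
      have "(norm (mat (\<i> * complex_of_real t) *v w))\<^sup>2 = (\<bar>t\<bar> * norm w)\<^sup>2"
        by (simp add: norm_vec_complex_power2 power_mult_distrib distrib_left del: abs_mult)
      then show ?thesis by (metis abs_ge_zero mult_nonneg_nonneg norm_ge_zero power2_eq_iff_nonneg)
    qed
    have "norm (ph_coeff H P1 P0 t x *v z)
        \<le> norm (mat (\<i> * complex_of_real t) *v (cmat (Hinv x) *v z) - cmat P0 *v z) * k1"
      unfolding coeff_vector by (rule k1)
    also have "\<dots> \<le> (\<bar>t\<bar> * (norm z / m) + norm z * k0) * k1"
    proof (intro mult_right_mono norm_triangle_le_diff add_mono)
      show "norm (mat (\<i> * complex_of_real t) *v (cmat (Hinv x) *v z)) \<le> \<bar>t\<bar> * (norm z / m)"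
        unfolding 2 by (intro mult_left_mono 1) auto
    qed (use k0 k1 in auto)
    also have "\<dots> = ((\<bar>t\<bar> / m + k0) * k1) * norm z" by (simp add: algebra_simps)
    finally show "norm (ph_coeff H P1 P0 t x *v z) \<le> ((\<bar>t\<bar> / m + k0) * k1) * norm z" .
  qed (use k0 k1 m_pos in \<open>auto intro!: mult_pos_pos add_nonneg_pos\<close>)
qed

lemma flow_continuous: "continuous_on {a..b} (\<Phi> t)"
  using fund abs_continuous_on_imp_continuous_on unfolding fundamental_solution_def by blast

lemma flow_start: "\<Phi> t a = mat 1"
  using fund unfolding fundamental_solution_def by blast

lemma flow_upper:
  assumes x: "x \<in> {a..b}"
  shows "norm (\<Phi> t x *v z) \<le> K * norm z"
proof -
  have clo: "closure {a<..<b} = {a..b}" using ab by simp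
  have "continuous_on (closure {a<..<b}) (\<lambda>x. \<Phi> t x *v z)"
    unfolding clo by (intro bounded_linear.continuous_on[OF bounded_linear_matrix_eval] flow_continuous)
  moreover have "\<forall>y\<in>{a<..<b}. norm (\<Phi> t y *v z) \<le> K * norm z"
    using op_norm_bound flow_bound by (meson mult_right_mono norm_ge_zero order_trans)
  ultimately show ?thesis
    using x unfolding clo[symmetric] by (rule continuous_on_closure_norm_le)
qed

lemma flow_primitive: "primitive a b (\<Phi> t) (\<lambda>x. ph_coeff H P1 P0 t x ** \<Phi> t x)"
proof -
  let ?g = "\<lambda>x. ph_coeff H P1 P0 t x ** \<Phi> t x"
  have weak: "has_weak_deriv a b (\<Phi> t) ?g" using fund unfolding fundamental_solution_def by blast
  obtain C where C: "\<And>x z. x \<in> {a<..<b} \<Longrightarrow> norm (ph_coeff H P1 P0 t x *v z) \<le> C * norm z" "C > 0"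
    using coeff_bound[where t = t] by metis
  have "norm (?g x) \<le> real CARD('d) * real CARD('d) * (C * K)" if x: "x \<in> {a<..<b}" for x
  proof (rule norm_matrix_le_columns)
    fix z
    have "norm (?g x *v z) = norm (ph_coeff H P1 P0 t x *v (\<Phi> t x *v z))"
      by (simp add: matrix_vector_mul_assoc)
    also have "\<dots> \<le> C * (K * norm z)"
      using C flow_upper[of x t z] x by (intro order_trans[OF C(1)[OF x]] mult_left_mono) auto
    finally show "norm (?g x *v z) \<le> C * K * norm z" by simp
  qed
  then have "?g absolutely_integrable_on {a..b}"
    using weak unfolding has_weak_deriv_def by (intro locally_integrable_bounded(1)) auto
  then obtain v where v: "primitive a b v ?g" "AE x in L. \<Phi> t x = v x"
    using weak_deriv_imp_primitive[OF ab weak absolutely_integrable_continuous_real[OF flow_continuous]] by blast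
  have "\<Phi> t x = v x" if "x \<in> {a..b}" for x
    by (rule continuous_AE_eq_imp_eq[OF ab flow_continuous primitive_continuous[OF v(1)] v(2) that])
  then show ?thesis by (intro primitive_cong[OF v(1)]) auto
qed

lemma flow_vector_primitive:
  "primitive a b (\<lambda>x. \<Phi> t x *v c) (\<lambda>x. ph_coeff H P1 P0 t x *v (\<Phi> t x *v c))"
proof -
  show ?thesis
    using primitive_linear[OF bounded_linear_matrix_eval flow_primitive] by (simp add: matrix_vector_mul_assoc)
qed

text \<open>\<open>(M y) \<bullet> (P1 v) + y \<bullet> (P1 (M v)) = 0\<close>, since \<open>P1 M = \<i>t H\<inverse> - P0\<close> is skew-adjoint; what remains of the
  product rule is the contribution of the inhomogeneity.\<close>
lemma energy_identity:
  assumes v: "solves t v f"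
  shows "primitive a b (\<lambda>x. (\<Phi> t x *v c) \<bullet> (cmat P1 *v v x)) (\<lambda>x. - ((\<Phi> t x *v c) \<bullet> f x))"
proof (rule primitive_cong[OF primitive_product[OF bounded_bilinear_inner flow_vector_primitive
        primitive_linear[OF matrix_vector_mul_bounded_linear v]]])
  fix x assume x: "x \<in> {a<..<b}"
  let ?y = "\<Phi> t x *v c"
  have P1i: "(matrix_inv P1 *v p) \<bullet> (P1 *v q) = p \<bullet> q" for p q
    using inner_symmetric_matrix[OF P1_sym, of "matrix_inv P1 *v p" q] by (simp add: matrix_inv_vector[OF P1_inv])
  have skew: "(P0 *v p) \<bullet> q = - (p \<bullet> (P0 *v q))" for p q
    using inner_transpose_matrix[of P0 p q] unfolding P0_skew
    by (simp add: matrix_vector_mult_def inner_vec_def sum_negf)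
  have "(ph_coeff H P1 P0 t x *v ?y) \<bullet> (cmat P1 *v v x)
      = (- t *\<^sub>R (Hinv x *v vec_Im ?y) - P0 *v vec_Re ?y) \<bullet> vec_Re (v x)
      + (t *\<^sub>R (Hinv x *v vec_Re ?y) - P0 *v vec_Im ?y) \<bullet> vec_Im (v x)"
    by (simp add: inner_vec_complex coeff_vector P1i)
  moreover have "cmat P1 *v (ph_coeff H P1 P0 t x *v v x - cmat (matrix_inv P1) *v f x)
      = mat (\<i> * complex_of_real t) *v (cmat (Hinv x) *v v x) - cmat P0 *v v x - f x"
    unfolding coeff_vector by (simp only: matrix_vector_mult_diff_distrib cmat_inverse_vector[OF P1_inv])
  moreover have "?y \<bullet> (mat (\<i> * complex_of_real t) *v (cmat (Hinv x) *v v x) - cmat P0 *v v x - f x)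
      = vec_Re ?y \<bullet> (- t *\<^sub>R (Hinv x *v vec_Im (v x)) - P0 *v vec_Re (v x))
      + vec_Im ?y \<bullet> (t *\<^sub>R (Hinv x *v vec_Re (v x)) - P0 *v vec_Im (v x)) - ?y \<bullet> f x"
    by (simp add: inner_vec_complex inner_diff_right)
  ultimately show "- (?y \<bullet> f x) = (ph_coeff H P1 P0 t x *v ?y) \<bullet> (cmat P1 *v v x)
      + ?y \<bullet> (cmat P1 *v (ph_coeff H P1 P0 t x *v v x - cmat (matrix_inv P1) *v f x))"
    by (simp add: inner_diff_left inner_diff_right skew Hinv_inner[OF x])
qed simp

lemma P1_bounds:
  obtains n1 n2 where "n1 > 0" "n2 > 0" "\<And>z. norm (cmat P1 *v z) \<le> n1 * norm z"
    "\<And>z. norm z \<le> n2 * norm (cmat P1 *v z)"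
proof -
  obtain n1 where n1: "n1 > 0" "\<And>z. norm (cmat P1 *v z) \<le> norm z * n1"
    using bounded_linear.pos_bounded[OF matrix_vector_mul_bounded_linear] by blast
  obtain n2 where n2: "n2 > 0" "\<And>z. norm (cmat (matrix_inv P1) *v z) \<le> norm z * n2"
    using bounded_linear.pos_bounded[OF matrix_vector_mul_bounded_linear] by blast
  show thesis
  proof (rule that[OF n1(1) n2(1)])
    show "norm (cmat P1 *v z) \<le> n1 * norm z" for z using n1(2)[of z] by (simp add: mult.commute)
    show "norm z \<le> n2 * norm (cmat P1 *v z)" for z
      using n2(2)[of "cmat P1 *v z"] by (simp add: mult.commute cmat_inverse_vector[OF P1_inv])
  qed
qed

text \<open>Without inhomogeneity \<open>(\<Phi> c) \<bullet> (P1 (\<Phi> z)) = c \<bullet> (P1 z)\<close> along the interval. For \<open>c = P1 z\<close> the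
  right-hand side is \<open>\<parallel>P1 z\<parallel>\<^sup>2\<close>, and the left-hand side is bounded by the upper bound on \<open>\<Phi> c\<close>.\<close>
lemma flow_lower:
  obtains \<kappa> where "\<kappa> > 0" "\<And>t x z. x \<in> {a..b} \<Longrightarrow> norm z \<le> \<kappa> * norm (\<Phi> t x *v z)"
proof -
  obtain n1 n2 where n: "n1 > 0" "n2 > 0" "\<And>z. norm (cmat P1 *v z) \<le> n1 * norm z"
    "\<And>z. norm z \<le> n2 * norm (cmat P1 *v z)" using P1_bounds by metis
  show thesis
  proof (rule that[of "n2 * (K * n1)"])
    fix t x and z :: "complex^'d" assume x: "x \<in> {a..b}"
    let ?p = "cmat P1 *v z"
    have "primitive a b (\<lambda>x. \<Phi> t x *v z) (\<lambda>x. ph_coeff H P1 P0 t x *v (\<Phi> t x *v z) - cmat (matrix_inv P1) *v 0)"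
      using flow_vector_primitive by simp
    from primitiveD[OF energy_identity[OF this] x, of ?p]
    have "(norm ?p)\<^sup>2 = (\<Phi> t x *v ?p) \<bullet> (cmat P1 *v (\<Phi> t x *v z))"
      by (simp add: flow_start power2_norm_eq_inner)
    also have "\<dots> \<le> norm (\<Phi> t x *v ?p) * norm (cmat P1 *v (\<Phi> t x *v z))" by (rule norm_cauchy_schwarz)
    also have "\<dots> \<le> (K * norm ?p) * (n1 * norm (\<Phi> t x *v z))"
      using flow_upper[OF x] n K_pos by (intro mult_mono) auto
    finally have "norm ?p * norm ?p \<le> norm ?p * (K * n1 * norm (\<Phi> t x *v z))"
      by (simp add: power2_eq_square mult_ac)
    then have "norm ?p \<le> K * n1 * norm (\<Phi> t x *v z)"
      using n K_pos by (cases "norm ?p = 0") auto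
    then have "n2 * norm ?p \<le> n2 * (K * n1 * norm (\<Phi> t x *v z))" using n by (intro mult_left_mono) auto
    then show "norm z \<le> n2 * (K * n1) * norm (\<Phi> t x *v z)"
      using n(4)[of z] by (simp add: mult.assoc)
  qed (intro mult_pos_pos n K_pos)
qed

lemma flow_invertible: "x \<in> {a..b} \<Longrightarrow> invertible (\<Phi> t x)"
proof (rule injective_bound_imp_invertible)
  fix z assume x: "x \<in> {a..b}" and z: "\<Phi> t x *v z = 0"
  obtain \<kappa> where "\<And>t x z. x \<in> {a..b} \<Longrightarrow> norm z \<le> \<kappa> * norm (\<Phi> t x *v z)" using flow_lower by metis
  from this[OF x, of z t] show "z = 0" using z by simp
qed

text \<open>By duality: the energy identity with \<open>c\<close> chosen such that \<open>\<Phi> t x c = P1 (v x)\<close> computes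
  \<open>\<parallel>P1 (v x)\<parallel>\<^sup>2\<close>. This takes the place of the variation of constants formula.\<close>
lemma solution_growth:
  "\<exists>C>0. \<forall>t v f. solves t v f
      \<longrightarrow> f absolutely_integrable_on {a..b}
      \<longrightarrow> (\<forall>x\<in>{a..b}. norm (v x) \<le> C * (norm (v a) + integral {a..b} (\<lambda>x. norm (f x))))"
proof -
  obtain n1 n2 where n: "n1 > 0" "n2 > 0" "\<And>z. norm (cmat P1 *v z) \<le> n1 * norm z"
    "\<And>z. norm z \<le> n2 * norm (cmat P1 *v z)" using P1_bounds by metis
  obtain \<kappa> where \<kappa>: "\<kappa> > 0" "\<And>t x z. x \<in> {a..b} \<Longrightarrow> norm z \<le> \<kappa> * norm (\<Phi> t x *v z)"
    using flow_lower by metis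
  show ?thesis
  proof (intro exI[of _ "n2 * (\<kappa> * n1 + K * \<kappa>)"] conjI allI impI ballI)
    fix t and v f :: "real \<Rightarrow> complex^'d" and x
    assume v: "solves t v f"
      and f: "f absolutely_integrable_on {a..b}" and x: "x \<in> {a..b}"
    let ?p = "cmat P1 *v v x" and ?I = "integral {a..b} (\<lambda>x. norm (f x))"
    let ?c = "matrix_inv (\<Phi> t x) *v ?p"
    have c: "\<Phi> t x *v ?c = ?p" by (rule matrix_inv_vector(1)[OF flow_invertible[OF x]])
    have c_le: "norm ?c \<le> \<kappa> * norm ?p" using \<kappa>(2)[OF x, of ?c t] by (simp add: c)
    note en = energy_identity[OF v, of ?c]
    have nf: "(\<lambda>x. norm (f x)) integrable_on {a..b}" using f by (simp add: absolutely_integrable_on_def)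
    have nfx: "(\<lambda>x. norm (f x)) integrable_on {a..x}"
      using x by (intro integrable_subinterval_real[OF nf]) auto
    have "norm (integral {a..x} (\<lambda>s. - ((\<Phi> t s *v ?c) \<bullet> f s))) \<le> integral {a..x} (\<lambda>s. K * norm ?c * norm (f s))"
    proof (rule integral_norm_bound_integral)
      show "(\<lambda>s. - ((\<Phi> t s *v ?c) \<bullet> f s)) integrable_on {a..x}" by (rule primitive_integrable[OF en x])
      show "(\<lambda>s. K * norm ?c * norm (f s)) integrable_on {a..x}" by (intro integrable_on_mult_right nfx)
      fix s assume s: "s \<in> {a..x}"
      have "norm (- ((\<Phi> t s *v ?c) \<bullet> f s)) \<le> norm (\<Phi> t s *v ?c) * norm (f s)"
        using Cauchy_Schwarz_ineq2[of "\<Phi> t s *v ?c" "f s"] by simp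
      also have "\<dots> \<le> K * norm ?c * norm (f s)"
        using flow_upper[of s t ?c] s x by (intro mult_right_mono) auto
      finally show "norm (- ((\<Phi> t s *v ?c) \<bullet> f s)) \<le> K * norm ?c * norm (f s)" .
    qed
    also have "\<dots> = K * norm ?c * integral {a..x} (\<lambda>s. norm (f s))" by simp
    also have "\<dots> \<le> K * norm ?c * ?I"
      using x K_pos nf nfx by (intro mult_left_mono integral_subset_le) auto
    finally have int: "norm (integral {a..x} (\<lambda>s. - ((\<Phi> t s *v ?c) \<bullet> f s))) \<le> K * norm ?c * ?I" .
    have I0: "?I \<ge> 0" by (rule integral_nonneg[OF nf]) auto
    have "(norm ?p)\<^sup>2 = ?c \<bullet> (cmat P1 *v v a) + integral {a..x} (\<lambda>s. - ((\<Phi> t s *v ?c) \<bullet> f s))"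
      using primitiveD[OF en x] by (simp add: c flow_start power2_norm_eq_inner)
    also have "\<dots> \<le> norm ?c * (n1 * norm (v a)) + K * norm ?c * ?I"
    proof (rule add_mono)
      show "?c \<bullet> (cmat P1 *v v a) \<le> norm ?c * (n1 * norm (v a))"
        using n(3)[of "v a"] by (intro order_trans[OF norm_cauchy_schwarz] mult_left_mono) auto
      show "integral {a..x} (\<lambda>s. - ((\<Phi> t s *v ?c) \<bullet> f s)) \<le> K * norm ?c * ?I"
        using int by (simp only: real_norm_def abs_le_iff)
    qed
    also have "\<dots> = norm ?c * (n1 * norm (v a) + K * ?I)" by (simp add: algebra_simps)
    also have "\<dots> \<le> \<kappa> * norm ?p * (n1 * norm (v a) + K * ?I)"
      using c_le n K_pos I0 by (intro mult_right_mono add_nonneg_nonneg mult_nonneg_nonneg) auto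
    finally have "norm ?p * norm ?p \<le> norm ?p * (\<kappa> * (n1 * norm (v a) + K * ?I))"
      by (simp add: power2_eq_square mult_ac)
    then have "norm ?p \<le> \<kappa> * (n1 * norm (v a) + K * ?I)"
      using \<kappa>(1) n(1) K_pos I0 by (cases "norm ?p = 0") auto
    also have "\<dots> \<le> (\<kappa> * n1 + K * \<kappa>) * (norm (v a) + ?I)"
      using \<kappa>(1) n(1) K_pos I0 by (simp add: algebra_simps)
    finally have "n2 * norm ?p \<le> n2 * ((\<kappa> * n1 + K * \<kappa>) * (norm (v a) + ?I))"
      using n(2) by (intro mult_left_mono) auto
    then show "norm (v x) \<le> n2 * (\<kappa> * n1 + K * \<kappa>) * (norm (v a) + ?I)"
      using n(4)[of "v x"] by (simp add: mult.assoc)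
  qed (intro mult_pos_pos add_pos_pos n \<kappa> K_pos)
qed

end

section \<open>The transfer matrix and the resolvent\<close>

context port_hamiltonian_flow
begin

abbreviation transfer where "transfer W t \<equiv> cmat W ** vstack (\<Phi> t b) (mat 1)"
abbreviation cnrm where "cnrm \<equiv> semi_inner_product.nrm (pair_form (ph_inner a b H))"
abbreviation Aop where "Aop \<equiv> ph_op a b H P1 P0"

lemma transfer_vector: "transfer W t *v c = cmat W *v vstack (\<Phi> t b *v c) c"
  by (simp add: vstack_vector flip: matrix_vector_mul_assoc)

text \<open>Subtracting \<open>\<Phi> (v a)\<close> leaves a solution \<open>w\<close> with \<open>w a = 0\<close>, which is bounded by \<open>f\<close>; the boundary
  condition then reads \<open>T (v a) = - W (w b; 0)\<close>.\<close>
lemma transfer_bound_imp_state_bound: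
  assumes \<tau>: "\<tau> \<ge> 0" "\<And>t c. norm c \<le> \<tau> * norm (transfer W t *v c)"
  shows "\<exists>C>0. \<forall>t v f. solves t v f
      \<longrightarrow> f absolutely_integrable_on {a..b} \<longrightarrow> cmat W *v vstack (v b) (v a) = 0
      \<longrightarrow> (\<forall>x\<in>{a..b}. norm (v x) \<le> C * integral {a..b} (\<lambda>x. norm (f x)))"
proof -
  obtain C where C_pos: "C > 0" and "\<forall>t v f.
      solves t v f
      \<longrightarrow> f absolutely_integrable_on {a..b}
      \<longrightarrow> (\<forall>x\<in>{a..b}. norm (v x) \<le> C * (norm (v a) + integral {a..b} (\<lambda>x. norm (f x))))"
    using solution_growth by (elim exE conjE)
  note C = C_pos this(2)[rule_format]
  obtain nW where nW: "nW > 0" "\<And>z. norm (cmat W *v z) \<le> norm z * nW"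
    using bounded_linear.pos_bounded[OF matrix_vector_mul_bounded_linear] by blast
  show ?thesis
  proof (intro exI[of _ "C * (\<tau> * (C * nW) + 1)"] conjI allI impI ballI)
    show "C * (\<tau> * (C * nW) + 1) > 0" using C(1) nW(1) \<tau>(1) by (intro mult_pos_pos add_nonneg_pos) auto
    fix t and v f :: "real \<Rightarrow> complex^'d" and x
    assume v: "solves t v f"
      and f: "f absolutely_integrable_on {a..b}" and bc: "cmat W *v vstack (v b) (v a) = 0" and x: "x \<in> {a..b}"
    define I where "I = integral {a..b} (\<lambda>x. norm (f x))"
    define w where "w = (\<lambda>x. v x - \<Phi> t x *v v a)"
    have w_prim: "solves t w f"
      using primitive_diff[OF v flow_vector_primitive[of t "v a"]]
      by (simp add: w_def matrix_vector_mult_diff_distrib diff_diff_eq add.commute)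
    have wa: "w a = 0" by (simp add: w_def flow_start)
    have wb: "norm (w b) \<le> C * I"
      using C(2)[OF w_prim f, of b] ab by (simp add: wa I_def)
    have "vstack (v b) (v a) = vstack (\<Phi> t b *v v a) (v a) + vstack (w b) 0"
      by (simp add: vstack_add w_def)
    then have "transfer W t *v v a = - (cmat W *v vstack (w b) 0)"
      using bc by (simp add: transfer_vector matrix_vector_right_distrib eq_neg_iff_add_eq_0)
    then have "norm (transfer W t *v v a) \<le> norm (w b) * nW"
      using nW(2)[of "vstack (w b) 0"] by (simp add: norm_vstack_zero)
    also have "\<dots> \<le> C * I * nW" using wb nW(1) by (intro mult_right_mono) auto
    finally have "\<tau> * norm (transfer W t *v v a) \<le> \<tau> * (C * I * nW)"
      using \<tau>(1) by (intro mult_left_mono) auto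
    then have "norm (v a) \<le> \<tau> * (C * I * nW)" using \<tau>(2)[of "v a" t] by linarith
    then have "C * (norm (v a) + I) \<le> C * (\<tau> * (C * I * nW) + I)" using C(1) by (intro mult_left_mono) auto
    also have "\<dots> = C * (\<tau> * (C * nW) + 1) * I" by (simp add: algebra_simps)
    finally show "norm (v x) \<le> C * (\<tau> * (C * nW) + 1) * integral {a..b} (\<lambda>x. norm (f x))"
      using C(2)[OF v f x] by (simp add: I_def)
  qed
qed

text \<open>With \<open>f = (\<i>t - A)u\<close> the state variable of \<open>u\<close> solves the inhomogeneous equation and satisfies the
  boundary condition, so it is bounded pointwise by the integral of \<open>f\<close>.\<close>
lemma transfer_bound_imp_resolvent_bound:
  assumes \<tau>: "\<tau> \<ge> 0" "\<And>t c. norm c \<le> \<tau> * norm (transfer W t *v c)"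
  shows "\<exists>C>0. \<forall>t. \<forall>u1\<in>ph_dom a b H W. \<forall>u2\<in>ph_dom a b H W. Aop u1 \<in> L2 a b \<longrightarrow> Aop u2 \<in> L2 a b
      \<longrightarrow> cnrm (u1, u2) \<le> C * cnrm (cscale (\<i> * of_real t) (u1, u2) - (Aop u1, Aop u2))"
proof -
  obtain C where C_pos: "C > 0" and "\<forall>t v f.
      solves t v f
      \<longrightarrow> f absolutely_integrable_on {a..b} \<longrightarrow> cmat W *v vstack (v b) (v a) = 0
      \<longrightarrow> (\<forall>x\<in>{a..b}. norm (v x) \<le> C * integral {a..b} (\<lambda>x. norm (f x)))"
    using transfer_bound_imp_state_bound[OF \<tau>] by (elim exE conjE)
  note C = C_pos this(2)[rule_format]
  define D where "D = sqrt (M0 * (b - a)\<^sup>2 / m ^ 3) * C"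
  have D2: "D\<^sup>2 = M0 * (b - a)\<^sup>2 / m ^ 3 * C\<^sup>2" using M0_pos m_pos by (simp add: D_def power_mult_distrib)
  show ?thesis
  proof (intro exI[of _ D] conjI allI impI ballI)
    show Dpos: "D > 0" using C M0_pos m_pos ab by (simp add: D_def)
    fix t and u1 u2 :: "real \<Rightarrow> real^'d"
    assume u: "u1 \<in> ph_dom a b H W" "u2 \<in> ph_dom a b H W" and Au: "Aop u1 \<in> L2 a b" "Aop u2 \<in> L2 a b"
    obtain v1 g1 where v1: "primitive a b v1 g1" "g1 \<in> L2 a b" "AE x in L. H x *v u1 x = v1 x"
      "W *v vstack (v1 b) (v1 a) = 0" "AE x in L. Aop u1 x = P1 *v g1 x + P0 *v v1 x"
      using domain_state[OF u(1) Au(1)] by blast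
    obtain v2 g2 where v2: "primitive a b v2 g2" "g2 \<in> L2 a b" "AE x in L. H x *v u2 x = v2 x"
      "W *v vstack (v2 b) (v2 a) = 0" "AE x in L. Aop u2 x = P1 *v g2 x + P0 *v v2 x"
      using domain_state[OF u(2) Au(2)] by blast
    have uL: "u1 \<in> L2 a b" "u2 \<in> L2 a b" using u by (auto simp: ph_dom_def)
    define r1 where "r1 = (- t) *\<^sub>R u2 - Aop u1"
    define r2 where "r2 = t *\<^sub>R u1 - Aop u2"
    have r: "cscale (\<i> * of_real t) (u1, u2) - (Aop u1, Aop u2) = (r1, r2)"
      by (simp add: cscale_def r1_def r2_def)
    have rL: "r1 \<in> L2 a b" "r2 \<in> L2 a b" unfolding r1_def r2_def using uL Au by blast+
    define f where "f = (\<lambda>x. vec_Complex (r1 x) (r2 x))"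
    define v where "v = (\<lambda>x. vec_Complex (v1 x) (v2 x))"
    have fL: "f \<in> L2 a b" unfolding f_def by (rule L2_vec_Complex[OF rL])
    note f_abs = L2_absolutely_integrable[OF fL]
    have inD: "AE x in L. x \<in> {a<..<b}" by (rule AE_I2) simp
    have u_v: "AE x in L. u1 x = Hinv x *v v1 x \<and> u2 x = Hinv x *v v2 x"
      using inD v1(3) v2(3) by eventually_elim (metis Hinv_H)
    have "AE x in L. ph_coeff H P1 P0 t x *v v x - cmat (matrix_inv P1) *v f x = vec_Complex (g1 x) (g2 x)"
      using u_v v1(5) v2(5)
    proof eventually_elim
      case (elim x)
      then show ?case
        by (intro vec_complex_eqI)
          (simp_all add: coeff_vector v_def f_def r1_def r2_def scaleR_fun_def matrix_vector_mult_diff_distrib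
            matrix_vector_right_distrib matrix_inv_vector[OF P1_inv])
    qed
    then have v_prim: "solves t v f"
      unfolding v_def by (rule primitive_cong_AE[OF primitive_vec_Complex[OF v1(1) v2(1)]])
    have bc: "cmat W *v vstack (v b) (v a) = 0"
      by (rule vec_complex_eqI) (simp_all add: vec_Re_vstack vec_Im_vstack v_def v1(4) v2(4))
    define I where "I = integral {a..b} (\<lambda>x. norm (f x))"
    have nf: "(\<lambda>x. norm (f x)) absolutely_integrable_on {a..b}" by (rule absolutely_integrable_norm[OF f_abs, unfolded o_def])
    have I_eq: "I = (LINT x|L. norm (f x))" unfolding I_def using lebesgue_on_open_interval(2)[OF nf] by simp
    have I0: "I \<ge> 0" unfolding I_eq by simp
    have v_le: "norm (v x) \<le> C * I" if "x \<in> {a..b}" for x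
      unfolding I_def by (rule C(2)[OF v_prim f_abs bc that])
    have I2: "m * I\<^sup>2 \<le> (b - a) * (cnrm (r1, r2))\<^sup>2"
    proof -
      have "m * I\<^sup>2 \<le> m * ((b - a) * (LINT x|L. (norm (f x))\<^sup>2))"
        unfolding I_eq using m_pos by (intro mult_left_mono integral_norm_power2_le[OF ab fL]) auto
      also have "\<dots> = (b - a) * (m * (LINT x|L. (norm (f x))\<^sup>2))" by simp
      also have "\<dots> \<le> (b - a) * (cnrm (r1, r2))\<^sup>2"
        using pair_nrm_bounds(1)[OF rL] ab unfolding f_def by (intro mult_left_mono) auto
      finally show ?thesis .
    qed
    have "AE x in L. norm (vec_Complex (u1 x) (u2 x)) \<le> C * I / m"
      using inD u_v
    proof eventually_elim
      case (elim x)
      have "(norm (vec_Complex (u1 x) (u2 x)))\<^sup>2 \<le> (norm (v1 x) / m)\<^sup>2 + (norm (v2 x) / m)\<^sup>2"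
        using elim Hinv_norm[of x] by (auto simp: norm_vec_complex_power2 intro!: add_mono power_mono)
      also have "\<dots> = (norm (v x) / m)\<^sup>2"
        by (simp only: power_divide v_def norm_vec_complex_power2[of "vec_Complex (v1 x) (v2 x)"]
            vec_Re_Im_Complex add_divide_distrib)
      finally have "norm (vec_Complex (u1 x) (u2 x)) \<le> norm (v x) / m"
        by (rule power2_le_imp_le) (use m_pos in auto)
      also have "\<dots> \<le> C * I / m" using v_le[of x] elim m_pos by (intro divide_right_mono) auto
      finally show ?case .
    qed
    then have "(LINT x|L. (norm (vec_Complex (u1 x) (u2 x)))\<^sup>2) \<le> (b - a) * (C * I / m)\<^sup>2"
      using C(1) I0 m_pos by (intro integral_power2_le L2_vec_Complex uL) auto
    then have "M0 * (LINT x|L. (norm (vec_Complex (u1 x) (u2 x)))\<^sup>2) \<le> M0 * ((b - a) * (C * I / m)\<^sup>2)"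
      using M0_pos by (intro mult_left_mono) auto
    then have "(cnrm (u1, u2))\<^sup>2 \<le> M0 * ((b - a) * (C * I / m)\<^sup>2)"
      using pair_nrm_bounds(2)[OF uL] by linarith
    also have "\<dots> = (M0 * (b - a) / m ^ 3 * C\<^sup>2) * (m * I\<^sup>2)"
      using m_pos by (simp add: power2_eq_square power3_eq_cube field_simps)
    also have "\<dots> \<le> (M0 * (b - a) / m ^ 3 * C\<^sup>2) * ((b - a) * (cnrm (r1, r2))\<^sup>2)"
      using M0_pos m_pos ab by (intro mult_left_mono I2) auto
    also have "\<dots> = (D * cnrm (r1, r2))\<^sup>2"
      unfolding power_mult_distrib[of D] D2 by (simp add: power2_eq_square)
    finally have "(cnrm (u1, u2))\<^sup>2 \<le> (D * cnrm (r1, r2))\<^sup>2" .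
    moreover have "cnrm (r1, r2) \<ge> 0"
      using semi_inner_product.nrm_ge0[OF E.pair_space, of "(r1, r2)"] rL by simp
    ultimately have "cnrm (u1, u2) \<le> D * cnrm (r1, r2)"
      using Dpos by (intro power2_le_imp_le[of "cnrm (u1, u2)"]) auto
    then show "cnrm (u1, u2) \<le> D * cnrm (cscale (\<i> * of_real t) (u1, u2) - (Aop u1, Aop u2))"
      unfolding r .
  qed
qed

end

context port_hamiltonian_flow
begin

text \<open>For a vector \<open>c\<close> let \<open>h = (h1; h0)\<close> satisfy \<open>W h = T c\<close>. The function \<open>\<Phi> (h0 + s k)\<close>, where \<open>s\<close> grows
  linearly from \<open>0\<close> to \<open>1\<close> and \<open>k\<close> is such that the value at \<open>b\<close> is \<open>h1\<close>, has the boundary values of \<open>h\<close>.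
  Hence \<open>v = \<Phi> (c - h0 - s k)\<close> satisfies the boundary condition, and it solves the inhomogeneous
  equation with \<open>f = P1 (\<Phi> k)/(b - a)\<close>. The resolvent bound estimates \<open>v\<close> by \<open>f\<close>, that is, by \<open>T c\<close>, and
  the lower bound on \<open>\<Phi>\<close> recovers \<open>c\<close> from \<open>v\<close>.\<close>
lemma resolvent_bound_imp_transfer_bound:
  assumes W: "rank W = CARD('d)"
    and op: "\<And>u. u \<in> ph_dom a b H W \<Longrightarrow> Aop u \<in> L2 a b" and C: "C > 0"
    and bound: "\<And>t u1 u2. u1 \<in> ph_dom a b H W \<Longrightarrow> u2 \<in> ph_dom a b H W \<Longrightarrow>
      cnrm (u1, u2) \<le> C * cnrm (cscale (\<i> * of_real t) (u1, u2) - (Aop u1, Aop u2))"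
  shows "\<exists>\<tau>>0. \<forall>t c. norm c \<le> \<tau> * norm (transfer W t *v c)"
proof -
  obtain R where R: "W ** R = mat 1"
    using W full_rank_surjective matrix_right_invertible_surjective by blast
  obtain nR where nR: "nR > 0" "\<And>z. norm (cmat R *v z) \<le> norm z * nR"
    using bounded_linear.pos_bounded[OF matrix_vector_mul_bounded_linear] by blast
  obtain n1 n2 where n: "n1 > 0" "\<And>z. norm (cmat P1 *v z) \<le> n1 * norm z"
    using P1_bounds by metis
  obtain \<kappa> where \<kappa>: "\<kappa> > 0" "\<And>t x z. x \<in> {a..b} \<Longrightarrow> norm z \<le> \<kappa> * norm (\<Phi> t x *v z)"
    using flow_lower by metis
  define D where "D = sqrt (M0\<^sup>2 / m * C\<^sup>2 * M0) * \<kappa>"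
  have D: "D > 0" "D\<^sup>2 = M0\<^sup>2 / m * C\<^sup>2 * M0 * \<kappa>\<^sup>2"
    using M0_pos m_pos C \<kappa>(1) by (auto simp: D_def power_mult_distrib)
  let ?q = "(\<kappa> + 1) * nR"
  \<comment> \<open>The first two summands account for \<open>h0\<close> and \<open>k\<close>, the third one for \<open>c - h0 - s k\<close>; its factor
    \<open>n1 * K * ?q / (b - a)\<close> comes from the bound for \<open>f\<close>.\<close>
  define \<tau> where "\<tau> = nR + ?q + D * (n1 * K * ?q / (b - a))"
  have "norm c \<le> \<tau> * norm (transfer W t *v c)" for t c
  proof -
    define \<eta> where "\<eta> = transfer W t *v c"
    define h where "h = cmat R *v \<eta>"
    define h1 where "h1 = (\<chi> i. h $ Inl i)"
    define h0 where "h0 = (\<chi> i. h $ Inr i)"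
    have h: "h = vstack h1 h0"
      by (simp add: vec_eq_iff vstack_def h1_def h0_def split: sum.split)
    have Wh: "cmat W *v h = \<eta>"
    proof (rule vec_complex_eqI)
      have WR: "W *v (R *v z) = z" for z by (simp add: matrix_vector_mul_assoc R)
      show "vec_Re (cmat W *v h) = vec_Re \<eta>" "vec_Im (cmat W *v h) = vec_Im \<eta>"
        unfolding h_def vec_Re_cmat vec_Im_cmat by (rule WR)+
    qed
    have "(norm h1)\<^sup>2 \<le> (norm h)\<^sup>2" "(norm h0)\<^sup>2 \<le> (norm h)\<^sup>2"
      unfolding h norm_vstack_power2 by auto
    then have h_le: "norm h1 \<le> norm h" "norm h0 \<le> norm h" by (auto intro: power2_le_imp_le)
    have h_eta: "norm h \<le> nR * norm \<eta>" using nR(2)[of \<eta>] by (simp add: h_def mult.commute)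
    have ab_in: "a \<in> {a..b}" "b \<in> {a..b}" using ab by auto
    \<comment> \<open>Chosen such that \<open>\<Phi> t b\<close> maps \<open>h0 + k\<close> to \<open>h1\<close>.\<close>
    define k where "k = matrix_inv (\<Phi> t b) *v h1 - h0"
    have \<Phi>k: "\<Phi> t b *v k = h1 - \<Phi> t b *v h0"
      by (simp add: k_def matrix_vector_mult_diff_distrib matrix_inv_vector(1)[OF flow_invertible[OF ab_in(2)]])
    have k_le: "norm k \<le> ?q * norm \<eta>"
    proof -
      have "norm (matrix_inv (\<Phi> t b) *v h1) \<le> \<kappa> * norm h1"
        using \<kappa>(2)[OF ab_in(2), of "matrix_inv (\<Phi> t b) *v h1" t]
        by (simp add: matrix_inv_vector(1)[OF flow_invertible[OF ab_in(2)]])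
      also have "\<dots> \<le> \<kappa> * norm h" using h_le \<kappa>(1) by simp
      finally have "norm k \<le> \<kappa> * norm h + norm h"
        unfolding k_def using h_le(2) by (intro order_trans[OF norm_triangle_ineq4] add_mono)
      also have "\<dots> = (\<kappa> + 1) * norm h" by (simp add: algebra_simps)
      also have "\<dots> \<le> (\<kappa> + 1) * (nR * norm \<eta>)" using h_eta \<kappa>(1) by (intro mult_left_mono) auto
      finally show ?thesis by simp
    qed
    define s where "s x = (x - a) / (b - a)" for x
    have s01: "0 \<le> s x" "s x \<le> 1" if "x \<in> {a..b}" for x using that ab by (auto simp: s_def)
    have s_prim: "primitive a b s (\<lambda>_. 1 / (b - a))"
      using ab by (intro primitive_C1)
        (auto simp: s_def[abs_def] has_real_derivative_iff_has_vector_derivative[symmetric] intro!: derivative_eq_intros)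
    define v where "v x = \<Phi> t x *v (c - h0) - s x *\<^sub>R (\<Phi> t x *v k)" for x
    define f where "f x = (1 / (b - a)) *\<^sub>R (cmat P1 *v (\<Phi> t x *v k))" for x
    define g where "g x = ph_coeff H P1 P0 t x *v v x - cmat (matrix_inv P1) *v f x" for x
    have scale: "A *v (r *\<^sub>R z) = r *\<^sub>R (A *v z)" for A :: "complex^'d^'d" and r :: real and z
      by (rule linear_cmul[OF bounded_linear.linear[OF matrix_vector_mul_bounded_linear]])
    have g_prim: "primitive a b v g"
    proof (rule primitive_cong[OF primitive_diff[OF flow_vector_primitive[of t "c - h0"]
            primitive_product[OF bounded_bilinear_scaleR s_prim flow_vector_primitive[of t k]]]])
      show "v x = \<Phi> t x *v (c - h0) - s x *\<^sub>R (\<Phi> t x *v k)" for x by (simp add: v_def)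
      show "g x = ph_coeff H P1 P0 t x *v (\<Phi> t x *v (c - h0))
          - ((1 / (b - a)) *\<^sub>R (\<Phi> t x *v k) + s x *\<^sub>R (ph_coeff H P1 P0 t x *v (\<Phi> t x *v k)))" for x
        unfolding g_def f_def v_def
        by (simp only: matrix_vector_mult_diff_distrib scale cmat_inverse_vector[OF P1_inv])
          (simp only: diff_diff_eq add.assoc add.commute add.left_commute)
    qed
    define \<rho> where "\<rho> = n1 * K * (?q * norm \<eta>) / (b - a)"
    have \<rho>0: "\<rho> \<ge> 0" using n(1) K_pos \<kappa>(1) nR(1) ab by (simp add: \<rho>_def)
    have f_le: "norm (f x) \<le> \<rho>" if x: "x \<in> {a..b}" for x
    proof -
      have "norm (cmat P1 *v (\<Phi> t x *v k)) \<le> n1 * (K * (?q * norm \<eta>))"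
        using flow_upper[OF x, of t k] k_le n K_pos
        by (intro order_trans[OF n(2)] mult_left_mono order_trans[OF flow_upper[OF x]]) auto
      then show ?thesis using ab by (simp add: f_def \<rho>_def divide_right_mono mult.assoc)
    qed
    obtain Cv where Cv: "\<And>x. x \<in> {a..b} \<Longrightarrow> norm (v x) \<le> Cv"
      using compact_imp_bounded[OF compact_continuous_image[OF primitive_continuous[OF g_prim]]]
      unfolding bounded_iff by blast
    obtain Cc where Cc: "\<And>x z. x \<in> {a<..<b} \<Longrightarrow> norm (ph_coeff H P1 P0 t x *v z) \<le> Cc * norm z" "Cc > 0"
      using coeff_bound[where t = t] by metis
    obtain ni where ni: "ni > 0" "\<And>z. norm (cmat (matrix_inv P1) *v z) \<le> norm z * ni"
      using bounded_linear.pos_bounded[OF matrix_vector_mul_bounded_linear] by blast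
    have g_L2: "g \<in> L2 a b"
    proof (rule bounded_imp_L2)
      have "integrable L g" using primitive_absolutely_integrable[OF g_prim] by (simp add: lebesgue_on_open_interval(1))
      then show "g \<in> borel_measurable L" by simp
      fix x assume x: "x \<in> {a<..<b}"
      have "norm (ph_coeff H P1 P0 t x *v v x) \<le> Cc * Cv"
        using Cc(2) x by (intro order_trans[OF Cc(1)[OF x]] mult_left_mono Cv) auto
      moreover have "norm (cmat (matrix_inv P1) *v f x) \<le> \<rho> * ni"
        using ni(1) x by (intro order_trans[OF ni(2)] mult_right_mono f_le) auto
      ultimately show "norm (g x) \<le> Cc * Cv + \<rho> * ni"
        unfolding g_def by (intro order_trans[OF norm_triangle_ineq4] add_mono)
    qed
    have "vstack (v b) (v a) = vstack (\<Phi> t b *v c) c - h"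
      using ab by (simp add: v_def s_def \<Phi>k h vstack_diff flow_start matrix_vector_mult_diff_distrib)
    then have bc: "cmat W *v vstack (v b) (v a) = 0"
      by (simp add: matrix_vector_mult_diff_distrib Wh \<eta>_def transfer_vector)
    have bcR: "W *v vstack (vec_Re (v b)) (vec_Re (v a)) = 0" and bcI: "W *v vstack (vec_Im (v b)) (vec_Im (v a)) = 0"
      using arg_cong[OF bc, of vec_Re] arg_cong[OF bc, of vec_Im] by (simp_all add: vec_Re_vstack vec_Im_vstack)
    define u1 where "u1 = (\<lambda>x. Hinv x *v vec_Re (v x))"
    define u2 where "u2 = (\<lambda>x. Hinv x *v vec_Im (v x))"
    note sd1 = state_domain[OF primitive_linear[OF bounded_linear_vec_Re g_prim] L2_linear[OF bounded_linear_vec_Re g_L2] bcR,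
        folded u1_def]
    note sd2 = state_domain[OF primitive_linear[OF bounded_linear_vec_Im g_prim] L2_linear[OF bounded_linear_vec_Im g_L2] bcI,
        folded u2_def]
    have dom: "u1 \<in> ph_dom a b H W" "u2 \<in> ph_dom a b H W" by (rule sd1(1), rule sd2(1))
    have uL: "u1 \<in> L2 a b" "u2 \<in> L2 a b" using dom by (auto simp: ph_dom_def)
    define r1 where "r1 = (- t) *\<^sub>R u2 - Aop u1"
    define r2 where "r2 = t *\<^sub>R u1 - Aop u2"
    have r: "cscale (\<i> * of_real t) (u1, u2) - (Aop u1, Aop u2) = (r1, r2)"
      by (simp add: cscale_def r1_def r2_def)
    have rL: "r1 \<in> L2 a b" "r2 \<in> L2 a b" unfolding r1_def r2_def using uL op dom by blast+
    have inD: "AE x in L. x \<in> {a<..<b}" by (rule AE_I2) simp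
    have "AE x in L. vec_Complex (r1 x) (r2 x) = f x"
      using sd1(2)[OF op[OF dom(1)]] sd2(2)[OF op[OF dom(2)]]
    proof eventually_elim
      case (elim x)
      then show ?case
        by (intro vec_complex_eqI)
          (simp_all add: r1_def r2_def scaleR_fun_def u1_def u2_def g_def coeff_vector matrix_vector_mult_diff_distrib
            matrix_inv_vector[OF P1_inv])
    qed
    then have "AE x in L. norm (vec_Complex (r1 x) (r2 x)) \<le> \<rho>"
      using inD by eventually_elim (simp add: f_le)
    then have "(LINT x|L. (norm (vec_Complex (r1 x) (r2 x)))\<^sup>2) \<le> (b - a) * \<rho>\<^sup>2"
      by (intro integral_power2_le L2_vec_Complex rL \<rho>0)
    then have "M0 * (LINT x|L. (norm (vec_Complex (r1 x) (r2 x)))\<^sup>2) \<le> M0 * ((b - a) * \<rho>\<^sup>2)"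
      using M0_pos by (intro mult_left_mono) auto
    then have r_le: "(cnrm (r1, r2))\<^sup>2 \<le> M0 * ((b - a) * \<rho>\<^sup>2)"
      using pair_nrm_bounds(2)[OF rL] by linarith
    have nonneg: "0 \<le> cnrm (u1, u2)"
      using semi_inner_product.nrm_ge0[OF E.pair_space, of "(u1, u2)"] uL by simp
    have "(cnrm (u1, u2))\<^sup>2 \<le> (C * cnrm (r1, r2))\<^sup>2"
      using bound[OF dom, of t] nonneg unfolding r by (intro power_mono)
    also have "\<dots> \<le> C\<^sup>2 * (M0 * ((b - a) * \<rho>\<^sup>2))"
      unfolding power_mult_distrib by (intro mult_left_mono r_le) auto
    finally have u_le: "(cnrm (u1, u2))\<^sup>2 \<le> C\<^sup>2 * (M0 * ((b - a) * \<rho>\<^sup>2))" .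
    \<comment> \<open>At every point \<open>\<delta> \<le> \<kappa> * norm (v x)\<close>; this is squared and integrated to bring in the energy norm.\<close>
    define \<delta> where "\<delta> = norm c - norm h0 - norm k"
    have "\<delta> \<le> D * \<rho>"
    proof (cases "\<delta> \<le> 0")
      case True
      then show ?thesis using D(1) \<rho>0 by (meson mult_nonneg_nonneg less_imp_le order_trans)
    next
      case False
      interpret finite_measure L by (rule finite_measure_lebesgue_on) simp
      have vL: "v \<in> L2 a b" by (rule continuous_L2[OF primitive_continuous[OF g_prim]])
      have pt: "(\<delta> / \<kappa>)\<^sup>2 \<le> M0\<^sup>2 * (norm (vec_Complex (u1 x) (u2 x)))\<^sup>2" if x: "x \<in> {a<..<b}" for x
      proof -
        have x': "x \<in> {a..b}" using x by auto
        let ?z = "c - h0 - s x *\<^sub>R k"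
        have "v x = \<Phi> t x *v ?z" by (simp add: v_def matrix_vector_mult_diff_distrib scale)
        then have z: "norm ?z \<le> \<kappa> * norm (v x)" using \<kappa>(2)[OF x', of ?z t] by simp
        have "c = ?z + h0 + s x *\<^sub>R k" by simp
        then have "norm c \<le> norm ?z + norm h0 + norm (s x *\<^sub>R k)"
          by (metis norm_triangle_ineq norm_triangle_le add_mono order_refl)
        also have "norm (s x *\<^sub>R k) \<le> norm k" using s01[OF x'] by (simp add: mult_left_le_one_le)
        finally have "\<delta> \<le> \<kappa> * norm (v x)" using z by (simp add: \<delta>_def)
        then have "(\<delta> / \<kappa>)\<^sup>2 \<le> (norm (v x))\<^sup>2"
          using False \<kappa>(1) by (intro power_mono) (auto simp: field_simps)
        also have "\<dots> = (norm (H x *v u1 x))\<^sup>2 + (norm (H x *v u2 x))\<^sup>2"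
          by (simp add: u1_def u2_def H_Hinv[OF x] norm_vec_complex_power2[of "v x"])
        also have "\<dots> \<le> (M0 * norm (u1 x))\<^sup>2 + (M0 * norm (u2 x))\<^sup>2"
          by (intro add_mono power_mono H_norm x) auto
        also have "\<dots> = M0\<^sup>2 * (norm (vec_Complex (u1 x) (u2 x)))\<^sup>2"
          by (simp only: norm_vec_complex_power2[of "vec_Complex (u1 x) (u2 x)"] vec_Re_Im_Complex
              power_mult_distrib distrib_left)
        finally show ?thesis .
      qed
      have "(b - a) * (\<delta> / \<kappa>)\<^sup>2 = (LINT x|L. (\<delta> / \<kappa>)\<^sup>2)" using ab by (simp add: measure_restrict_space)
      also have "\<dots> \<le> (LINT x|L. M0\<^sup>2 * (norm (vec_Complex (u1 x) (u2 x)))\<^sup>2)"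
        using L2_vec_Complex[OF uL] pt by (intro integral_mono) (auto simp: L2_def)
      also have "\<dots> = M0\<^sup>2 / m * (m * (LINT x|L. (norm (vec_Complex (u1 x) (u2 x)))\<^sup>2))" using m_pos by simp
      also have "\<dots> \<le> M0\<^sup>2 / m * (C\<^sup>2 * (M0 * ((b - a) * \<rho>\<^sup>2)))"
        using pair_nrm_bounds(1)[OF uL] u_le m_pos by (intro mult_left_mono) auto
      also have "\<dots> = (b - a) * (M0\<^sup>2 / m * C\<^sup>2 * M0 * \<rho>\<^sup>2)" by simp
      finally have "(\<delta> / \<kappa>)\<^sup>2 \<le> M0\<^sup>2 / m * C\<^sup>2 * M0 * \<rho>\<^sup>2" using ab by (simp only: mult_le_cancel_left_pos diff_gt_0_iff_gt)
      then have "\<kappa>\<^sup>2 * (\<delta> / \<kappa>)\<^sup>2 \<le> \<kappa>\<^sup>2 * (M0\<^sup>2 / m * C\<^sup>2 * M0 * \<rho>\<^sup>2)" by (intro mult_left_mono) auto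
      moreover have "\<kappa>\<^sup>2 * (\<delta> / \<kappa>)\<^sup>2 = \<delta>\<^sup>2" using \<kappa>(1) by (simp add: power_divide)
      moreover have "\<kappa>\<^sup>2 * (M0\<^sup>2 / m * C\<^sup>2 * M0 * \<rho>\<^sup>2) = (D * \<rho>)\<^sup>2"
        unfolding power_mult_distrib D(2) by simp
      ultimately have "\<delta>\<^sup>2 \<le> (D * \<rho>)\<^sup>2" by simp
      then show ?thesis by (rule power2_le_imp_le) (use D(1) \<rho>0 in auto)
    qed
    then have "norm c \<le> norm h0 + norm k + D * \<rho>" by (simp add: \<delta>_def)
    also have "\<dots> \<le> nR * norm \<eta> + ?q * norm \<eta> + D * \<rho>"
      using k_le h_le(2) h_eta by (intro add_mono) auto
    also have "\<dots> = \<tau> * norm \<eta>" by (simp add: \<tau>_def \<rho>_def algebra_simps)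
    finally show ?thesis by (simp add: \<eta>_def)
  qed
  moreover have "\<tau> > 0"
    unfolding \<tau>_def using nR(1) \<kappa>(1) D(1) n(1) K_pos ab
    by (intro add_pos_pos mult_pos_pos divide_pos_pos) auto
  ultimately show ?thesis by blast
qed

end

section \<open>Exponential stability\<close>

text \<open>The pointwise identities between functions are identities in the vector space of functions.\<close>
lemma C0_semigroup_imp_seminormed_semigroup:
  fixes V :: "('x \<Rightarrow> 'e::real_vector) set"
  assumes inner: "semi_inner_product V B" and S: "C0_semigroup V (semi_inner_product.nrm B) S"
  shows "seminormed_semigroup V B S"
proof -
  interpret semi_inner_product V B by (rule inner)
  have bd: "bounded_op V nrm (S t)" if "0 \<le> t" for t using S that by (simp add: C0_semigroup_def)
  show ?thesis
  proof (intro seminormed_semigroup.intro inner seminormed_semigroup_axioms.intro)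
    fix t :: real and u v :: "'x \<Rightarrow> 'e" and \<alpha> \<beta> :: real
    assume t: "0 \<le> t" and u: "u \<in> V"
    have Sin: "S t u \<in> V" if "u \<in> V" for u using bd[OF t] that by (simp add: bounded_op_def)
    then show "S t u \<in> V" using u .
    assume v: "v \<in> V"
    have "nrm (\<lambda>x. S t (\<lambda>y. \<alpha> *\<^sub>R u y + \<beta> *\<^sub>R v y) x - (\<alpha> *\<^sub>R S t u x + \<beta> *\<^sub>R S t v x)) = 0"
      using bd[OF t] u v unfolding bounded_op_def by blast
    then have "nrm (S t (\<alpha> *\<^sub>R u + \<beta> *\<^sub>R v) - (\<alpha> *\<^sub>R S t u + \<beta> *\<^sub>R S t v)) = 0"
      unfolding scaleR_fun_def plus_fun_def fun_diff_def .
    then show "eqv (S t (\<alpha> *\<^sub>R u + \<beta> *\<^sub>R v)) (\<alpha> *\<^sub>R S t u + \<beta> *\<^sub>R S t v)"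
      using u v Sin by (simp add: eqv_def)
  next
    fix t :: real assume "0 \<le> t"
    then show "\<exists>C. \<forall>u\<in>V. nrm (S t u) \<le> C * nrm u" using bd[of t] by (simp add: bounded_op_def)
  next
    fix u assume u: "u \<in> V"
    have "nrm (S 0 u - u) = 0" using S u unfolding C0_semigroup_def fun_diff_def by blast
    moreover have "S 0 u \<in> V" using bd[of 0] u by (simp add: bounded_op_def)
    ultimately show "eqv (S 0 u) u" using u by (simp add: eqv_def)
  next
    fix s t :: real and u assume st: "0 \<le> s" "0 \<le> t" and u: "u \<in> V"
    have "nrm (S (s + t) u - S s (S t u)) = 0" using S st u unfolding C0_semigroup_def fun_diff_def by blast
    moreover have "S r w \<in> V" if "0 \<le> r" "w \<in> V" for r w using bd[of r] that by (simp add: bounded_op_def)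
    ultimately show "eqv (S (s + t) u) (S s (S t u))" using st u by (simp add: eqv_def)
  qed
qed

lemma gen_limit_iff:
  fixes V :: "('x \<Rightarrow> 'e::real_vector) set"
  assumes "seminormed_semigroup V B S"
  shows "seminormed_semigroup.gen V B S u f \<longleftrightarrow> u \<in> V \<and> f \<in> V \<and> gen_limit (semi_inner_product.nrm B) S u f"
  unfolding seminormed_semigroup.gen_def[OF assms] gen_limit_def scaleR_fun_def fun_diff_def ..

theorem theorem1p2:
  fixes a b :: real
    and P1 P0 :: "real^'d^'d"
    and H :: "real \<Rightarrow> real^'d^'d"
    and W :: "real^('d + 'd)^'d"
    and \<Phi> :: "real \<Rightarrow> real \<Rightarrow> complex^'d^'d"
  defines "V \<equiv> (L2 a b :: (real \<Rightarrow> real^'d) set)"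
    and "p \<equiv> ph_norm a b H"
    and "D \<equiv> ph_dom a b H W"
    and "A \<equiv> ph_op a b H P1 P0"
    and "W' \<equiv> W ** matrix_inv (block_mat P1 (- P1) (mat 1) (mat 1))"
    and "T \<equiv> (\<lambda>t. cmat W ** vstack (\<Phi> t b) (mat 1))"
  assumes "a < b"
    and "transpose P1 = P1" and "invertible P1"
    and "transpose P0 = - P0"
    and "H \<in> borel_measurable (lebesgue_on {a<..<b})"
    and "\<exists>m>0. \<exists>M0>0. \<forall>x\<in>{a<..<b}.
           transpose (H x) = H x \<and> psd (H x - mat m) \<and> psd (mat M0 - H x)"
    and "rank W = CARD('d)"
    and "psd (W' ** block_mat (mat 0) (mat 1) (mat 1) (mat 0) ** transpose W')"
    and "m_dissipative V p D A"
    and "\<And>t. fundamental_solution a b (ph_coeff H P1 P0 t) (\<Phi> t)"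
    and "bdd_above {op_norm (\<Phi> t x) | t x. x \<in> {a<..<b}}"
  shows "(\<exists>S. C0_semigroup V p S \<and> generates V p D A S \<and> exp_stable V p S) \<longleftrightarrow>
         (\<forall>t. invertible (T t)) \<and> bdd_above (range (\<lambda>t. op_norm (matrix_inv (T t))))"
proof -
  obtain m M0 where mM: "0 < m" "0 < M0" and H: "\<forall>x\<in>{a<..<b}.
      transpose (H x) = H x \<and> psd (H x - mat m) \<and> psd (mat M0 - H x)"
    using assms(12) by blast
  have mat_real: "mat c *v v = c *\<^sub>R v" for c and v :: "real^'d"
    by (simp add: mat_vector scalar_mult_eq_scaleR)
  obtain K0 where K0: "\<And>t x. x \<in> {a<..<b} \<Longrightarrow> op_norm (\<Phi> t x) \<le> K0"
    using assms(17) unfolding bdd_above_def by blast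
  \<comment> \<open>The maximum with \<open>1\<close> makes the bound on the fundamental solutions positive.\<close>
  interpret port_hamiltonian_flow a b m M0 P1 P0 H \<Phi> "max K0 1"
  proof
    fix x v assume x: "x \<in> {a<..<b}"
    show "transpose (H x) = H x" using H x by blast
    have "0 \<le> v \<bullet> ((H x - mat m) *v v)" "0 \<le> v \<bullet> ((mat M0 - H x) *v v)"
      using H x unfolding psd_def by blast+
    then show "m * (v \<bullet> v) \<le> v \<bullet> (H x *v v)" "v \<bullet> (H x *v v) \<le> M0 * (v \<bullet> v)"
      by (simp_all add: matrix_vector_mult_diff_rdistrib mat_real inner_diff_right)
  next
    fix x t assume "x \<in> {a<..<b}"
    then show "op_norm (\<Phi> t x) \<le> max K0 1" using K0[of x t] by simp
  qed (use assms mM in auto)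
  have p: "p = E.nrm" by (simp add: p_def energy_nrm)
  interpret P: semi_inner_product "L2 a b \<times> L2 a b" "pair_form (ph_inner a b H)" by (rule E.pair_space)
  have gen_op: "u \<in> D \<and> E.eqv f (A u)" if "seminormed_semigroup V (ph_inner a b H) S" "generates V p D A S"
    "seminormed_semigroup.gen V (ph_inner a b H) S u f" for S u f
  proof -
    interpret S: seminormed_semigroup "L2 a b" "ph_inner a b H" S using that(1) unfolding V_def .
    have uf: "u \<in> V" "f \<in> V" "gen_limit p S u f"
      using that(3) unfolding gen_limit_iff[OF that(1)] p by auto
    then have u: "u \<in> D" using that(2) unfolding generates_def by blast
    then have "A u \<in> V" "gen_limit p S u (A u)" using that(2) unfolding generates_def by blast+
    then have "S.gen u (A u)" using uf gen_limit_iff[OF that(1), of u "A u"] unfolding p V_def by blast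
    moreover have "S.gen u f" using that(3) unfolding V_def .
    ultimately show ?thesis using u S.gen_unique by blast
  qed
  have op_gen: "A u \<in> V \<and> seminormed_semigroup.gen V (ph_inner a b H) S u (A u)"
    if "seminormed_semigroup V (ph_inner a b H) S" "generates V p D A S" "u \<in> D" for S u
    using that(2,3) unfolding gen_limit_iff[OF that(1)] generates_def p by blast
  show ?thesis
  proof
    assume "\<exists>S. C0_semigroup V p S \<and> generates V p D A S \<and> exp_stable V p S"
    then obtain S where S: "C0_semigroup V p S" "generates V p D A S" "exp_stable V p S" by blast
    have sg: "seminormed_semigroup V (ph_inner a b H) S"
      using C0_semigroup_imp_seminormed_semigroup[OF energy_space] S(1) unfolding V_def p .
    interpret S: seminormed_semigroup "L2 a b" "ph_inner a b H" S using sg unfolding V_def .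
    obtain C \<omega> where C: "C \<ge> 1" "\<omega> > 0" "\<And>t u. 0 \<le> t \<Longrightarrow> u \<in> L2 a b \<Longrightarrow> E.nrm (S t u) \<le> C * exp (- \<omega> * t) * E.nrm u"
      using S(3) unfolding exp_stable_def p V_def by blast
    have op: "A u \<in> L2 a b" "S.gen u (A u)" if "u \<in> D" for u
      using op_gen[OF sg S(2) that] unfolding V_def by blast+
    have "\<exists>\<tau>>0. \<forall>t c. norm c \<le> \<tau> * norm (transfer W t *v c)"
    proof (rule resolvent_bound_imp_transfer_bound[OF assms(13)])
      show "Aop u \<in> L2 a b" if "u \<in> ph_dom a b H W" for u using op(1)[of u] that by (simp add: A_def D_def)
      show "C / \<omega> > 0" using C by simp
      fix t u1 u2 assume "u1 \<in> ph_dom a b H W" "u2 \<in> ph_dom a b H W"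
      then have "S.gen u1 (Aop u1)" "S.gen u2 (Aop u2)" using op(2) by (simp_all add: A_def D_def)
      from S.complex_lower_bound[where \<mu> = "\<i> * of_real t" and \<omega> = \<omega> and C = C, OF _ _ C(3) this]
      show "cnrm (u1, u2) \<le> C / \<omega> * cnrm (cscale (\<i> * of_real t) (u1, u2) - (Aop u1, Aop u2))"
        using C by simp
    qed
    then obtain \<tau> where \<tau>: "\<tau> > 0" "\<And>t c. norm c \<le> \<tau> * norm (T t *v c)" unfolding T_def by blast
    have inv: "invertible (T t)" for t
    proof (rule injective_bound_imp_invertible)
      fix c assume "T t *v c = 0"
      then show "c = 0" using \<tau>(2)[of c t] by simp
    qed
    have "op_norm (matrix_inv (T t)) \<le> \<tau>" for t
      unfolding op_norm_def
    proof (rule onorm_le)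
      fix y
      show "norm (matrix_inv (T t) *v y) \<le> \<tau> * norm y"
        using \<tau>(2)[of "matrix_inv (T t) *v y" t] by (simp add: matrix_inv_vector(1)[OF inv])
    qed
    then show "(\<forall>t. invertible (T t)) \<and> bdd_above (range (\<lambda>t. op_norm (matrix_inv (T t))))"
      using inv by (auto simp: bdd_above_def)
  next
    assume ii: "(\<forall>t. invertible (T t)) \<and> bdd_above (range (\<lambda>t. op_norm (matrix_inv (T t))))"
    then obtain B where B: "\<And>t. op_norm (matrix_inv (T t)) \<le> B" unfolding bdd_above_def by blast
    have \<tau>: "norm c \<le> max B 0 * norm (transfer W t *v c)" for t c
    proof -
      have "norm c = norm (matrix_inv (T t) *v (T t *v c))" using ii by (simp add: matrix_inv_vector(2))
      also have "\<dots> \<le> op_norm (matrix_inv (T t)) * norm (T t *v c)" by (rule op_norm_bound)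
      also have "\<dots> \<le> max B 0 * norm (T t *v c)" using B[of t] by (intro mult_right_mono) auto
      finally show ?thesis by (simp add: T_def)
    qed
    have "\<exists>C>0. \<forall>t. \<forall>u1\<in>ph_dom a b H W. \<forall>u2\<in>ph_dom a b H W. Aop u1 \<in> L2 a b \<longrightarrow> Aop u2 \<in> L2 a b
      \<longrightarrow> cnrm (u1, u2) \<le> C * cnrm (cscale (\<i> * of_real t) (u1, u2) - (Aop u1, Aop u2))"
      by (rule transfer_bound_imp_resolvent_bound[OF _ \<tau>]) simp
    then obtain C where C: "C > 0" "\<And>t u1 u2. u1 \<in> D \<Longrightarrow> u2 \<in> D \<Longrightarrow> A u1 \<in> L2 a b \<Longrightarrow> A u2 \<in> L2 a b
      \<Longrightarrow> cnrm (u1, u2) \<le> C * cnrm (cscale (\<i> * of_real t) (u1, u2) - (A u1, A u2))"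
      unfolding A_def D_def by blast
    obtain S where S: "contraction_semigroup V p S" "generates V p D A S"
      using assms(15) unfolding m_dissipative_def by blast
    then have C0: "C0_semigroup V p S" by (simp add: contraction_semigroup_def)
    have sg: "seminormed_semigroup V (ph_inner a b H) S"
      using C0_semigroup_imp_seminormed_semigroup[OF energy_space] C0 unfolding V_def p .
    interpret S: seminormed_semigroup "L2 a b" "ph_inner a b H" S using sg unfolding V_def .
    have "S.imag_axis_bound C"
      unfolding S.imag_axis_bound_def
    proof (intro allI impI)
      fix t u v f g assume uv: "S.gen u f" "S.gen v g"
      have u: "u \<in> D" "E.eqv f (A u)" and v: "v \<in> D" "E.eqv g (A v)"
        using gen_op[OF sg S(2), unfolded V_def] uv by blast+
      have Au: "A u \<in> L2 a b" "A v \<in> L2 a b" using u v by (auto dest: E.eqv_in)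
      have uvL: "(u, v) \<in> L2 a b \<times> L2 a b" using uv by (auto dest: S.gen_in)
      have "P.eqv (f, g) (A u, A v)" using u v by (simp add: E.pair_eqv_iff)
      then have "P.nrm (cscale (\<i> * of_real t) (u, v) - (f, g)) = P.nrm (cscale (\<i> * of_real t) (u, v) - (A u, A v))"
        using uvL by (intro P.eqv_nrm P.eqv_diff P.eqv_refl E.cscale_in)
      then show "P.nrm (u, v) \<le> C * P.nrm (cscale (\<i> * of_real t) (u, v) - (f, g))"
        using C(2)[OF u(1) v(1) Au, of t] by simp
    qed
    then have "\<exists>C\<ge>1. \<exists>\<omega>>0. \<forall>t\<ge>0. \<forall>u\<in>L2 a b. E.nrm (S t u) \<le> C * exp (- \<omega> * t) * E.nrm u"
    proof (rule S.contraction_exp_stable[rotated 2])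
      show "E.nrm (S t u) \<le> E.nrm u" if "0 \<le> t" "u \<in> L2 a b" for t u
        using S(1) that unfolding contraction_semigroup_def p V_def by blast
      show "((\<lambda>t. E.nrm (S t u - u)) \<longlongrightarrow> 0) (at_right 0)" if "u \<in> L2 a b" for u
        using C0 that unfolding C0_semigroup_def p V_def fun_diff_def by blast
      show "\<exists>u f. S.gen u f \<and> E.nrm (v - u) < e" if v: "v \<in> L2 a b" "e > 0" for v e
      proof -
        obtain w where "w \<in> D" "E.nrm (v - w) < e" using domain_dense[OF v] unfolding D_def by blast
        then show ?thesis using op_gen[OF sg S(2), of w] unfolding V_def by blast
      qed
    qed (rule C(1))
    then have "exp_stable V p S" unfolding exp_stable_def p V_def .
    then show "\<exists>S. C0_semigroup V p S \<and> generates V p D A S \<and> exp_stable V p S" using C0 S(2) by blast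
  qed
qed

end
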